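(* Let $m = e^{-V}\mathcal{L}^n$ be a probability measure on $\mathbb{R}^n$ such that $V \in C^{\infty}(\mathbb{R}^n)$ satisfies $\kappa \leq \nabla^2 V\leq \kappa'$ for some $\kappa, \kappa'>0$, and let $f \in H^1(\mathbb{R}^n, m) \cap C^{\infty}(\mathbb{R}^n)$ have bounded second derivatives. Assume the following two conditions: (i) $\int_{\mathbb{R}^n}f \,dm =0$. (ii) $\int_{\mathbb{R}^n}xf(x) \,dm(x) = 0$. Then \[ \kappa\left(1+\frac{\kappa}{\kappa'}\right)\int_{\mathbb{R}^n} f^2 \,dm \leq \int_{\mathbb{R}^n} \|\nabla f\|_2^2 \,dm. \] In particular, when $m=\gamma_n$, for any $f\in H^1(\mathbb{R}^n, \gamma_n) \cap C^{\infty}(\mathbb{R}^n)$ with bounded second derivatives, $\int_{\mathbb{R}^n}f \,d\gamma_n =0$ and $\int_{\mathbb{R}^n}\nabla f \,d\gamma_n =0$, we have \[ 2\int_{\mathbb{R}^n} f^2 \,d\gamma_n \leq \int_{\mathbb{R}^n} \|\nabla f\|_2^2 \,d\gamma_n. \]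
   Context: $\mathcal{L}^n$ is the Lebesgue measure on $\mathbb{R}^n$; $\gamma_n$ is the standard Gaussian measure on $\mathbb{R}^n$. $\kappa\le\nabla^2V\le\kappa'$ means $\kappa I_n\le\nabla^2V(x)\le\kappa' I_n$ as symmetric matrices for every $x$. $H^1(\mathbb{R}^n,m)$ is the Sobolev space of functions $f\in L^2(m)$ with weak gradient in $L^2(m)$. *)

theory Defs
  imports "HOL-Probability.Probability"
begin

(* Only meaningful where f is Frechet differentiable. *)

definition partial :: "'n::finite \<Rightarrow> (real^'n \<Rightarrow> real) \<Rightarrow> real^'n \<Rightarrow> real" where
  "partial i f x = frechet_derivative f (at x) (axis i 1)"

definition gradient :: "(real^'n::finite \<Rightarrow> real) \<Rightarrow> real^'n \<Rightarrow> real^'n" where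
  "gradient f x = (\<chi> i. partial i f x)"

definition hessian :: "(real^'n::finite \<Rightarrow> real) \<Rightarrow> real^'n \<Rightarrow> real^'n^'n" where
  "hessian f x = (\<chi> i j. partial i (partial j f) x)"

primrec Ck :: "nat \<Rightarrow> (real^'n::finite \<Rightarrow> real) \<Rightarrow> bool" where
  "Ck 0 f \<longleftrightarrow> continuous_on UNIV f"
| "Ck (Suc k) f \<longleftrightarrow> f differentiable_on UNIV \<and> (\<forall>i. Ck k (partial i f))"

definition smooth :: "(real^'n::finite \<Rightarrow> real) \<Rightarrow> bool" where
  "smooth f \<longleftrightarrow> (\<forall>k. Ck k f)"

(* The order of quadratic forms; used only for symmetric matrices. *)

definition loewner_le :: "real^'n^'n \<Rightarrow> real^'n^'n::finite \<Rightarrow> bool" where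
  "loewner_le A B \<longleftrightarrow> (\<forall>v. v \<bullet> (A *v v) \<le> v \<bullet> (B *v v))"

definition test_function :: "(real^'n::finite \<Rightarrow> real) \<Rightarrow> bool" where
  "test_function \<phi> \<longleftrightarrow> smooth \<phi> \<and> compact (closure {x. \<phi> x \<noteq> 0})"

definition locally_integrable :: "(real^'n::finite \<Rightarrow> 'b::{banach,second_countable_topology}) \<Rightarrow> bool" where
  "locally_integrable f \<longleftrightarrow> (\<forall>K. compact K \<longrightarrow> set_integrable lborel K f)"

(* The weak gradient is taken in the sense of distributions, i.e. by integration by parts
   against Lebesgue measure, whatever the measure m of the Sobolev space below. *)

definition weak_gradient :: "(real^'n::finite \<Rightarrow> real) \<Rightarrow> (real^'n \<Rightarrow> real^'n) \<Rightarrow> bool" where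
  "weak_gradient f g \<longleftrightarrow> locally_integrable f \<and> locally_integrable g \<and>
     (\<forall>\<phi>. test_function \<phi> \<longrightarrow>
        (LINT x|lborel. f x *\<^sub>R gradient \<phi> x) = - (LINT x|lborel. \<phi> x *\<^sub>R g x))"

definition L2 :: "'a measure \<Rightarrow> ('a \<Rightarrow> 'b::euclidean_space) set" where
  "L2 m = {f \<in> borel_measurable m. integrable m (\<lambda>x. (norm (f x))\<^sup>2)}"

definition H1 :: "(real^'n::finite) measure \<Rightarrow> (real^'n \<Rightarrow> real) set" where
  "H1 m = {f \<in> L2 m. \<exists>g \<in> L2 m. weak_gradient f g}"

definition gibbs :: "(real^'n::finite \<Rightarrow> real) \<Rightarrow> (real^'n) measure" where
  "gibbs V = density lborel (\<lambda>x. ennreal (exp (- V x)))"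

definition std_gaussian :: "(real^'n::finite) measure" where
  "std_gaussian = density lborel
     (\<lambda>x. ennreal ((2 * pi) powr (- real CARD('n) / 2) * exp (- (norm x)\<^sup>2 / 2)))"

end

theory Submission
  imports Defs
begin

text \<open>
  Write \<open>w = exp (- V)\<close> and \<open>L u = \<Delta>u - \<nabla>V \<bullet> \<nabla>u\<close>, so that \<open>\<langle>g, L u\<rangle> = - \<langle>\<nabla>g, \<nabla>u\<rangle>\<close> in \<open>L\<^sup>2(w)\<close>.
  If \<open>L u = f\<close>, then \<open>\<integral>x f w = 0\<close> says that \<open>\<nabla>u\<close> has mean zero. Bochner's formula
  \<open>\<parallel>L u\<parallel>\<^sup>2 = \<parallel>\<nabla>\<^sup>2u\<parallel>\<^sup>2 + \<langle>\<nabla>u, \<nabla>\<^sup>2V \<nabla>u\<rangle>\<close> and the Poincare inequality for the components of \<open>\<nabla>u\<close> then give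
  \<open>\<parallel>f\<parallel>\<^sup>2 \<ge> 2 \<kappa> \<parallel>\<nabla>u\<parallel>\<^sup>2\<close>, and by duality \<open>2 \<kappa> \<parallel>f\<parallel>\<^sup>2 \<le> \<parallel>\<nabla>f\<parallel>\<^sup>2\<close>, which is stronger than the claim
  because \<open>\<kappa> \<le> \<kappa>'\<close>. The equation need not be solved: it suffices that \<open>{L u | u \<in> C\<^sub>c\<^sup>3}\<close> is dense in the mean-zero
  part of \<open>L\<^sup>2(w)\<close>. Near-minimizers of \<open>\<parallel>f - L u\<parallel>\<close> are almost orthogonal to this range, and a mollification
  argument (Weyl's lemma) shows that they are almost constant, hence small.
\<close>

section \<open>Functions of class \<open>C\<^sup>k\<close>\<close>

text \<open>Solving L u = f would call for a complete Hilbert space and elliptic regularity. Both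
  are avoided by keeping to continuous functions: a near-minimizer \<open>f - L u\<close> with u in
  C_c^3 is itself continuous, and no limit object has to be constructed. The price is that Weyl's
  lemma must be quantitative: for a fixed mean-zero test function, one tolerance has to serve all h
  with ||h||^2 \<le> A at once. Duality means <g, L u>^2 = <\<nabla>g, \<nabla>u>^2 \<le>
  ||\<nabla>g||^2 ||\<nabla>u||^2 combined with K ||\<nabla>u||^2 \<le> ||L u||^2; letting L u tend
  to g leaves K ||g||^2 \<le> ||\<nabla>g||^2. It is run twice. With K = \<kappa> the Hessian term
  of Bochner's formula is dropped, which yields the Poincare inequality; applied to the components
  of \<nabla>u, that inequality extracts a second \<kappa> from the Hessian term, up to an error
  that vanishes in the limit. The class C_c^3 is dictated by Bochner's formula, where L u is
  differentiated once.\<close>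

lemma partial_eqI:
  assumes "(f has_derivative f') (at x)"
  shows "partial i f x = f' (axis i 1)"
  using frechet_derivative_at[OF assms] by (simp add: partial_def)

lemma has_derivative_partial:
  fixes f :: "real^'n::finite \<Rightarrow> real"
  assumes "f differentiable (at x)"
  shows "(f has_derivative (\<lambda>v. \<Sum>i\<in>UNIV. v $ i * partial i f x)) (at x)"
proof -
  have D: "(f has_derivative frechet_derivative f (at x)) (at x)"
    using assms frechet_derivative_works by blast
  then interpret bounded_linear "frechet_derivative f (at x)"
    by (rule has_derivative_bounded_linear)
  have "frechet_derivative f (at x) v = (\<Sum>i\<in>UNIV. v $ i * partial i f x)" for v
  proof -
    have "frechet_derivative f (at x) v = frechet_derivative f (at x) (\<Sum>i\<in>UNIV. v $ i *\<^sub>R axis i 1)"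
      using basis_expansion[of v] by (simp add: scalar_mult_eq_scaleR)
    then show ?thesis by (simp add: sum scaleR partial_def)
  qed
  then have "frechet_derivative f (at x) = (\<lambda>v. \<Sum>i\<in>UNIV. v $ i * partial i f x)" by (rule ext)
  then show ?thesis using D by simp
qed

lemma has_derivative_gradient:
  fixes f :: "real^'n::finite \<Rightarrow> real"
  assumes "f differentiable (at x)"
  shows "(f has_derivative (\<lambda>v. gradient f x \<bullet> v)) (at x)"
  using has_derivative_partial[OF assms]
  by (simp add: gradient_def inner_vec_def mult.commute)

lemma partial_const [simp]: "partial i (\<lambda>x. c) = (\<lambda>x. 0)"
  by (rule ext, rule partial_eqI) (rule has_derivative_const)

lemma partial_add:
  assumes "f differentiable (at x)" "g differentiable (at x)"
  shows "partial i (\<lambda>x. f x + g x) x = partial i f x + partial i g x"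
  using assms[unfolded frechet_derivative_works]
  by (subst partial_eqI[OF has_derivative_add]) (auto simp: partial_def)

lemma partial_diff:
  assumes "f differentiable (at x)" "g differentiable (at x)"
  shows "partial i (\<lambda>x. f x - g x) x = partial i f x - partial i g x"
  using assms[unfolded frechet_derivative_works]
  by (subst partial_eqI[OF has_derivative_diff]) (auto simp: partial_def)

lemma partial_mult:
  fixes f g :: "real^'n::finite \<Rightarrow> real"
  assumes "f differentiable (at x)" "g differentiable (at x)"
  shows "partial i (\<lambda>x. f x * g x) x = f x * partial i g x + partial i f x * g x"
  using assms[unfolded frechet_derivative_works]
  by (subst partial_eqI[OF has_derivative_mult]) (auto simp: partial_def)

lemma partial_sum:
  assumes "\<And>j. j \<in> A \<Longrightarrow> f j differentiable (at x)"
  shows "partial i (\<lambda>x. \<Sum>j\<in>A. f j x) x = (\<Sum>j\<in>A. partial i (f j) x)"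
  using assms[unfolded frechet_derivative_works]
  by (subst partial_eqI[OF has_derivative_sum]) (auto simp: partial_def)

lemma has_derivative_compose_real:
  fixes g :: "real^'n::finite \<Rightarrow> real"
  assumes "g differentiable (at x)" "(h has_real_derivative h') (at (g x))"
  shows "((\<lambda>x. h (g x)) has_derivative (\<lambda>v. h' * frechet_derivative g (at x) v)) (at x)"
  using has_derivative_compose[OF assms(1)[unfolded frechet_derivative_works]]
    assms(2)[unfolded has_field_derivative_def] by blast

lemma partial_compose_real:
  fixes g :: "real^'n::finite \<Rightarrow> real"
  assumes "g differentiable (at x)" "(h has_real_derivative h') (at (g x))"
  shows "partial i (\<lambda>x. h (g x)) x = h' * partial i g x"
  by (subst partial_eqI[OF has_derivative_compose_real[OF assms]]) (simp add: partial_def)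

lemma partial_component: "partial i (\<lambda>x::real^'n::finite. x $ j) = (\<lambda>x. axis i 1 $ j)"
  by (rule ext, rule partial_eqI) (rule bounded_linear_imp_has_derivative[OF bounded_linear_vec_nth])

lemma Ck_differentiable: "Ck (Suc k) f \<Longrightarrow> f differentiable (at x)"
  by (simp add: differentiable_on_def)

lemma Ck_SucD: "Ck (Suc k) f \<Longrightarrow> Ck k f"
proof (induction k arbitrary: f)
  case 0
  then show ?case by (simp add: differentiable_imp_continuous_on)
next
  case (Suc k)
  then show ?case by simp
qed

lemma Ck_le: "Ck k f \<Longrightarrow> j \<le> k \<Longrightarrow> Ck j f"
  by (induction k) (auto simp: le_Suc_eq simp del: Ck.simps intro: Ck_SucD)

lemma Ck_continuous: "Ck k f \<Longrightarrow> continuous_on UNIV f"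
  using Ck_le[of k f 0] by simp

lemma Ck_partial: "Ck (Suc k) f \<Longrightarrow> Ck k (partial i f)"
  by simp

lemma Ck_SucI:
  assumes "\<And>x. f differentiable (at x)" "\<And>i. Ck k (partial i f)"
  shows "Ck (Suc k) f"
  using assms by (simp add: differentiable_on_def)

lemma Ck_const [simp]: "Ck k (\<lambda>x::real^'n::finite. c)"
  by (induction k arbitrary: c) auto

lemma Ck_add: "Ck k f \<Longrightarrow> Ck k g \<Longrightarrow> Ck k (\<lambda>x. f x + g x)"
proof (induction k arbitrary: f g)
  case 0
  then show ?case by (simp add: continuous_on_add)
next
  case (Suc k)
  note [simp] = Ck_differentiable[OF Suc.prems(1)] Ck_differentiable[OF Suc.prems(2)]
  show ?case
  proof (rule Ck_SucI)
    fix i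
    have "partial i (\<lambda>x. f x + g x) = (\<lambda>x. partial i f x + partial i g x)"
      by (rule ext) (simp add: partial_add)
    then show "Ck k (partial i (\<lambda>x. f x + g x))"
      using Suc.IH[of "partial i f" "partial i g"] Suc.prems by simp
  qed simp
qed

lemma Ck_mult:
  fixes f g :: "real^'n::finite \<Rightarrow> real"
  shows "Ck k f \<Longrightarrow> Ck k g \<Longrightarrow> Ck k (\<lambda>x. f x * g x)"
proof (induction k arbitrary: f g)
  case 0
  then show ?case by (simp add: continuous_on_mult)
next
  case (Suc k)
  note [simp] = Ck_differentiable[OF Suc.prems(1)] Ck_differentiable[OF Suc.prems(2)]
  show ?case
  proof (rule Ck_SucI)
    fix i
    have "partial i (\<lambda>x. f x * g x) = (\<lambda>x. f x * partial i g x + partial i f x * g x)"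
      by (rule ext) (simp add: partial_mult)
    then show "Ck k (partial i (\<lambda>x. f x * g x))"
      using Suc.prems Ck_SucD[OF Suc.prems(1)] Ck_SucD[OF Suc.prems(2)]
      by (auto intro!: Ck_add Suc.IH)
  qed simp
qed

lemma Ck_cmult: "Ck k f \<Longrightarrow> Ck k (\<lambda>x::real^'n::finite. c * f x)"
  by (intro Ck_mult Ck_const)

lemma Ck_diff: "Ck k f \<Longrightarrow> Ck k g \<Longrightarrow> Ck k (\<lambda>x::real^'n::finite. f x - g x)"
  using Ck_add[of k f "\<lambda>x. (-1) * g x"] Ck_cmult[of k g "-1"] by simp

lemma Ck_sum: "(\<And>j. j \<in> A \<Longrightarrow> Ck k (f j)) \<Longrightarrow> Ck k (\<lambda>x::real^'n::finite. \<Sum>j\<in>A. f j x)"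
  by (induction A rule: infinite_finite_induct) (auto intro: Ck_add)

lemma Ck_component: "Ck k (\<lambda>x::real^'n::finite. x $ j)"
proof (cases k)
  case 0
  then show ?thesis by (auto intro!: continuous_intros)
next
  case (Suc l)
  show ?thesis unfolding Suc
    by (rule Ck_SucI)
      (auto simp: partial_component intro!: bounded_linear_imp_differentiable bounded_linear_vec_nth)
qed

lemma norm_vec_square: "(norm (x::real^'n::finite))^2 = (\<Sum>i\<in>UNIV. x $ i * x $ i)"
  by (simp add: power2_norm_eq_inner inner_vec_def)

lemma Ck_norm_square: "Ck k (\<lambda>x::real^'n::finite. (norm x)^2)"
  unfolding norm_vec_square by (intro Ck_sum Ck_mult Ck_component)

lemma partial_norm_square: "partial i (\<lambda>x::real^'n::finite. (norm x)^2) x = 2 * x $ i"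
proof -
  have "((\<lambda>x::real^'n. (norm x)^2) has_derivative (\<lambda>v. 2 * (x \<bullet> v))) (at x)"
    unfolding power2_norm_eq_inner
    by (auto intro!: derivative_eq_intros simp: inner_commute)
  from partial_eqI[OF this] show ?thesis by (simp add: inner_axis)
qed

section \<open>Exponentials and truncated powers\<close>

lemma Ck_exp:
  fixes f :: "real^'n::finite \<Rightarrow> real"
  shows "Ck k f \<Longrightarrow> Ck k (\<lambda>x. exp (f x))"
proof (induction k)
  case 0
  then show ?case by (auto intro!: continuous_intros)
next
  case (Suc k)
  note D = Ck_differentiable[OF Suc.prems]
  show ?case
  proof (rule Ck_SucI)
    show "(\<lambda>x. exp (f x)) differentiable (at x)" for x
      using has_derivative_compose_real[OF D DERIV_exp] unfolding differentiable_def by blast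
    show "Ck k (partial i (\<lambda>x. exp (f x)))" for i
    proof -
      have "partial i (\<lambda>x. exp (f x)) = (\<lambda>x. exp (f x) * partial i f x)"
        by (rule ext) (rule partial_compose_real[OF D DERIV_exp])
      then show ?thesis using Suc.prems Suc.IH[OF Ck_SucD[OF Suc.prems]] by (simp add: Ck_mult)
    qed
  qed
qed

text \<open>Only the origin needs care: there the difference quotient is at most |h|^(k+1) in
  modulus, and k + 1 is positive.\<close>

lemma DERIV_max_0_power:
  "((\<lambda>s::real. (max 0 s) ^ Suc (Suc k)) has_real_derivative (real (k + 2) * (max 0 s) ^ Suc k)) (at s)"
proof -
  consider "s > 0" | "s < 0" | "s = 0" by linarith
  then show ?thesis
  proof cases
    case 1
    have "((\<lambda>s::real. s ^ Suc (Suc k)) has_real_derivative (real (k + 2) * (max 0 s) ^ Suc k)) (at s)"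
      using 1 DERIV_pow[of "Suc (Suc k)" s] by simp
    then show ?thesis
      by (rule has_field_derivative_transform_within_open[where S = "{0<..}"]) (use 1 in auto)
  next
    case 2
    have "((\<lambda>s::real. 0) has_real_derivative (real (k + 2) * (max 0 s) ^ Suc k)) (at s)"
      using 2 by (auto intro!: derivative_eq_intros)
    then show ?thesis
      by (rule has_field_derivative_transform_within_open[where S = "{..<0}"]) (use 2 in auto)
  next
    case 3
    have "((\<lambda>h. \<bar>h\<bar> ^ Suc k) \<longlongrightarrow> \<bar>0\<bar> ^ Suc k) (at (0::real))"
      by (intro tendsto_intros)
    then have "((\<lambda>h. \<bar>h\<bar> ^ Suc k) \<longlongrightarrow> 0) (at (0::real))" by simp
    then have "((\<lambda>h. (max 0 (0 + h) ^ Suc (Suc k) - max 0 0 ^ Suc (Suc k)) / h) \<longlongrightarrow> 0) (at (0::real))"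
    proof (rule Lim_null_comparison[rotated], intro always_eventually allI)
      fix h :: real
      show "norm ((max 0 (0 + h) ^ Suc (Suc k) - max 0 0 ^ Suc (Suc k)) / h) \<le> \<bar>h\<bar> ^ Suc k"
        by (cases "h > 0") (auto simp: max_def intro!: mult_nonpos_nonneg)
    qed
    then show ?thesis using 3 by (simp add: DERIV_def)
  qed
qed

text \<open>Each derivative costs one power, so k derivatives leave the exponent 1, which is still
  continuous. Truncated powers supply explicit compactly supported functions of finite smoothness: k
  = 4 for mollifiers, k = 1 for cutoffs.\<close>

lemma Ck_max_0_power:
  fixes g :: "real^'n::finite \<Rightarrow> real"
  shows "Ck k g \<Longrightarrow> Ck k (\<lambda>x. (max 0 (g x)) ^ Suc k)"
proof (induction k)
  case 0
  then show ?case by (auto intro!: continuous_intros)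
next
  case (Suc k)
  note D = Ck_differentiable[OF Suc.prems]
  show ?case
  proof (rule Ck_SucI)
    show "(\<lambda>x. (max 0 (g x)) ^ Suc (Suc k)) differentiable (at x)" for x
      using has_derivative_compose_real[OF D DERIV_max_0_power] unfolding differentiable_def by blast
    show "Ck k (partial i (\<lambda>x. (max 0 (g x)) ^ Suc (Suc k)))" for i
    proof -
      have "partial i (\<lambda>x. (max 0 (g x)) ^ Suc (Suc k))
          = (\<lambda>x. real (k + 2) * (max 0 (g x)) ^ Suc k * partial i g x)"
        by (rule ext) (rule partial_compose_real[OF D DERIV_max_0_power])
      then show ?thesis using Suc.prems Suc.IH[OF Ck_SucD[OF Suc.prems]]
        by (auto intro!: Ck_mult simp del: power_Suc)
    qed
  qed
qed

lemma has_real_derivative_along_line: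
  fixes f :: "real^'n::finite \<Rightarrow> real"
  assumes "f differentiable (at (x + s *\<^sub>R v))"
  shows "((\<lambda>s. f (x + s *\<^sub>R v)) has_real_derivative (gradient f (x + s *\<^sub>R v) \<bullet> v)) (at s)"
proof -
  have "((\<lambda>s. x + s *\<^sub>R v) has_derivative (\<lambda>s. s *\<^sub>R v)) (at s)"
    by (auto intro!: derivative_eq_intros)
  from has_derivative_compose[OF this has_derivative_gradient[OF assms]]
  show ?thesis unfolding has_field_derivative_def by (simp add: mult_commute_abs)
qed

lemma gradient_inner_axis: "gradient f x \<bullet> axis i 1 = partial i f x"
  by (simp add: gradient_def inner_axis)

text \<open>Symmetry of second derivatives, via the mean value theorem applied twice to the mixed second difference.\<close>

lemma second_difference_mixed:
  fixes u :: "real^'n::finite \<Rightarrow> real"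
  assumes u: "Ck 2 u" and h: "h > 0"
  obtains y where "norm (y - x) \<le> 2 * h"
    "u (x + h *\<^sub>R axis i 1 + h *\<^sub>R axis j 1) - u (x + h *\<^sub>R axis i 1) - u (x + h *\<^sub>R axis j 1) + u x
      = h * h * partial j (partial i u) y"
proof -
  have D: "u differentiable (at z)" for z
    using u by (intro Ck_differentiable[of 1]) (simp add: numeral_2_eq_2)
  have D': "partial i u differentiable (at z)" for z
    using u by (intro Ck_differentiable[of 0] Ck_partial) (simp add: numeral_2_eq_2)
  define g where "g s = u (x + h *\<^sub>R axis j 1 + s *\<^sub>R axis i 1) - u (x + s *\<^sub>R axis i 1)" for s
  have "(g has_real_derivative (partial i u (x + h *\<^sub>R axis j 1 + s *\<^sub>R axis i 1)
      - partial i u (x + s *\<^sub>R axis i 1))) (at s)" for s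
    unfolding g_def gradient_inner_axis[symmetric]
    by (intro DERIV_diff has_real_derivative_along_line D)
  from MVT2[OF h this] obtain \<xi> where \<xi>: "0 < \<xi>" "\<xi> < h" and
    e1: "g h - g 0 = h * (partial i u (x + \<xi> *\<^sub>R axis i 1 + h *\<^sub>R axis j 1)
      - partial i u (x + \<xi> *\<^sub>R axis i 1))"
    by (auto simp: add_ac)
  have "((\<lambda>t. partial i u (x + \<xi> *\<^sub>R axis i 1 + t *\<^sub>R axis j 1)) has_real_derivative
      partial j (partial i u) (x + \<xi> *\<^sub>R axis i 1 + t *\<^sub>R axis j 1)) (at t)" for t
    unfolding gradient_inner_axis[of "partial i u", symmetric]
    by (intro has_real_derivative_along_line D')
  from MVT2[OF h this] obtain \<eta> where \<eta>: "0 < \<eta>" "\<eta> < h" and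
    e2: "partial i u (x + \<xi> *\<^sub>R axis i 1 + h *\<^sub>R axis j 1) - partial i u (x + \<xi> *\<^sub>R axis i 1)
      = h * partial j (partial i u) (x + \<xi> *\<^sub>R axis i 1 + \<eta> *\<^sub>R axis j 1)"
    by auto
  show thesis
  proof
    have "norm (\<xi> *\<^sub>R axis i 1 + \<eta> *\<^sub>R axis j 1 :: real^'n) \<le> \<xi> + \<eta>"
      by (rule order_trans[OF norm_triangle_ineq]) (use \<xi> \<eta> in \<open>simp add: norm_axis_1\<close>)
    then show "norm (x + \<xi> *\<^sub>R axis i 1 + \<eta> *\<^sub>R axis j 1 - x) \<le> 2 * h"
      using \<xi> \<eta> by (simp add: add.assoc)
    show "u (x + h *\<^sub>R axis i 1 + h *\<^sub>R axis j 1) - u (x + h *\<^sub>R axis i 1) - u (x + h *\<^sub>R axis j 1) + u x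
      = h * h * partial j (partial i u) (x + \<xi> *\<^sub>R axis i 1 + \<eta> *\<^sub>R axis j 1)"
      using e1 unfolding e2 by (simp add: g_def add_ac)
  qed
qed

lemma partial_commute:
  fixes u :: "real^'n::finite \<Rightarrow> real"
  assumes u: "Ck 2 u"
  shows "partial i (partial j u) x = partial j (partial i u) x"
proof -
  define h where "h n = inverse (real (Suc n))" for n
  have h: "h n > 0" for n by (simp add: h_def)
  have h0: "h \<longlonglongrightarrow> 0" unfolding h_def by (rule LIMSEQ_inverse_real_of_nat)
  have C: "isCont (partial a (partial b u)) x" for a b
    using u by (auto simp: numeral_2_eq_2 continuous_on_eq_continuous_at)
  have "\<exists>y. norm (y - x) \<le> 2 * h n \<and>
    u (x + h n *\<^sub>R axis a 1 + h n *\<^sub>R axis b 1) - u (x + h n *\<^sub>R axis a 1) - u (x + h n *\<^sub>R axis b 1) + u x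
      = h n * h n * partial b (partial a u) y" for a b n
    using second_difference_mixed[OF u h] by metis
  then have "\<forall>a b n. \<exists>y. norm (y - x) \<le> 2 * h n \<and>
    u (x + h n *\<^sub>R axis a 1 + h n *\<^sub>R axis b 1) - u (x + h n *\<^sub>R axis a 1) - u (x + h n *\<^sub>R axis b 1) + u x
      = h n * h n * partial b (partial a u) y"
    by blast
  then obtain y where y: "\<And>a b n. norm (y a b n - x) \<le> 2 * h n"
    "\<And>a b n. u (x + h n *\<^sub>R axis a 1 + h n *\<^sub>R axis b 1) - u (x + h n *\<^sub>R axis a 1) - u (x + h n *\<^sub>R axis b 1) + u x
      = h n * h n * partial b (partial a u) (y a b n)"
    by metis
  have lim: "y a b \<longlonglongrightarrow> x" for a b
  proof (rule metric_LIMSEQ_I)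
    fix r :: real assume "r > 0"
    then obtain N where "\<And>n. n \<ge> N \<Longrightarrow> \<bar>h n\<bar> < r / 2"
      using LIMSEQ_D[OF h0, of "r/2"] by auto
    then show "\<exists>N. \<forall>n\<ge>N. dist (y a b n) x < r"
      using y(1)[of a b] by (intro exI[of _ N]) (fastforce simp: dist_norm intro: le_less_trans)
  qed
  have "partial j (partial i u) (y i j n) = partial i (partial j u) (y j i n)" for n
  proof -
    \<comment> \<open>The second difference does not see the order of the two directions, so the
      mixed derivatives at the two mean value points agree; both points tend to x.\<close>
    have e: "x + h n *\<^sub>R axis i 1 + h n *\<^sub>R axis j 1 = x + h n *\<^sub>R axis j 1 + h n *\<^sub>R axis i 1"
      by (simp add: add_ac)
    from y(2)[of n i j, unfolded e] y(2)[of n j i]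
    have "h n * h n * partial j (partial i u) (y i j n) = h n * h n * partial i (partial j u) (y j i n)"
      by linarith
    then show ?thesis using h[of n] by simp
  qed
  then have "(\<lambda>n. partial j (partial i u) (y i j n)) = (\<lambda>n. partial i (partial j u) (y j i n))"
    by (rule ext)
  moreover have "(\<lambda>n. partial j (partial i u) (y i j n)) \<longlonglongrightarrow> partial j (partial i u) x"
    "(\<lambda>n. partial i (partial j u) (y j i n)) \<longlonglongrightarrow> partial i (partial j u) x"
    using isCont_tendsto_compose[OF C lim] by auto
  ultimately show ?thesis using LIMSEQ_unique by fastforce
qed

section \<open>Compact support and convolution\<close>

text \<open>The radius is kept explicit because radii add under convolution and have to be compared
  with those of cutoffs. The domain is any normed space since Fubini's theorem is applied to such a
  function on a product.\<close>

definition supp_ball :: "real \<Rightarrow> ('a::real_normed_vector \<Rightarrow> real) \<Rightarrow> bool" where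
  "supp_ball r f \<longleftrightarrow> (\<forall>x. norm x > r \<longrightarrow> f x = 0)"

definition Cc :: "('a::real_normed_vector \<Rightarrow> real) \<Rightarrow> bool" where
  "Cc f \<longleftrightarrow> continuous_on UNIV f \<and> (\<exists>r. supp_ball r f)"

lemma CcI: "continuous_on UNIV f \<Longrightarrow> supp_ball r f \<Longrightarrow> Cc f"
  by (auto simp: Cc_def)

lemma Cc_continuous: "Cc f \<Longrightarrow> continuous_on UNIV f"
  by (simp add: Cc_def)

lemma Cc_supp:
  assumes "Cc f"
  obtains r where "r > 0" "supp_ball r f"
proof -
  obtain s where "supp_ball s f" using assms by (auto simp: Cc_def)
  then have "supp_ball (max s 1) f" by (simp add: supp_ball_def)
  then show thesis by (intro that[of "max s 1"]) auto
qed

lemma Cc_integrable: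
  fixes f :: "'a::euclidean_space \<Rightarrow> real"
  assumes "Cc f" shows "integrable lborel f"
proof -
  obtain r where r: "supp_ball r f" using assms by (auto simp: Cc_def)
  have "integrable lborel (\<lambda>x. indicator (cball 0 r) x *\<^sub>R f x)"
    by (rule borel_integrable_compact) (use assms in \<open>auto simp: Cc_def intro: continuous_on_subset\<close>)
  also have "(\<lambda>x. indicator (cball 0 r) x *\<^sub>R f x) = f"
    using r by (auto simp: fun_eq_iff supp_ball_def indicator_def)
  finally show ?thesis .
qed

lemma Cc_mult_right: "continuous_on UNIV p \<Longrightarrow> Cc f \<Longrightarrow> Cc (\<lambda>x. p x * f x)"
  unfolding Cc_def supp_ball_def by (auto intro: continuous_on_mult)

lemma Cc_mult_left: "continuous_on UNIV p \<Longrightarrow> Cc f \<Longrightarrow> Cc (\<lambda>x. f x * p x)"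
  using Cc_mult_right[of p f] by (simp add: mult.commute)

lemma Cc_cmult: "Cc f \<Longrightarrow> Cc (\<lambda>x. c * f x)"
  by (intro Cc_mult_right continuous_on_const)

lemma Cc_0 [simp]: "Cc (\<lambda>x. 0)"
  by (auto simp: Cc_def supp_ball_def)

lemma Cc_add:
  assumes "Cc f" "Cc g" shows "Cc (\<lambda>x. f x + g x)"
proof -
  obtain r s where "supp_ball r f" "supp_ball s g" using assms by (auto simp: Cc_def)
  then have "supp_ball (max r s) (\<lambda>x. f x + g x)" by (simp add: supp_ball_def)
  then show ?thesis using assms by (auto simp: Cc_def intro: continuous_on_add)
qed

lemma Cc_diff: "Cc f \<Longrightarrow> Cc g \<Longrightarrow> Cc (\<lambda>x. f x - g x)"
  using Cc_add[of f "\<lambda>x. (-1) * g x"] Cc_cmult[of g "-1"] by simp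

lemma Cc_sum: "(\<And>i. i \<in> I \<Longrightarrow> Cc (f i)) \<Longrightarrow> Cc (\<lambda>x. \<Sum>i\<in>I. f i x)"
  by (induction I rule: infinite_finite_induct) (auto intro: Cc_add)

lemma Cc_abs: "Cc f \<Longrightarrow> Cc (\<lambda>x. \<bar>f x\<bar>)"
  by (auto simp: Cc_def supp_ball_def intro!: continuous_intros)

lemma Cc_power2: "Cc f \<Longrightarrow> Cc (\<lambda>x. (f x)^2)"
  by (auto simp: Cc_def supp_ball_def intro!: continuous_intros)

lemma supp_ball_intros:
  "supp_ball r f \<Longrightarrow> supp_ball r (\<lambda>x. f x * p x)"
  "supp_ball r f \<Longrightarrow> supp_ball r (\<lambda>x. p x * f x)"
  "supp_ball r f \<Longrightarrow> supp_ball r g \<Longrightarrow> supp_ball r (\<lambda>x. f x + g x)"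
  "supp_ball r f \<Longrightarrow> supp_ball r g \<Longrightarrow> supp_ball r (\<lambda>x. f x - g x)"
  "(\<And>i. i \<in> I \<Longrightarrow> supp_ball r (h i)) \<Longrightarrow> supp_ball r (\<lambda>x. \<Sum>i\<in>I. h i x)"
  by (auto simp: supp_ball_def)

lemma supp_ball_mono: "supp_ball r f \<Longrightarrow> r \<le> s \<Longrightarrow> supp_ball s f"
  by (auto simp: supp_ball_def)

lemma partial_eq_0_open:
  fixes f :: "real^'n::finite \<Rightarrow> real"
  assumes "open S" "x \<in> S" "\<And>y. y \<in> S \<Longrightarrow> f y = 0"
  shows "partial i f x = 0"
proof -
  have "(f has_derivative (\<lambda>_. 0)) (at x)"
    by (rule has_derivative_transform_within_open[OF has_derivative_const[of 0] assms(1,2)])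
      (use assms(3) in auto)
  from partial_eqI[OF this] show ?thesis .
qed

lemma supp_ball_partial:
  fixes f :: "real^'n::finite \<Rightarrow> real"
  assumes "supp_ball r f" shows "supp_ball r (partial i f)"
  unfolding supp_ball_def
proof (intro allI impI)
  fix x :: "real^'n" assume x: "r < norm x"
  have "open {y::real^'n. r < norm y}" by (intro open_Collect_less continuous_intros)
  then show "partial i f x = 0"
    by (rule partial_eq_0_open) (use x assms in \<open>auto simp: supp_ball_def\<close>)
qed

lemma Cc_partial:
  assumes "Ck (Suc k) f" "Cc f" shows "Cc (partial i f)"
proof -
  obtain r where "supp_ball r f" using assms(2) by (auto simp: Cc_def)
  from CcI[OF Ck_continuous[OF Ck_partial[OF assms(1)]] supp_ball_partial[OF this]] show ?thesis .
qed

lemma Cc_uniformly_continuous: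
  fixes f :: "'a::euclidean_space \<Rightarrow> real"
  assumes f: "Cc f" and e: "e > 0"
  obtains d where "d > 0" "\<And>x y. norm (x - y) < d \<Longrightarrow> \<bar>f x - f y\<bar> < e"
proof -
  obtain r where r: "supp_ball r f" using f by (auto simp: Cc_def)
  have "uniformly_continuous_on (cball 0 (r + 1)) f"
    by (rule compact_uniformly_continuous) (use continuous_on_subset[OF Cc_continuous[OF f]] in auto)
  from this[unfolded uniformly_continuous_on_def, rule_format, OF e]
  obtain d where d: "d > 0"
    "\<forall>x\<in>cball 0 (r + 1). \<forall>y\<in>cball 0 (r + 1). dist y x < d \<longrightarrow> dist (f y) (f x) < e"
    by blast
  show thesis
  \<comment> \<open>At distance below 1, two points either both lie in the ball of radius r + 1 or
    both lie outside the ball of radius r, where f vanishes.\<close>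
  proof (rule that[of "min d 1"])
    show "\<bar>f x - f y\<bar> < e" if *: "norm (x - y) < min d 1" for x y
    proof (cases "norm x \<le> r + 1 \<and> norm y \<le> r + 1")
      case True
      then show ?thesis using d(2)[rule_format, of y x] * by (auto simp: dist_norm)
    next
      case False
      have "norm x \<le> norm y + norm (x - y)" "norm y \<le> norm x + norm (x - y)"
        using norm_triangle_ineq[of y "x - y"] norm_triangle_ineq[of x "y - x"]
        by (auto simp: norm_minus_commute)
      then have "norm x > r" "norm y > r" using False * by auto
      then show ?thesis using r e by (simp add: supp_ball_def)
    qed
  qed (use d in auto)
qed

section \<open>Translation, reflection and integration by parts\<close>

lemma continuous_on_UNIV_borel: "continuous_on UNIV f \<Longrightarrow> f \<in> borel_measurable lborel"
  by (simp add: borel_measurable_continuous_onI)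

lemma integral_translate:
  fixes f :: "'a::euclidean_space \<Rightarrow> real"
  assumes "continuous_on UNIV f"
  shows "(LBINT x. f (a + x)) = (LBINT x. f x)"
  using integral_distr[of "(+) a" lborel borel f] assms
  by (simp add: lborel_distr_plus borel_measurable_continuous_onI)

lemma integral_reflect:
  fixes f :: "'a::euclidean_space \<Rightarrow> real"
  assumes "continuous_on UNIV f"
  shows "(LBINT x. f (a - x)) = (LBINT x. f x)"
proof -
  have "lborel = density (distr lborel borel (\<lambda>x::'a. a + (-1) *\<^sub>R x)) (\<lambda>_. 1)"
    using lborel_affine[of "-1" a] by simp
  then have "lborel = distr lborel borel (\<lambda>x::'a. a - x)" by (simp add: density_1)
  then have "(LBINT x. f x) = (LINT x|distr lborel borel (\<lambda>x::'a. a - x). f x)" by simp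
  also have "\<dots> = (LBINT x. f (a - x))"
    by (rule integral_distr) (use assms in \<open>auto simp: borel_measurable_continuous_onI\<close>)
  finally show ?thesis by simp
qed

lemma Cc_translate:
  fixes f :: "'a::real_normed_vector \<Rightarrow> real"
  assumes "Cc f" shows "Cc (\<lambda>x. f (a + x))" "Cc (\<lambda>x. f (a - x))"
proof -
  obtain r where r: "supp_ball r f" using assms by (auto simp: Cc_def)
  have "norm (a + x) > r" "norm (a - x) > r" if "norm x > r + norm a" for x
    using that norm_triangle_ineq4[of "a + x" a] norm_triangle_ineq4[of a "a - x"] by auto
  then have "supp_ball (r + norm a) (\<lambda>x. f (a + x))" "supp_ball (r + norm a) (\<lambda>x. f (a - x))"
    using r by (auto simp: supp_ball_def)
  moreover have "continuous_on UNIV (\<lambda>x. f (a + x))" "continuous_on UNIV (\<lambda>x. f (a - x))"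
    using continuous_on_compose2[of UNIV f UNIV "\<lambda>y. a + y"] continuous_on_compose2[of UNIV f UNIV "\<lambda>y. a - y"] assms
    by (simp_all add: continuous_on_diff continuous_on_add Cc_def)
  ultimately show "Cc (\<lambda>x. f (a + x))" "Cc (\<lambda>x. f (a - x))" by (auto intro: CcI)
qed

lemma mean_value_along:
  fixes f :: "real^'n::finite \<Rightarrow> real"
  assumes "Ck 1 f"
  obtains s where "0 < s" "s < 1" "f (x + v) - f x = gradient f (x + s *\<^sub>R v) \<bullet> v"
proof -
  have "((\<lambda>s. f (x + s *\<^sub>R v)) has_real_derivative (gradient f (x + s *\<^sub>R v) \<bullet> v)) (at s)" for s
    by (rule has_real_derivative_along_line) (use assms Ck_differentiable[of 0 f] in simp)
  from MVT2[of 0 1, OF _ this] obtain s where "0 < s" "s < 1"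
    "f (x + 1 *\<^sub>R v) - f (x + 0 *\<^sub>R v) = (1 - 0) * (gradient f (x + s *\<^sub>R v) \<bullet> v)"
    by auto
  then show thesis using that by simp
qed

text \<open>A first-order Taylor remainder whose size does not depend on x. This uniformity is what
  permits integrating it, in \<open>integral_partial_eq_0\<close> and in
  \<open>has_derivative_conv\<close>.\<close>

lemma partial_increment_bound:
  fixes f :: "real^'n::finite \<Rightarrow> real"
  assumes f: "Ck 1 f" and d: "\<And>i x y. norm (x - y) < d \<Longrightarrow> \<bar>partial i f x - partial i f y\<bar> \<le> e"
    and v: "norm v < d"
  shows "\<bar>f (x + v) - f x - (\<Sum>i\<in>UNIV. v $ i * partial i f x)\<bar> \<le> real CARD('n) * e * norm v"
proof -
  obtain s where s: "0 < s" "s < 1" "f (x + v) - f x = gradient f (x + s *\<^sub>R v) \<bullet> v"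
    using mean_value_along[OF f] .
  have n: "norm (x + s *\<^sub>R v - x) < d" using s v
    by (simp add: le_less_trans[OF mult_left_le_one_le[of "norm v" s]])
  have e: "e \<ge> 0" using d[OF n] by (meson abs_ge_zero order_trans)
  have eq: "f (x + v) - f x - (\<Sum>i\<in>UNIV. v $ i * partial i f x)
      = (\<Sum>i\<in>UNIV. v $ i * (partial i f (x + s *\<^sub>R v) - partial i f x))"
    by (simp add: s(3) gradient_def inner_vec_def right_diff_distrib sum_subtractf mult.commute)
  have "\<bar>f (x + v) - f x - (\<Sum>i\<in>UNIV. v $ i * partial i f x)\<bar> \<le> (\<Sum>i\<in>(UNIV::'n set). norm v * e)"
    unfolding eq
    by (rule order_trans[OF sum_abs], rule sum_mono)
      (use e d[OF n] in \<open>auto simp: abs_mult component_le_norm_cart intro!: mult_mono\<close>)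
  then show ?thesis by (simp add: mult_ac)
qed

lemma Cc_partial_uniform:
  fixes f :: "real^'n::finite \<Rightarrow> real"
  assumes f: "Ck 1 f" "Cc f" and e: "e > 0"
  obtains d where "d > 0" "\<And>i x y. norm (x - y) < d \<Longrightarrow> \<bar>partial i f x - partial i f y\<bar> \<le> e"
proof -
  have "\<forall>i. \<exists>d>0. \<forall>x y. norm (x - y) < d \<longrightarrow> \<bar>partial i f x - partial i f y\<bar> < e"
    using Cc_uniformly_continuous[OF Cc_partial[of 0, OF _ f(2)] e] f by (metis One_nat_def)
  then obtain d where d: "\<And>i. d i > 0"
    "\<And>i x y. norm (x - y) < d i \<Longrightarrow> \<bar>partial i f x - partial i f y\<bar> < e"
    by metis
  show thesis
  proof (rule that[of "Min (range d)"])
    show "0 < Min (range d)" using d(1) by (subst Min_gr_iff) auto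
    show "\<bar>partial i f x - partial i f y\<bar> \<le> e" if "norm (x - y) < Min (range d)" for i x y
      using that d(2)[of x y i] by (simp add: less_imp_le)
  qed
qed

text \<open>By translation invariance the integral of the difference quotients vanishes.\<close>

lemma integral_partial_eq_0:
  fixes f :: "real^'n::finite \<Rightarrow> real"
  assumes f: "Ck 1 f" "Cc f"
  shows "(LBINT x. partial i f x) = 0"
proof -
  obtain r where r: "supp_ball r f" using f by (auto simp: Cc_def)
  have C: "continuous_on UNIV f" using f by (simp add: Cc_def)
  have P: "Cc (partial i f)" using Cc_partial[of 0, OF _ f(2)] f(1) by simp
  have I: "integrable lborel (partial i f)" by (rule Cc_integrable[OF P])
  define K where "K = measure lborel (cball 0 (r + 1) :: (real^'n) set)"
  have "\<bar>LBINT x. partial i f x\<bar> \<le> e * (real CARD('n) * K)" if e: "e > 0" for e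
  proof -
    obtain d where d: "d > 0" "\<And>i x y. norm (x - y) < d \<Longrightarrow> \<bar>partial i f x - partial i f y\<bar> \<le> e"
      using Cc_partial_uniform[OF f e] by metis
    \<comment> \<open>t < d makes the modulus of continuity available; t \<le> 1 confines the
      shifted support to the ball of radius r + 1, whose volume is K.\<close>
    define t where "t = min (d / 2) 1"
    have t: "0 < t" "t < d" "t \<le> 1" using d by (auto simp: t_def)
    define v where "v = t *\<^sub>R (axis i 1 :: real^'n)"
    have nv: "norm v = t" using t by (simp add: v_def norm_axis_1)
    have sv: "(\<Sum>j\<in>UNIV. v $ j * partial j f x) = t * partial i f x" for x
    proof -
      have "(\<Sum>j\<in>UNIV. v $ j * partial j f x) = (\<Sum>j\<in>UNIV. if j = i then t * partial i f x else 0)"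
        by (rule sum.cong) (auto simp: v_def axis_def)
      then show ?thesis by simp
    qed
    let ?q = "\<lambda>x. f (v + x) - f x - t * partial i f x"
    have q: "Cc ?q" by (intro Cc_diff Cc_translate f Cc_cmult P)
    have b: "\<bar>?q x\<bar> \<le> real CARD('n) * e * t * indicator (cball 0 (r + 1)) x" for x
    proof (cases "norm x \<le> r + 1")
      case True
      then show ?thesis
        using partial_increment_bound[OF f(1) d(2), where v = v and x = x] t sv by (simp add: nv add.commute)
    next
      case False
      then have "norm x > r" "norm (v + x) > r"
        using norm_triangle_ineq4[of "v + x" v] nv t by auto
      then show ?thesis using r supp_ball_partial[OF r, of i] False by (simp add: supp_ball_def)
    qed
    have "(LBINT x. ?q x) = (LBINT x. f (v + x)) - (LBINT x. f x) - t * (LBINT x. partial i f x)"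
      using Cc_integrable[OF Cc_translate(1)[OF f(2)]] Cc_integrable[OF f(2)] I by simp
    also have "\<dots> = - t * (LBINT x. partial i f x)"
      by (simp add: integral_translate[OF C])
    finally have "t * \<bar>LBINT x. partial i f x\<bar> = \<bar>LBINT x. ?q x\<bar>"
      using t by (simp add: abs_mult)
    also have "\<dots> \<le> (LBINT x. \<bar>?q x\<bar>)" by (rule integral_abs_bound)
    also have "\<dots> \<le> (LINT x::real^'n|lborel. real CARD('n) * e * t * indicator (cball 0 (r + 1)) x)"
    proof (rule Bochner_Integration.integral_mono)
      show "integrable lborel (\<lambda>x. \<bar>?q x\<bar>)" by (intro Cc_integrable Cc_abs q)
    qed (use b in \<open>auto intro!: integrable_mult_right integrable_real_indicator emeasure_compact_finite\<close>)
    also have "\<dots> = t * (e * (real CARD('n) * K))" by (simp add: K_def)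
    finally show ?thesis using t by simp
  qed
  \<comment> \<open>K was fixed before e, so e may be divided by a multiple of K; the added 1 keeps
    the divisor positive.\<close>
  then have "\<bar>LBINT x. partial i f x\<bar> \<le> 0 + e" if e: "e > 0" for e
  proof -
    have "real CARD('n) * K \<ge> 0" by (simp add: K_def)
    then have "e / (real CARD('n) * K + 1) * (real CARD('n) * K) \<le> e" using e by (simp add: field_simps)
    moreover have "e / (real CARD('n) * K + 1) > 0" using e \<open>real CARD('n) * K \<ge> 0\<close> by simp
    ultimately show ?thesis
      using \<open>\<And>e. e > 0 \<Longrightarrow> \<bar>LBINT x. partial i f x\<bar> \<le> e * (real CARD('n) * K)\<close>[of "e / (real CARD('n) * K + 1)"]
      by linarith
  qed
  then have "\<bar>LBINT x. partial i f x\<bar> \<le> 0" using field_le_epsilon by blast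
  then show ?thesis by simp
qed

lemma integral_by_parts:
  fixes f g :: "real^'n::finite \<Rightarrow> real"
  assumes f: "Ck 1 f" and g: "Ck 1 g" "Cc g"
  shows "(LBINT x. partial i f x * g x) = - (LBINT x. f x * partial i g x)"
proof -
  have D: "f differentiable (at x)" "g differentiable (at x)" for x
    using f g Ck_differentiable[of 0] by auto
  have P: "Cc (partial i g)" using Cc_partial[of 0, OF _ g(2)] g(1) by simp
  have "Ck 1 (\<lambda>x. f x * g x)" by (intro Ck_mult f g)
  from integral_partial_eq_0[OF this Cc_mult_right[OF Ck_continuous[OF f] g(2)], of i]
  have "(LBINT x. f x * partial i g x + partial i f x * g x) = 0"
    by (simp add: partial_mult[OF D])
  then show ?thesis
    using Cc_integrable[OF Cc_mult_right[OF Ck_continuous[OF f] P]]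
      Cc_integrable[OF Cc_mult_right[OF Ck_continuous[OF Ck_partial[of 0 f i]] g(2)]] f
    by simp
qed

section \<open>Convolution\<close>

definition conv :: "('a::euclidean_space \<Rightarrow> real) \<Rightarrow> ('a \<Rightarrow> real) \<Rightarrow> 'a \<Rightarrow> real" where
  "conv p q x = (LBINT y. p y * q (x - y))"

text \<open>The two factors are treated asymmetrically throughout: the first is merely continuous
  and may grow arbitrarily, while compact support and smoothness come from the second.\<close>

lemma Cc_conv_integrand:
  "continuous_on UNIV p \<Longrightarrow> Cc q \<Longrightarrow> Cc (\<lambda>y. p y * q (x - y))"
  by (intro Cc_mult_right Cc_translate)

lemma integrable_conv_integrand:
  "continuous_on UNIV p \<Longrightarrow> Cc q \<Longrightarrow> integrable lborel (\<lambda>y. p y * q (x - y))"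
  by (intro Cc_integrable Cc_conv_integrand)

lemma supp_ball_conv:
  assumes "supp_ball r p" "supp_ball s q" shows "supp_ball (r + s) (conv p q)"
  unfolding supp_ball_def
proof (intro allI impI)
  fix x :: 'a assume x: "r + s < norm x"
  have "p y * q (x - y) = 0" for y
  proof (cases "norm y > r")
    case True then show ?thesis using assms by (simp add: supp_ball_def)
  next
    case False
    then have "norm (x - y) > s" using x norm_triangle_ineq[of "x - y" y] by simp
    then show ?thesis using assms by (simp add: supp_ball_def)
  qed
  then have "(\<lambda>y. p y * q (x - y)) = (\<lambda>y. 0)" by (rule ext)
  then show "conv p q x = 0" by (simp add: conv_def)
qed

text \<open>Differentiation under the integral sign. For increments shorter than 1 the Taylor
  remainder of q vanishes outside the ball of radius r + 1 about x, where |p| has the finite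
  integral M, and inside it is uniformly small by \<open>partial_increment_bound\<close>.\<close>

lemma has_derivative_conv:
  fixes p q :: "real^'n::finite \<Rightarrow> real"
  assumes p: "continuous_on UNIV p" and q: "Ck 1 q" "Cc q"
  shows "(conv p q has_derivative (\<lambda>v. \<Sum>i\<in>UNIV. v $ i * conv p (partial i q) x)) (at x)"
  unfolding has_derivative_at_alt
proof (intro conjI allI impI)
  show "bounded_linear (\<lambda>v. \<Sum>i\<in>UNIV. v $ i * conv p (partial i q) x)"
    by (intro bounded_linear_sum bounded_linear_mult_const[OF bounded_linear_vec_nth])
next
  fix e :: real assume e: "e > 0"
  obtain r where r: "r > 0" "supp_ball r q" using Cc_supp[OF q(2)] .
  have P: "Cc (partial i q)" for i using Cc_partial[of 0, OF _ q(2)] q(1) by simp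
  define M where "M = (LBINT y. \<bar>p y\<bar> * indicator (cball x (r + 1)) y)"
  have "integrable lborel (\<lambda>y. indicator (cball x (r + 1)) y *\<^sub>R \<bar>p y\<bar>)"
    by (rule borel_integrable_compact) (use p in \<open>auto intro!: continuous_intros intro: continuous_on_subset\<close>)
  then have IM: "integrable lborel (\<lambda>y. \<bar>p y\<bar> * indicator (cball x (r + 1)) y)"
    by (simp add: mult.commute)
  have M: "M \<ge> 0" unfolding M_def by (rule integral_nonneg_AE) simp
  define e' where "e' = e / (real CARD('n) * M + 1)"
  have nM: "0 \<le> real CARD('n) * M" using M by simp
  have e': "e' > 0" "real CARD('n) * e' * M \<le> e"
    using e nM unfolding e'_def by (simp_all add: field_simps add_pos_nonneg)
  obtain d where d: "d > 0" "\<And>i x y. norm (x - y) < d \<Longrightarrow> \<bar>partial i q x - partial i q y\<bar> \<le> e'"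
    using Cc_partial_uniform[OF q e'(1)] by metis
  show "\<exists>d>0. \<forall>y. norm (y - x) < d \<longrightarrow>
      norm (conv p q y - conv p q x - (\<Sum>i\<in>UNIV. (y - x) $ i * conv p (partial i q) x)) \<le> e * norm (y - x)"
  proof (intro exI[of _ "min d 1"] conjI allI impI)
    fix z assume z: "norm (z - x) < min d 1"
    define v where "v = z - x"
    have v: "norm v < d" "norm v < 1" and zv: "z = x + v" using z by (auto simp: v_def)
    let ?D = "\<lambda>y. q (x + v - y) - q (x - y) - (\<Sum>i\<in>UNIV. v $ i * partial i q (x - y))"
    have b: "\<bar>?D y\<bar> \<le> real CARD('n) * e' * norm v * indicator (cball x (r + 1)) y" for y
    proof (cases "dist x y \<le> r + 1")
      case True
      then show ?thesis
        using partial_increment_bound[OF q(1) d(2) v(1), where x = "x - y"] by (simp add: algebra_simps)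
    next
      case False
      then have "norm (x - y) > r" "norm (x + v - y) > r"
        using norm_triangle_ineq4[of "x + v - y" v] v by (auto simp: dist_norm algebra_simps)
      then show ?thesis using r supp_ball_partial[OF r(2)] False by (simp add: supp_ball_def)
    qed
    have I1: "integrable lborel (\<lambda>y. p y * q (x + v - y))" "integrable lborel (\<lambda>y. p y * q (x - y))"
      by (rule integrable_conv_integrand[OF p q(2)])+
    have I2: "integrable lborel (\<lambda>y. v $ i * (p y * partial i q (x - y)))" for i
      by (intro integrable_mult_right integrable_conv_integrand[OF p P])
    have eq: "p y * ?D y = p y * q (x + v - y) - p y * q (x - y) - (\<Sum>i\<in>UNIV. v $ i * (p y * partial i q (x - y)))" for y
      by (simp add: right_diff_distrib sum_distrib_left mult_ac)
    have ID: "integrable lborel (\<lambda>y. p y * ?D y)"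
      unfolding eq by (intro Bochner_Integration.integrable_diff Bochner_Integration.integrable_sum I1 I2)
    have "conv p q z - conv p q x - (\<Sum>i\<in>UNIV. v $ i * conv p (partial i q) x) = (LBINT y. p y * ?D y)"
      unfolding eq zv conv_def using I1 I2 by (simp add: Bochner_Integration.integral_sum)
    then have "\<bar>conv p q z - conv p q x - (\<Sum>i\<in>UNIV. v $ i * conv p (partial i q) x)\<bar>
        \<le> (LBINT y. \<bar>p y * ?D y\<bar>)" by (simp only: integral_abs_bound)
    also have "\<dots> \<le> (LBINT y. (real CARD('n) * e' * norm v) * (\<bar>p y\<bar> * indicator (cball x (r + 1)) y))"
    proof (rule Bochner_Integration.integral_mono)
      show "\<bar>p y * ?D y\<bar> \<le> real CARD('n) * e' * norm v * (\<bar>p y\<bar> * indicator (cball x (r + 1)) y)" for y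
        using mult_left_mono[OF b[of y] abs_ge_zero[of "p y"]] by (simp add: abs_mult mult_ac)
    qed (use ID IM in \<open>auto intro: integrable_mult_right\<close>)
    also have "\<dots> = (real CARD('n) * e' * M) * norm v" by (simp add: M_def)
    also have "\<dots> \<le> e * norm v" using e'(2) by (intro mult_right_mono) auto
    finally show "norm (conv p q z - conv p q x - (\<Sum>i\<in>UNIV. (z - x) $ i * conv p (partial i q) x)) \<le> e * norm (z - x)"
      by (simp add: v_def)
  qed (use d in auto)
qed

lemma partial_conv:
  assumes "continuous_on UNIV p" "Ck 1 q" "Cc q"
  shows "partial i (conv p q) = conv p (partial i q)"
proof (rule ext)
  fix x
  have "(\<Sum>j\<in>UNIV. axis i 1 $ j * conv p (partial j q) x)
      = (\<Sum>j\<in>UNIV. if j = i then conv p (partial i q) x else 0)"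
    by (rule sum.cong) (auto simp: axis_def)
  then show "partial i (conv p q) x = conv p (partial i q) x"
    by (simp add: partial_eqI[OF has_derivative_conv[OF assms]])
qed

text \<open>One derivative is given away: in the base case the continuity of the convolution is
  deduced from its differentiability.\<close>

lemma Ck_conv:
  fixes p q :: "real^'n::finite \<Rightarrow> real"
  assumes "continuous_on UNIV p"
  shows "Ck (Suc k) q \<Longrightarrow> Cc q \<Longrightarrow> Ck k (conv p q)"
proof (induction k arbitrary: q)
  case 0
  have "conv p q differentiable (at x)" for x
    using has_derivative_conv[OF assms, of q x] 0 unfolding differentiable_def by auto
  then show ?case by (simp add: continuous_on_eq_continuous_at differentiable_imp_continuous_within)
next
  case (Suc k)
  have 1: "Ck 1 q" using Ck_le[OF Suc.prems(1), of 1] by simp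
  show ?case
  proof (rule Ck_SucI)
    show "conv p q differentiable (at x)" for x
      using has_derivative_conv[OF assms 1 Suc.prems(2), of x] unfolding differentiable_def by blast
    show "Ck k (partial i (conv p q))" for i
      unfolding partial_conv[OF assms 1 Suc.prems(2)]
      by (rule Suc.IH[OF Ck_partial[OF Suc.prems(1)] Cc_partial[OF Suc.prems]])
  qed
qed

lemma continuous_conv:
  fixes p q :: "real^'n::finite \<Rightarrow> real"
  assumes "continuous_on UNIV p" "Ck 1 q" "Cc q"
  shows "continuous_on UNIV (conv p q)"
  using Ck_conv[OF assms(1), of 0 q] assms(2,3) by simp

lemma Cc_conv:
  fixes p q :: "real^'n::finite \<Rightarrow> real"
  assumes "Cc p" "Ck 1 q" "Cc q"
  shows "Cc (conv p q)"
  using continuous_conv[OF Cc_continuous[OF assms(1)] assms(2,3)] assms(1,3) supp_ball_conv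
  unfolding Cc_def by blast

lemma has_derivative_reflect:
  fixes f :: "real^'n::finite \<Rightarrow> real"
  assumes "f differentiable (at (x - y))"
  shows "((\<lambda>y. f (x - y)) has_derivative (\<lambda>v. frechet_derivative f (at (x - y)) (- v))) (at y)"
proof -
  have "((\<lambda>y. x - y) has_derivative (\<lambda>v. - v)) (at y)" by (auto intro!: derivative_eq_intros)
  from has_derivative_compose[OF this assms[unfolded frechet_derivative_works]] show ?thesis .
qed

lemma partial_reflect:
  fixes f :: "real^'n::finite \<Rightarrow> real"
  assumes "f differentiable (at (x - y))"
  shows "partial i (\<lambda>y. f (x - y)) y = - partial i f (x - y)"
proof -
  have "linear (frechet_derivative f (at (x - y)))"
    using assms by (simp add: linear_frechet_derivative)
  note neg = linear_neg[OF this]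
  show ?thesis by (subst partial_eqI[OF has_derivative_reflect[OF assms]]) (simp add: neg partial_def)
qed

lemma Ck_1_reflect:
  fixes f :: "real^'n::finite \<Rightarrow> real"
  assumes "Ck 1 f" shows "Ck 1 (\<lambda>y. f (x - y))"
proof -
  have D: "f differentiable (at x)" for x using assms Ck_differentiable[of 0] by auto
  have "Ck (Suc 0) (\<lambda>y. f (x - y))"
  proof (rule Ck_SucI)
    show "(\<lambda>y. f (x - y)) differentiable (at y)" for y
      using has_derivative_reflect[OF D] unfolding differentiable_def by blast
    have "partial i (\<lambda>y. f (x - y)) = (\<lambda>y. - partial i f (x - y))" for i
      by (rule ext) (rule partial_reflect[OF D])
    then show "Ck 0 (partial i (\<lambda>y. f (x - y)))" for i
      using continuous_on_compose2[of UNIV "partial i f" UNIV "\<lambda>y. x - y"] assms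
      by (simp add: continuous_on_diff continuous_on_minus)
  qed
  then show ?thesis by simp
qed

text \<open>The minus sign of the integration by parts cancels the one from differentiating
  \<open>q (x - y)\<close> in y.\<close>

lemma conv_partial_left:
  fixes p q :: "real^'n::finite \<Rightarrow> real"
  assumes p: "Ck 1 p" and q: "Ck 1 q" "Cc q"
  shows "conv (partial i p) q = conv p (partial i q)"
proof (rule ext)
  fix x
  have D: "q differentiable (at x)" for x using q Ck_differentiable[of 0] by auto
  show "conv (partial i p) q x = conv p (partial i q) x"
    using integral_by_parts[OF p Ck_1_reflect[OF q(1), of x] Cc_translate(2)[OF q(2), of x], of i]
    by (simp add: conv_def partial_reflect[OF D])
qed

lemma Fubini_Cc:
  fixes F :: "'a::euclidean_space \<times> 'a \<Rightarrow> real"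
  assumes "Cc F"
  shows "(LBINT x. LBINT y. F (x, y)) = (LBINT y. LBINT x. F (x, y))"
  using lborel_pair.Fubini_integral[of "\<lambda>x y. F (x, y)"] Cc_integrable[OF assms]
  by (simp add: lborel_prod split_def)

text \<open>Convolution with s is adjoint to convolution with its reflection. Fubini applies
  although p may grow: q confines y and s confines x - y. If |y| \<le> r and |x - y| \<le> t, then
  |x| + |y| \<le> 2 r + t, which is the radius used for the product.\<close>

lemma integral_conv_adjoint:
  fixes p q :: "'a::euclidean_space \<Rightarrow> real"
  assumes p: "continuous_on UNIV p" and q: "Cc q" and s: "Cc s"
  shows "(LBINT x. p x * conv q s x) = (LBINT y. q y * conv p (\<lambda>z. s (- z)) y)"
proof -
  obtain r where r: "r > 0" "supp_ball r q" using Cc_supp[OF q] .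
  obtain t where t: "t > 0" "supp_ball t s" using Cc_supp[OF s] .
  define F where "F z = p (fst z) * (q (snd z) * s (fst z - snd z))" for z
  have "supp_ball (2 * r + t) F"
    unfolding supp_ball_def
  proof (intro allI impI)
    fix z :: "'a \<times> 'a" assume "2 * r + t < norm z"
    then have n: "2 * r + t < norm (fst z) + norm (snd z)"
      using norm_Pair_le[of "fst z" "snd z"] by simp
    show "F z = 0"
    proof (cases "norm (snd z) > r")
      case True then show ?thesis using r by (simp add: supp_ball_def F_def)
    next
      case False
      then have "norm (fst z - snd z) > t" using n norm_triangle_ineq[of "fst z - snd z" "snd z"] by simp
      then show ?thesis using t by (simp add: supp_ball_def F_def)
    qed
  qed
  moreover have "continuous_on UNIV F"
    unfolding F_def using p q s
    by (intro continuous_on_mult continuous_on_compose2[OF p, of UNIV fst]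
        continuous_on_compose2[OF Cc_continuous[OF q], of UNIV snd]
        continuous_on_compose2[OF Cc_continuous[OF s], of UNIV "\<lambda>z. fst z - snd z"]
        continuous_on_diff continuous_on_fst continuous_on_snd continuous_on_id subset_UNIV)
  ultimately have "Cc F" by (rule CcI[rotated])
  from Fubini_Cc[OF this]
  have "(LBINT x. LBINT y. F (x, y)) = (LBINT y. LBINT x. F (x, y))" .
  moreover have "(LBINT y. F (x, y)) = p x * conv q s x" for x by (simp add: F_def conv_def)
  moreover have "(LBINT x. F (x, y)) = q y * conv p (\<lambda>z. s (- z)) y" for y
    by (simp add: F_def conv_def mult.left_commute[of "p _"])
  ultimately show ?thesis by simp
qed

text \<open>Jensen's inequality for the probability density \<open>q (x - y)\<close> in y, read off
  from the nonnegative variance of p about its mean \<open>?c\<close>.\<close>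

lemma conv_sq_le:
  fixes p q :: "'a::euclidean_space \<Rightarrow> real"
  assumes p: "continuous_on UNIV p" and q: "Cc q" "\<And>x. q x \<ge> 0" "(LBINT x. q x) = 1"
  shows "(conv p q x)^2 \<le> conv (\<lambda>y. (p y)^2) q x"
proof -
  let ?c = "conv p q x"
  have I: "integrable lborel (\<lambda>y. (p y)^2 * q (x - y))" "integrable lborel (\<lambda>y. p y * q (x - y))"
    by (intro integrable_conv_integrand q continuous_intros p)+
  have I1: "integrable lborel (\<lambda>y. q (x - y))" by (intro Cc_integrable Cc_translate q)
  have q1: "(LBINT y. q (x - y)) = 1" using integral_reflect[of q x] q by (simp add: Cc_def)
  have "0 \<le> (LBINT y. (p y - ?c)^2 * q (x - y))"
    by (rule integral_nonneg_AE) (simp add: q)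
  also have "\<dots> = (LBINT y. (p y)^2 * q (x - y) - (2 * ?c) * (p y * q (x - y)) + ?c^2 * q (x - y))"
    by (simp add: power2_eq_square algebra_simps)
  also have "\<dots> = conv (\<lambda>y. (p y)^2) q x - (2 * ?c) * ?c + ?c^2"
    using I I1 q1 by (simp add: conv_def)
  finally show ?thesis by (simp add: power2_eq_square)
qed

section \<open>Mollifiers\<close>

lemma integral_pos_continuous:
  fixes f :: "'a::euclidean_space \<Rightarrow> real"
  assumes f: "continuous_on UNIV f" "integrable lborel f" "\<And>x. f x \<ge> 0" "f a > 0"
  shows "(LBINT x. f x) > 0"
proof -
  have "isCont f a" using f(1) by (simp add: continuous_on_eq_continuous_at)
  then obtain d where d: "d > 0" "\<And>x. dist x a < d \<Longrightarrow> dist (f x) (f a) < f a / 2"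
    unfolding continuous_at_eps_delta using f(4) by (meson half_gt_zero)
  have b: "(f a / 2) * indicator (ball a d) x \<le> f x" for x
  proof (cases "dist x a < d")
    case True
    then show ?thesis using d(2)[OF True] by (simp add: dist_real_def dist_commute) argo
  qed (use f(3) in \<open>auto simp: indicator_def dist_commute\<close>)
  have "0 < (f a / 2) * measure lborel (ball a d)"
    using content_ball_pos[OF d(1), of a] f(4) by simp
  also have "\<dots> = (LBINT x. (f a / 2) * indicator (ball a d) x)" by simp
  also have "\<dots> \<le> (LBINT x. f x)"
    by (rule Bochner_Integration.integral_mono) (use b f(2) in \<open>auto intro!: integrable_mult_right integrable_real_indicator emeasure_bounded_finite\<close>)
  finally show ?thesis .
qed

text \<open>Class C^4 makes \<open>conv g q\<close> of class C^3 for merely continuous g, which is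
  the regularity of the test functions u in \<open>L u\<close>. Evenness makes convolution with q
  symmetric, and convolution with its partial derivatives antisymmetric, under the integral.\<close>

definition is_mollifier :: "real \<Rightarrow> (real^'n::finite \<Rightarrow> real) \<Rightarrow> bool" where
  "is_mollifier \<epsilon> q \<longleftrightarrow> Ck 4 q \<and> supp_ball \<epsilon> q \<and> (\<forall>x. q x \<ge> 0) \<and> (\<forall>x. q (- x) = q x)
     \<and> (LBINT x. q x) = 1"

lemma ex_mollifier:
  assumes "\<epsilon> > 0"
  obtains q :: "real^'n::finite \<Rightarrow> real" where "is_mollifier \<epsilon> q"
proof -
  define b :: "real^'n \<Rightarrow> real" where "b x = (max 0 (\<epsilon>^2 - (norm x)^2)) ^ Suc 4" for x
  have C: "Ck 4 b" unfolding b_def by (intro Ck_max_0_power Ck_diff Ck_const Ck_norm_square)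
  have S: "supp_ball \<epsilon> b"
    unfolding supp_ball_def b_def using assms by (auto simp: max_def dest!: power_strict_mono[of \<epsilon> _ 2])
  have Cc: "Cc b" by (rule CcI[OF Ck_continuous[OF C] S])
  have pos: "(LBINT x. b x) > 0"
    by (rule integral_pos_continuous[OF Ck_continuous[OF C] Cc_integrable[OF Cc], of 0])
      (use assms in \<open>auto simp: b_def\<close>)
  show thesis
  proof (rule that)
    show "is_mollifier \<epsilon> (\<lambda>x. inverse (LBINT x. b x) * b x)"
      unfolding is_mollifier_def
      using C S pos by (auto intro!: Ck_cmult supp_ball_intros) (auto simp: b_def)
  qed
qed

lemma partial_even:
  fixes q :: "real^'n::finite \<Rightarrow> real"
  assumes "\<And>x. q differentiable (at x)" "\<And>x. q (- x) = q x"
  shows "partial i q (- x) = - partial i q x"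
proof -
  have "partial i (\<lambda>y. q (0 - y)) x = - partial i q (0 - x)" by (rule partial_reflect) (rule assms)
  then show ?thesis using assms(2) by simp
qed

lemma is_mollifierD:
  assumes "is_mollifier \<epsilon> q"
  shows "Ck 4 q" "Cc q" "q x \<ge> 0" "supp_ball \<epsilon> q" "(LBINT x. q x) = 1" "q (- x) = q x"
    "Ck 1 q" "Cc (partial i q)" "Ck 1 (partial i q)" "Cc (partial i (partial i q))"
    "partial i q (- x) = - partial i q x"
proof -
  show q4: "Ck 4 q" and "q x \<ge> 0" and "supp_ball \<epsilon> q" and "(LBINT x. q x) = 1" and "q (- x) = q x"
    using assms by (auto simp: is_mollifier_def)
  show qc: "Cc q" using assms CcI[of q \<epsilon>] Ck_continuous[OF q4] by (simp add: is_mollifier_def)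
  show "Ck 1 q" by (rule Ck_le[OF q4]) simp
  then show "partial i q (- x) = - partial i q x"
    using assms Ck_differentiable[of 0 q] by (intro partial_even) (auto simp: is_mollifier_def)
  have "Ck 2 q" by (rule Ck_le[OF q4]) simp
  then have q2: "Ck (Suc (Suc 0)) q" by (simp add: numeral_2_eq_2)
  show pc: "Cc (partial i q)" by (rule Cc_partial[OF q2 qc])
  show q1: "Ck 1 (partial i q)" using Ck_partial[OF q2] by (simp del: Ck.simps)
  show "Cc (partial i (partial i q))" by (rule Cc_partial[of 0, OF _ pc]) (use q1 in simp)
qed

lemma Ck_conv_mollifier: "continuous_on UNIV g \<Longrightarrow> is_mollifier \<epsilon> q \<Longrightarrow> Ck 3 (conv g q)"
  using Ck_conv[of g 3 q] is_mollifierD(1,2)[of \<epsilon> q] by (simp add: eval_nat_numeral)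

lemma Cc_integral_sum:
  fixes f :: "'i \<Rightarrow> 'a::euclidean_space \<Rightarrow> real"
  assumes "\<And>i. i \<in> I \<Longrightarrow> Cc (f i)"
  shows "(LBINT x. (\<Sum>i\<in>I. f i x)) = (\<Sum>i\<in>I. LBINT x. f i x)"
  by (rule Bochner_Integration.integral_sum) (use assms Cc_integrable in auto)

text \<open>The constants 1/2, 2 and 5 are those of \<open>energy_pointwise\<close>.\<close>

lemma integral_combination:
  fixes A B C :: "'a \<Rightarrow> real"
  assumes "integrable M A" "integrable M B" "integrable M C"
  shows "integrable M (\<lambda>x. A x / 2 - 2 * B x - 5 * C x)"
    "(LINT x|M. A x) / 2 - 2 * (LINT x|M. B x) - 5 * (LINT x|M. C x) = (LINT x|M. A x / 2 - 2 * B x - 5 * C x)"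
  using assms by simp_all

section \<open>The operator \<open>L\<close> and Bochner's inequality\<close>

text \<open>The mass of w is finite by strong convexity (\<open>integrable_w\<close>) but is not
  normalized to 1; averages therefore carry a division by the integral of w.\<close>

locale gibbs_potential =
  fixes V :: "real^'n::finite \<Rightarrow> real" and \<kappa> :: real
  assumes smooth_V: "smooth V" and \<kappa>_pos: "\<kappa> > 0"
    and hessian_V: "\<And>x. loewner_le (mat \<kappa>) (hessian V x)"
begin

definition w :: "real^'n \<Rightarrow> real" where "w x = exp (- V x)"

definition L :: "(real^'n \<Rightarrow> real) \<Rightarrow> real^'n \<Rightarrow> real" where
  "L u x = (\<Sum>i\<in>UNIV. partial i (partial i u) x - partial i V x * partial i u x)"

definition wint :: "(real^'n \<Rightarrow> real) \<Rightarrow> real" where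
  "wint f = (LBINT x. f x * w x)"

abbreviation sqnorm :: "(real^'n \<Rightarrow> real) \<Rightarrow> real" where
  "sqnorm f \<equiv> wint (\<lambda>x. (f x)^2)"

abbreviation energy :: "(real^'n \<Rightarrow> real) \<Rightarrow> real" where
  "energy f \<equiv> (\<Sum>i\<in>UNIV. wint (\<lambda>x. (partial i f x)^2))"

abbreviation local_energy :: "(real^'n \<Rightarrow> real) \<Rightarrow> (real^'n \<Rightarrow> real) \<Rightarrow> real" where
  "local_energy \<eta> f \<equiv> wint (\<lambda>x. (\<eta> x)^2 * (\<Sum>i\<in>UNIV. (partial i f x)^2))"

lemma Ck_V: "Ck k V" using smooth_V by (simp add: smooth_def)

lemma Ck_partial_V: "Ck k (partial i V)" using Ck_V[of "Suc k"] by simp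

lemma Ck_w: "Ck k w"
  unfolding w_def using Ck_exp[OF Ck_cmult[OF Ck_V, of k "-1"]] by simp

lemma w_pos [simp]: "w x > 0" by (simp add: w_def)

lemma w_nz [simp]: "w x \<noteq> 0" by (simp add: w_def)

lemma w_nonneg [simp]: "w x \<ge> 0" by (simp add: w_def)

lemma Ck_inverse_w: "Ck k (\<lambda>x. inverse (w x))"
proof -
  have "(\<lambda>x. inverse (w x)) = (\<lambda>x. exp (V x))" by (simp add: w_def exp_minus fun_eq_iff)
  then show ?thesis by (simp add: Ck_exp Ck_V)
qed

lemma differentiable_V: "V differentiable (at x)"
  using Ck_differentiable[OF Ck_V] .

lemma differentiable_w: "w differentiable (at x)"
  using Ck_differentiable[OF Ck_w] .

lemma partial_w: "partial i w x = - (w x * partial i V x)"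
proof -
  have "((\<lambda>s. exp (- s)) has_real_derivative (- exp (- V x))) (at (V x))"
    by (auto intro!: derivative_eq_intros)
  from partial_compose_real[OF differentiable_V this, of i] show ?thesis
    by (simp add: w_def[abs_def])
qed

lemma Ck_L: "Ck (Suc (Suc k)) u \<Longrightarrow> Ck k (L u)"
  unfolding L_def
  by (intro Ck_sum Ck_diff Ck_mult Ck_partial_V Ck_partial) (auto dest: Ck_SucD simp del: Ck.simps intro: Ck_partial)

lemma supp_ball_L: "supp_ball r u \<Longrightarrow> supp_ball r (L u)"
  unfolding L_def by (intro supp_ball_intros supp_ball_partial)

lemma Cc_L: "Ck (Suc (Suc k)) u \<Longrightarrow> Cc u \<Longrightarrow> Cc (L u)"
  using CcI[OF Ck_continuous[OF Ck_L] supp_ball_L] by (auto simp: Cc_def)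

text \<open>L in divergence form: w L u is the divergence of w \<nabla>u, so each coordinate takes
  one integration by parts. The compact support of u removes the boundary terms, so F may be
  unbounded, such as a coordinate function.\<close>

lemma wint_L:
  assumes F: "Ck 1 F" and u: "Ck 2 u" "Cc u"
  shows "wint (\<lambda>x. F x * L u x) = - (\<Sum>i\<in>UNIV. wint (\<lambda>x. partial i F x * partial i u x))"
proof -
  have u1: "Ck 1 (partial i u)" for i using Ck_partial[of 1 u i] u by (simp add: numeral_2_eq_2 del: Ck.simps)
  have cu: "Cc (partial i u)" for i using Cc_partial[of 1 u i] u by (simp add: numeral_2_eq_2)
  have cuu: "Cc (partial i (partial i u))" for i using Cc_partial[of 0 "partial i u" i] u1 cu by simp
  let ?g = "\<lambda>i x. partial i u x * w x"
  have g: "Ck 1 (?g i)" "Cc (?g i)" for i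
    by (intro Ck_mult u1 Ck_w Cc_mult_left cu Ck_continuous[OF Ck_w])+
  have D: "partial i u differentiable (at x)" for i x using u1[of i] Ck_differentiable[of 0 "partial i u"] by (simp del: Ck.simps)
  have pg: "partial i (?g i) x = (partial i (partial i u) x - partial i V x * partial i u x) * w x" for i x
    unfolding partial_mult[OF D differentiable_w] partial_w by (simp add: algebra_simps)
  have cpg: "Cc (\<lambda>x. F x * partial i (?g i) x)" for i
    using Cc_partial[of 0 "?g i" i] g by (intro Cc_mult_right Ck_continuous[OF F]) simp
  have "wint (\<lambda>x. F x * L u x) = (LBINT x. (\<Sum>i\<in>UNIV. F x * partial i (?g i) x))"
    by (simp add: wint_def L_def pg sum_distrib_left sum_distrib_right mult.assoc)
  also have "\<dots> = (\<Sum>i\<in>UNIV. LBINT x. F x * partial i (?g i) x)"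
    by (rule Cc_integral_sum) (rule cpg)
  also have "\<dots> = (\<Sum>i\<in>UNIV. - (LBINT x. partial i F x * ?g i x))"
    using integral_by_parts[OF F g] by simp
  finally show ?thesis by (simp add: wint_def sum_negf mult.assoc)
qed

text \<open>The commutator of a partial derivative with L is a row of the Hessian of V applied to
  the gradient. It is the source of the curvature term in Bochner's formula.\<close>

lemma partial_L:
  assumes u: "Ck 3 u"
  shows "partial i (L u) x = L (partial i u) x - (\<Sum>j\<in>UNIV. partial i (partial j V) x * partial j u x)"
proof -
  have u2: "Ck 2 (partial j u)" for j using Ck_partial[of 2 u j] u by (simp add: numeral_3_eq_3 numeral_2_eq_2)
  have u1: "Ck 1 (partial k (partial j u))" for j k
    using Ck_partial[of 1 "partial j u" k] u2[of j] by (simp add: numeral_2_eq_2)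
  have uu: "Ck 2 u" using Ck_le[OF u, of 2] by simp
  have D: "partial j u differentiable (at x)" "partial k (partial j u) differentiable (at x)"
    "partial j V differentiable (at x)" for j k x
    using Ck_differentiable[of 1 "partial j u"] u2[of j] Ck_differentiable[of 0 "partial k (partial j u)"] u1[of k j]
      Ck_differentiable[OF Ck_partial_V]
    by (simp_all add: numeral_2_eq_2 del: Ck.simps)
  have D2: "(\<lambda>x. partial j V x * partial j u x) differentiable (at x)" for j x
    using D by simp
  have c1: "partial i (partial j u) = partial j (partial i u)" for j
    using partial_commute[OF uu] by (rule ext)
  have c2: "partial i (partial j (partial j u)) x = partial j (partial j (partial i u)) x" for j
    using partial_commute[OF u2[of j], of i j x] by (simp add: c1)
  show ?thesis
    unfolding L_def
    by (subst partial_sum)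
      (auto simp: D D2 partial_diff partial_mult c1 c2 sum_subtractf sum.distrib algebra_simps)
qed

lemma hessian_form:
  "v \<bullet> (hessian V x *v v) = (\<Sum>i\<in>UNIV. \<Sum>j\<in>UNIV. v $ i * partial i (partial j V) x * v $ j)"
  by (simp add: inner_vec_def matrix_vector_mult_def hessian_def sum_distrib_left mult.assoc)

lemma mat_form: "v \<bullet> (mat k *v v) = k * (\<Sum>i\<in>UNIV. (v $ i)^2)" for v :: "real^'n"
proof -
  have "mat k *v v = k *\<^sub>R v"
    by (simp add: vec_eq_iff matrix_vector_mult_def mat_def if_distrib[of "\<lambda>a. a * _"] cong: if_cong)
  then show ?thesis by (simp add: inner_vec_def power2_eq_square sum_distrib_left mult.left_commute)
qed

lemma hessian_V_ge:
  "\<kappa> * (\<Sum>i\<in>UNIV. (v i)^2) \<le> (\<Sum>i\<in>UNIV. \<Sum>j\<in>UNIV. v i * partial i (partial j V) x * v j)"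
  using hessian_V[of x, unfolded loewner_le_def, rule_format, of "\<chi> i. v i"]
  by (simp add: hessian_form mat_form)

lemma integrable_Cc_w: "Cc f \<Longrightarrow> integrable lborel (\<lambda>x. f x * w x)"
  by (intro Cc_integrable Cc_mult_left Ck_continuous[OF Ck_w])

text \<open>Two integrations by parts around a commutation: the first takes one L apart,
  \<open>partial_L\<close> moves the derivative inside the other, and the second turns <\<partial>_i
  u, L \<partial>_i u> into minus the squares of second derivatives. The commutator leaves the
  quadratic form of the Hessian of V, which is bounded below by \<kappa>.\<close>

lemma bochner:
  assumes u: "Ck 3 u" "Cc u"
  shows "sqnorm (L u) \<ge> (\<Sum>i\<in>UNIV. \<Sum>j\<in>UNIV. wint (\<lambda>x. (partial j (partial i u) x)^2))
      + \<kappa> * energy u"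
proof -
  have u2: "Ck 2 (partial j u)" for j using Ck_partial[of 2 u j] u(1) by (simp add: numeral_3_eq_3 numeral_2_eq_2)
  have uu: "Ck 2 u" using Ck_le[OF u(1), of 2] by simp
  have cu: "Cc (partial i u)" for i using Cc_partial[of 2 u i] u by (simp add: numeral_3_eq_3 numeral_2_eq_2)
  have cLu: "Cc (L (partial i u))" for i using Cc_L[of 0, OF _ cu] u2[of i] by (simp add: numeral_2_eq_2)
  have L1: "Ck 1 (L u)" using Ck_L[of 1 u] u(1) by (simp add: numeral_3_eq_3)
  let ?B = "\<lambda>x. \<Sum>i\<in>UNIV. \<Sum>j\<in>UNIV. partial i u x * partial i (partial j V) x * partial j u x"
  have cB: "Cc (\<lambda>x. \<Sum>j\<in>UNIV. partial i u x * partial i (partial j V) x * partial j u x)" for i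
    by (intro Cc_sum Cc_mult_right cu continuous_on_mult Cc_continuous[OF cu] Ck_continuous[OF Ck_partial[OF Ck_partial_V[of "Suc 0"]]])
  have cPL: "Cc (\<lambda>x. partial i u x * L (partial i u) x)" for i
    by (intro Cc_mult_right cLu Cc_continuous[OF cu])
  have "sqnorm (L u) = - (\<Sum>i\<in>UNIV. wint (\<lambda>x. partial i (L u) x * partial i u x))"
    using wint_L[OF L1 uu u(2)] by (simp add: power2_eq_square)
  also have "\<dots> = - (\<Sum>i\<in>UNIV. wint (\<lambda>x. partial i u x * L (partial i u) x)
      - wint (\<lambda>x. \<Sum>j\<in>UNIV. partial i u x * partial i (partial j V) x * partial j u x))"
  proof (rule arg_cong[where f = uminus], rule sum.cong[OF refl])
    fix i
    have e: "partial i (L u) x * partial i u x * w x = partial i u x * L (partial i u) x * w x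
        - (\<Sum>j\<in>UNIV. partial i u x * partial i (partial j V) x * partial j u x) * w x" for x
      by (simp add: partial_L[OF u(1)] algebra_simps sum_distrib_left sum_distrib_right)
    show "wint (\<lambda>x. partial i (L u) x * partial i u x) = wint (\<lambda>x. partial i u x * L (partial i u) x)
      - wint (\<lambda>x. \<Sum>j\<in>UNIV. partial i u x * partial i (partial j V) x * partial j u x)"
      unfolding wint_def e
      by (rule Bochner_Integration.integral_diff) (intro integrable_Cc_w cB cPL)+
  qed
  also have "\<dots> = (\<Sum>i\<in>UNIV. \<Sum>j\<in>UNIV. wint (\<lambda>x. (partial j (partial i u) x)^2)) + wint ?B"
  proof -
    have "wint (\<lambda>x. partial i u x * L (partial i u) x)
        = - (\<Sum>j\<in>UNIV. wint (\<lambda>x. (partial j (partial i u) x)^2))" for i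
      using wint_L[OF _ u2[of i] cu, of "partial i u" for i] Ck_le[OF u2[of i], of 1] by (simp add: power2_eq_square)
    moreover have "wint ?B = (\<Sum>i\<in>UNIV. wint (\<lambda>x. \<Sum>j\<in>UNIV. partial i u x * partial i (partial j V) x * partial j u x))"
      unfolding wint_def
      by (subst sum_distrib_right, rule Cc_integral_sum) (intro Cc_mult_left cB Ck_continuous[OF Ck_w])
    ultimately show ?thesis by (simp add: sum_subtractf sum_negf)
  qed
  finally have eq: "sqnorm (L u) = (\<Sum>i\<in>UNIV. \<Sum>j\<in>UNIV. wint (\<lambda>x. (partial j (partial i u) x)^2)) + wint ?B" .
  have "wint ?B \<ge> \<kappa> * energy u"
  proof -
    have "\<kappa> * energy u = (LBINT x. (\<kappa> * (\<Sum>i\<in>UNIV. (partial i u x)^2)) * w x)"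
      unfolding wint_def mult.assoc sum_distrib_right
      by (subst Cc_integral_sum[symmetric]) (auto intro!: Cc_mult_left Cc_power2 cu Ck_continuous[OF Ck_w] simp del: Ck.simps)
    also have "\<dots> \<le> wint ?B"
      unfolding wint_def
      by (rule Bochner_Integration.integral_mono)
        (auto intro!: integrable_Cc_w Cc_cmult Cc_sum[of UNIV "\<lambda>i x. (partial i u x)^2"] Cc_sum[OF cB]
          Cc_power2 cu mult_right_mono hessian_V_ge simp del: Ck.simps)
    finally show ?thesis .
  qed
  then show ?thesis unfolding eq by simp
qed

text \<open>The weak equation for h becomes a classical first-order expression in P: by adjointness
  all convolutions pass from the test function to h w, and one of the two derivatives goes along.
  The other stays on g, ready for a choice of g that contains P itself.\<close>

lemma wint_L_conv:
  assumes h: "continuous_on UNIV h" and q: "is_mollifier \<epsilon> q" and g: "Ck 1 g" "Cc g"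
  defines "P \<equiv> conv (\<lambda>x. h x * w x) q"
    and "b \<equiv> \<lambda>i. conv (\<lambda>x. h x * w x * partial i V x) q"
  shows "wint (\<lambda>x. h x * L (conv g q) x) = - (\<Sum>i\<in>UNIV. LBINT x. partial i g x * (partial i P x + b i x))"
proof -
  note qc = is_mollifierD(2)[OF q] and q1 = is_mollifierD(7)[OF q]
    and pq = is_mollifierD(8)[OF q] and pq1 = is_mollifierD(9)[OF q]
  have p: "continuous_on UNIV (\<lambda>x. h x * w x)" "continuous_on UNIV (\<lambda>x. h x * w x * partial i V x)" for i
    by (intro continuous_on_mult h Ck_continuous[OF Ck_w] Ck_continuous[OF Ck_partial_V])+
  have gi: "Cc (partial i g)" for i using Cc_partial[of 0 g i] g by simp
  have d1: "partial i (conv g q) = conv (partial i g) q" for i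
    by (simp only: partial_conv[OF Ck_continuous[OF g(1)] q1 qc] conv_partial_left[OF g(1) q1 qc])
  have d2: "partial i (partial i (conv g q)) = conv (partial i g) (partial i q)" for i
    unfolding d1 by (rule partial_conv[OF Cc_continuous[OF gi] q1 qc])
  have Pi: "partial i P = conv (\<lambda>x. h x * w x) (partial i q)" for i
    unfolding P_def by (rule partial_conv[OF p(1) q1 qc])
  note cc1 = Cc_conv[OF gi q1 qc] and cc2 = Cc_conv[OF gi pq1 pq]
  have P0: "continuous_on UNIV (partial i P)" for i
    unfolding Pi by (rule continuous_conv[OF p(1) pq1 pq])
  have b0: "continuous_on UNIV (b i)" for i
    unfolding b_def by (rule continuous_conv[OF p(2) q1 qc])
  \<comment> \<open>The minus sign comes from the oddness of \<open>partial i q\<close>.\<close>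
  have a1: "(LBINT x. h x * w x * conv (partial i g) (partial i q) x) = - (LBINT x. partial i g x * partial i P x)" for i
    unfolding integral_conv_adjoint[OF p(1) gi pq] Pi by (simp add: is_mollifierD(11)[OF q] conv_def)
  have a2: "(LBINT x. (h x * w x * partial i V x) * conv (partial i g) q x) = (LBINT x. partial i g x * b i x)" for i
    unfolding integral_conv_adjoint[OF p(2) gi qc] b_def by (simp add: is_mollifierD(6)[OF q])
  have e: "h x * L (conv g q) x * w x = (\<Sum>i\<in>UNIV. h x * w x * conv (partial i g) (partial i q) x
      - (h x * w x * partial i V x) * conv (partial i g) q x)" for x
    unfolding L_def d2 unfolding d1 by (simp add: sum_distrib_left sum_distrib_right algebra_simps)
  have "wint (\<lambda>x. h x * L (conv g q) x) = (\<Sum>i\<in>UNIV. LBINT x. (h x * w x * conv (partial i g) (partial i q) x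
      - (h x * w x * partial i V x) * conv (partial i g) q x))"
    unfolding wint_def e by (rule Cc_integral_sum) (intro Cc_diff Cc_mult_right p cc1 cc2)
  also have "\<dots> = (\<Sum>i\<in>UNIV. - (LBINT x. partial i g x * partial i P x) - (LBINT x. partial i g x * b i x))"
    using Cc_integrable[OF Cc_mult_right[OF p(1) cc2]] Cc_integrable[OF Cc_mult_right[OF p(2) cc1]]
    by (simp add: a1 a2)
  also have "\<dots> = - (\<Sum>i\<in>UNIV. LBINT x. partial i g x * (partial i P x + b i x))"
    using Cc_integrable[OF Cc_mult_left[OF P0 gi]] Cc_integrable[OF Cc_mult_left[OF b0 gi]]
    by (simp add: distrib_left sum_negf[symmetric])
  finally show ?thesis .
qed

text \<open>With \<open>a = \<eta> D \<surd>s\<close>, \<open>\<beta> = \<eta> c / \<surd>s\<close>, \<open>\<gamma> = \<eta>' H \<surd>s\<close> the right-hand side is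
  \<open>a\<^sup>2 + a \<beta> + 2 a \<gamma> + 2 \<beta> \<gamma>\<close>.\<close>

lemma energy_pointwise:
  fixes \<eta> \<eta>' D H c s :: real
  assumes "s > 0"
  shows "\<eta>^2 * D^2 * s / 2 - 2 * (\<eta>^2 * (c^2 / s)) - 5 * (\<eta>'^2 * (H^2 * s))
      \<le> (\<eta>^2 * D + 2 * \<eta> * \<eta>' * H) * (s * D + c)"
proof -
  define t where "t = sqrt s"
  have t: "t > 0" "s = t^2" using assms by (auto simp: t_def)
  define a \<beta> \<gamma> where "a = \<eta> * D * t" "\<beta> = \<eta> * c / t" "\<gamma> = \<eta>' * H * t"
  have e: "(\<eta>^2 * D + 2 * \<eta> * \<eta>' * H) * (s * D + c) = a^2 + a * \<beta> + 2 * a * \<gamma> + 2 * \<beta> * \<gamma>"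
    "\<eta>^2 * D^2 * s = a^2" "\<eta>^2 * (c^2 / s) = \<beta>^2" "\<eta>'^2 * (H^2 * s) = \<gamma>^2"
    using t(1) by (simp_all add: a_\<beta>_\<gamma>_def t(2) power2_eq_square field_simps)
  \<comment> \<open>This sum of squares is exactly the difference of the two sides; the constants 2
    and 5 are the total coefficients of \<beta>^2 and \<gamma>^2 in it.\<close>
  have "0 \<le> (a / 2 + \<beta>)^2 + (a / 2 + 2 * \<gamma>)^2 + (\<beta> + \<gamma>)^2" by simp
  then show ?thesis unfolding e by (simp add: power2_eq_square algebra_simps)
qed

text \<open>The density \<open>h w\<close> is mollified rather than \<open>h\<close>: testing against \<open>L (conv g q)\<close> then turns into
  an identity for \<open>moll h q\<close> up to a commutator of \<open>q\<close> with \<open>\<nabla>V\<close>.\<close>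

definition moll :: "(real^'n \<Rightarrow> real) \<Rightarrow> (real^'n \<Rightarrow> real) \<Rightarrow> real^'n \<Rightarrow> real" where
  "moll h q x = conv (\<lambda>x. h x * w x) q x * inverse (w x)"

lemma Ck_moll:
  assumes "continuous_on UNIV h" "is_mollifier \<epsilon> q"
  shows "Ck 3 (moll h q)"
proof -
  have "Ck 3 (conv (\<lambda>x. h x * w x) q)"
    by (intro Ck_conv_mollifier[OF _ assms(2)] continuous_on_mult assms(1) Ck_continuous[OF Ck_w])
  then show ?thesis unfolding moll_def by (intro Ck_mult Ck_inverse_w)
qed

text \<open>Caccioppoli's inequality, from the test function
  \<open>conv (\<lambda>x. (\<eta> x)^2 * H x) q\<close>. Since P = w H, the sum of \<partial>_i P
  and the mollified drift equals w \<partial>_i H + c_i: the drift survives only through the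
  commutator c, which is small at small scales. \<open>energy_pointwise\<close> absorbs the cross
  terms, and its constants 1/2, 2, 5 are doubled to 1, 4, 10.\<close>

lemma energy_estimate:
  assumes h: "continuous_on UNIV h" and q: "is_mollifier \<epsilon> q" and \<eta>: "Ck 1 \<eta>" "Cc \<eta>"
  defines "P \<equiv> conv (\<lambda>x. h x * w x) q"
    and "c \<equiv> \<lambda>i x. conv (\<lambda>x. h x * w x * partial i V x) q x - partial i V x * conv (\<lambda>x. h x * w x) q x"
    and "H \<equiv> moll h q"
  shows "local_energy \<eta> H
    \<le> 2 * \<bar>wint (\<lambda>x. h x * L (conv (\<lambda>x. (\<eta> x)^2 * H x) q) x)\<bar>
      + 4 * (\<Sum>i\<in>UNIV. LBINT x. (\<eta> x)^2 * ((c i x)^2 / w x))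
      + 10 * (\<Sum>i\<in>UNIV. LBINT x. (partial i \<eta> x)^2 * ((H x)^2 * w x))"
proof -
  have H3: "Ck 3 H" unfolding H_def by (rule Ck_moll[OF h q])
  have H1: "Ck 1 H" by (rule Ck_le[OF H3]) simp
  note q1 = is_mollifierD(7)[OF q] and qc = is_mollifierD(2)[OF q]
  have p: "continuous_on UNIV (\<lambda>x. h x * w x)" "continuous_on UNIV (\<lambda>x. h x * w x * partial i V x)" for i
    by (intro continuous_on_mult h Ck_continuous[OF Ck_w] Ck_continuous[OF Ck_partial_V])+
  have cc: "continuous_on UNIV (c i)" for i
    unfolding c_def by (intro continuous_on_diff continuous_on_mult continuous_conv p q1 qc Ck_continuous[OF Ck_partial_V])
  have DH: "H differentiable (at x)" and D\<eta>: "\<eta> differentiable (at x)" for x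
    using H1 \<eta> Ck_differentiable[of 0] by auto
  let ?g = "\<lambda>x. (\<eta> x)^2 * H x"
  have g: "Ck 1 ?g" "Cc ?g"
    unfolding power2_eq_square mult.assoc
    by (intro Ck_mult \<eta> H1 Cc_mult_left continuous_on_mult Ck_continuous[OF \<eta>(1)] Ck_continuous[OF H1])+
  have gi: "partial i ?g x = (\<eta> x)^2 * partial i H x + 2 * \<eta> x * partial i \<eta> x * H x" for i x
  proof -
    have D2: "(\<lambda>x. \<eta> x * \<eta> x) differentiable (at x)" using D\<eta> by simp
    show ?thesis unfolding power2_eq_square
      unfolding partial_mult[OF D2 DH] partial_mult[OF D\<eta> D\<eta>] by (simp add: algebra_simps)
  qed
  have P: "P = (\<lambda>x. w x * H x)" by (simp add: P_def H_def moll_def fun_eq_iff)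
  have Pi: "partial i P x + conv (\<lambda>x. h x * w x * partial i V x) q x = w x * partial i H x + c i x" for i x
  proof -
    have "partial i P x = w x * partial i H x - partial i V x * P x"
      unfolding P partial_mult[OF differentiable_w DH] partial_w by (simp add: algebra_simps)
    then show ?thesis by (simp add: c_def P_def)
  qed
  have c\<eta>i: "Cc (partial i \<eta>)" for i using Cc_partial[of 0 \<eta> i] \<eta> by simp
  have Hi: "continuous_on UNIV (partial i H)" for i using H1 by simp
  have \<eta>2: "Cc (\<lambda>x. (\<eta> x)^2 * f x)" if "continuous_on UNIV f" for f
    by (intro Cc_mult_left Cc_power2 \<eta> that)
  have wc: "continuous_on UNIV w" by (rule Ck_continuous[OF Ck_w])
  let ?A = "\<lambda>i x. (\<eta> x)^2 * ((partial i H x)^2 * w x)"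
    and ?B = "\<lambda>i x. (\<eta> x)^2 * ((c i x)^2 / w x)"
    and ?C = "\<lambda>i x. (partial i \<eta> x)^2 * ((H x)^2 * w x)"
    and ?D = "\<lambda>i x. partial i ?g x * (w x * partial i H x + c i x)"
  have I1: "integrable lborel (?A i)" for i
    by (intro Cc_integrable \<eta>2 continuous_intros Hi wc)
  have I2: "integrable lborel (?B i)" for i
    by (intro Cc_integrable \<eta>2 continuous_intros cc wc) simp
  have I3: "integrable lborel (?C i)" for i
    by (intro Cc_integrable Cc_mult_left Cc_power2 c\<eta>i continuous_intros Ck_continuous[OF H1] wc)
  have I4: "integrable lborel (?D i)" for i
    using Cc_partial[of 0 ?g i] g
    by (intro Cc_integrable Cc_mult_left continuous_intros Hi wc cc) simp
  have "integral\<^sup>L lborel (?A i) / 2 - 2 * integral\<^sup>L lborel (?B i) - 5 * integral\<^sup>L lborel (?C i)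
    \<le> integral\<^sup>L lborel (?D i)" for i
    unfolding integral_combination(2)[OF I1 I2 I3]
  proof (rule Bochner_Integration.integral_mono[OF integral_combination(1)[OF I1 I2 I3] I4])
    show "?A i x / 2 - 2 * ?B i x - 5 * ?C i x \<le> ?D i x" for x
      unfolding gi using energy_pointwise[OF w_pos, of "\<eta> x" "partial i H x" x "c i x" "partial i \<eta> x" "H x"]
      by (simp add: mult.assoc)
  qed
  then have "(\<Sum>i\<in>UNIV. integral\<^sup>L lborel (?A i) / 2 - 2 * integral\<^sup>L lborel (?B i) - 5 * integral\<^sup>L lborel (?C i))
    \<le> (\<Sum>i\<in>UNIV. integral\<^sup>L lborel (?D i))"
    by (rule sum_mono)
  moreover have "(\<Sum>i\<in>UNIV. integral\<^sup>L lborel (?D i)) = - wint (\<lambda>x. h x * L (conv ?g q) x)"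
    using wint_L_conv[OF h q g] Pi by (simp add: P_def)
  moreover have "local_energy \<eta> H = (\<Sum>i\<in>UNIV. integral\<^sup>L lborel (?A i))"
    unfolding wint_def sum_distrib_left sum_distrib_right mult.assoc
    by (rule Cc_integral_sum) (intro \<eta>2 continuous_intros Hi wc)
  ultimately show ?thesis
    by (simp add: sum_subtractf sum_distrib_left[symmetric] sum_divide_distrib[symmetric])
qed

end

section \<open>Weyl's lemma\<close>

lemma abs_le_one_plus_square: "\<bar>a\<bar> \<le> 1 + a^2" for a :: real
proof -
  have "0 \<le> (1 - \<bar>a\<bar>)^2" by simp
  then have "2 * \<bar>a\<bar> \<le> 1 + a^2" by (simp add: power2_diff)
  then show ?thesis by linarith
qed

lemma continuous_uniform_cball:
  fixes f :: "'a::euclidean_space \<Rightarrow> real"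
  assumes f: "continuous_on UNIV f" and e: "e > 0"
  obtains d where "d > 0" "\<And>x y. norm x \<le> r \<Longrightarrow> norm (x - y) \<le> d \<Longrightarrow> \<bar>f y - f x\<bar> \<le> e"
proof -
  have "uniformly_continuous_on (cball 0 (r + 1)) f"
    by (rule compact_uniformly_continuous) (use continuous_on_subset[OF f] in auto)
  from this[unfolded uniformly_continuous_on_def, rule_format, OF e]
  obtain d where d: "d > 0"
    "\<forall>x\<in>cball 0 (r + 1). \<forall>y\<in>cball 0 (r + 1). dist y x < d \<longrightarrow> dist (f y) (f x) < e"
    by blast
  show thesis
  proof (rule that[of "min (d / 2) 1"])
    show "\<bar>f y - f x\<bar> \<le> e" if *: "norm x \<le> r" "norm (x - y) \<le> min (d / 2) 1" for x y
    proof -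
      have "norm y \<le> norm x + norm (x - y)" using norm_triangle_ineq4[of x "x - y"] by simp
      then have "norm y \<le> r + 1" using * by auto
      then have "dist (f y) (f x) < e"
        using * d(1) by (intro d(2)[rule_format]) (auto simp: dist_norm norm_minus_commute)
      then show ?thesis by (simp add: dist_norm)
    qed
  qed (use d in auto)
qed

lemma continuous_bounded_cball:
  fixes f :: "'a::euclidean_space \<Rightarrow> real"
  assumes "continuous_on UNIV f"
  obtains M where "M > 0" "\<And>x. norm x \<le> r \<Longrightarrow> \<bar>f x\<bar> \<le> M"
proof -
  have "bounded (f ` cball 0 r)"
    by (intro compact_imp_bounded compact_continuous_image) (use continuous_on_subset[OF assms] in auto)
  then obtain M where "M > 0" "\<And>y. y \<in> f ` cball 0 r \<Longrightarrow> norm y \<le> M"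
    unfolding bounded_pos by blast
  then show thesis by (intro that[of M]) auto
qed

lemma Cc_bounded:
  fixes f :: "'a::euclidean_space \<Rightarrow> real"
  assumes "Cc f"
  obtains M where "M > 0" "\<And>x. \<bar>f x\<bar> \<le> M"
proof -
  obtain r where r: "supp_ball r f" using assms by (auto simp: Cc_def)
  obtain M where M: "M > 0" "\<And>x. norm x \<le> r \<Longrightarrow> \<bar>f x\<bar> \<le> M"
    using continuous_bounded_cball[OF Cc_continuous[OF assms]] by metis
  show thesis
  proof (rule that[OF M(1)])
    show "\<bar>f x\<bar> \<le> M" for x using M r by (cases "norm x \<le> r") (auto simp: supp_ball_def)
  qed
qed

lemma conv_mono_local:
  fixes F G q :: "'a::euclidean_space \<Rightarrow> real"
  assumes "continuous_on UNIV F" "continuous_on UNIV G" "Cc q" "\<And>x. q x \<ge> 0" "supp_ball \<epsilon> q"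
    and le: "\<And>y. norm (x - y) \<le> \<epsilon> \<Longrightarrow> F y \<le> G y"
  shows "conv F q x \<le> conv G q x"
  unfolding conv_def
proof (rule Bochner_Integration.integral_mono)
  show "F y * q (x - y) \<le> G y * q (x - y)" for y
  proof (cases "norm (x - y) \<le> \<epsilon>")
    case True
    then show ?thesis using le assms(4) by (intro mult_right_mono) auto
  next
    case False
    then show ?thesis using assms(5) by (simp add: supp_ball_def)
  qed
qed (rule integrable_conv_integrand; fact)+

lemma conv_cmult: "conv (\<lambda>y. c * F y) q x = c * conv F q x"
  by (simp add: conv_def mult.assoc)

lemma conv_const:
  fixes q :: "'a::euclidean_space \<Rightarrow> real"
  assumes "Cc q" "(LBINT x. q x) = 1"
  shows "conv (\<lambda>_. c) q x = c"
  using integral_reflect[of q x] assms by (simp add: conv_def Cc_def)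

text \<open>Averaging against a probability density supported in the \<epsilon>-ball cannot move a
  value by more than the oscillation of f there.\<close>

lemma conv_close:
  fixes f q :: "'a::euclidean_space \<Rightarrow> real"
  assumes f: "continuous_on UNIV f" and q: "Cc q" "\<And>x. q x \<ge> 0" "supp_ball \<epsilon> q" "(LBINT x. q x) = 1"
    and e: "\<And>y. norm (x - y) \<le> \<epsilon> \<Longrightarrow> \<bar>f y - f x\<bar> \<le> e"
  shows "\<bar>conv f q x - f x\<bar> \<le> e"
proof -
  have "f y \<le> f x + e" "f x - e \<le> f y" if "norm (x - y) \<le> \<epsilon>" for y
    using e[OF that] by auto
  then have "conv f q x \<le> conv (\<lambda>_. f x + e) q x" "conv (\<lambda>_. f x - e) q x \<le> conv f q x"
    by (intro conv_mono_local[OF _ _ q(1-3)]; auto intro: f)+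
  then show ?thesis unfolding conv_const[OF q(1,4)] by linarith
qed

lemma abs_conv_le:
  fixes g s :: "'a::euclidean_space \<Rightarrow> real"
  assumes g: "Cc g" and s: "Cc s" "\<And>x. \<bar>s x\<bar> \<le> S"
  shows "\<bar>conv g s x\<bar> \<le> S * (LBINT y. \<bar>g y\<bar>)"
proof -
  have I: "integrable lborel (\<lambda>y. \<bar>g y\<bar>)" by (intro Cc_integrable Cc_abs g)
  have "\<bar>conv g s x\<bar> \<le> (LBINT y. \<bar>g y * s (x - y)\<bar>)"
    unfolding conv_def by (rule integral_abs_bound)
  also have "\<dots> \<le> (LBINT y. S * \<bar>g y\<bar>)"
  proof (rule Bochner_Integration.integral_mono)
    show "integrable lborel (\<lambda>y. \<bar>g y * s (x - y)\<bar>)"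
      by (intro Cc_integrable Cc_abs Cc_conv_integrand s Cc_continuous[OF g])
    show "\<bar>g y * s (x - y)\<bar> \<le> S * \<bar>g y\<bar>" for y
      using mult_left_mono[OF s(2)[of "x - y"] abs_ge_zero[of "g y"]] by (simp add: abs_mult mult.commute)
  qed (use I in simp)
  finally show ?thesis by simp
qed

section \<open>Cutoff functions\<close>

definition cutoff :: "real \<Rightarrow> real^'n::finite \<Rightarrow> real" where
  "cutoff R x = (max 0 (1 - inverse (R^2) * (norm x)^2))^2"

lemma Ck_cutoff: "Ck 1 (cutoff R)"
proof -
  have "Ck 1 (\<lambda>x::real^'n. (max 0 (1 - inverse (R^2) * (norm x)^2)) ^ Suc 1)"
    by (intro Ck_max_0_power Ck_diff Ck_const Ck_cmult Ck_norm_square)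
  then show ?thesis by (simp add: cutoff_def[abs_def] numeral_2_eq_2 del: Ck.simps)
qed

lemma cutoff_nonneg [simp]: "cutoff R x \<ge> 0" by (simp add: cutoff_def)

lemma cutoff_le_1: "cutoff R x \<le> 1"
  unfolding cutoff_def by (intro power_le_one) auto

lemma supp_ball_cutoff: "R > 0 \<Longrightarrow> supp_ball R (cutoff R)"
  unfolding supp_ball_def cutoff_def
proof (intro allI impI)
  fix x :: "real^'n" assume "R > 0" "R < norm x"
  then have "R^2 \<le> (norm x)^2" by (intro power_mono) auto
  then have "1 \<le> inverse (R^2) * (norm x)^2" using \<open>R > 0\<close> by (simp add: field_simps)
  then show "(max 0 (1 - inverse (R^2) * (norm x)^2))^2 = 0" by simp
qed

lemma Cc_cutoff: "R > 0 \<Longrightarrow> Cc (cutoff R)"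
  using CcI[OF Ck_continuous[OF Ck_cutoff] supp_ball_cutoff] .

text \<open>The cutoff is not constant near the origin, so this lower bound stands in for being
  equal to 1 there. On the half ball the truncated quadratic is at least 3/4, and (3/4)^2 \<ge>
  1/2.\<close>

lemma cutoff_half: 
  assumes "R > 0" "norm x \<le> R / 2" shows "1 \<le> 4 * (cutoff R x)^2"
proof -
  have "(norm x)^2 \<le> (R / 2)^2" using assms by (intro power_mono) auto
  then have "inverse (R^2) * (norm x)^2 \<le> 1 / 4" using assms by (simp add: field_simps power2_eq_square)
  then have a: "3 / 4 \<le> max 0 (1 - inverse (R^2) * (norm x)^2)" by simp
  have "(3 / 4)^2 \<le> cutoff R x" unfolding cutoff_def by (rule power_mono[OF a]) simp
  then have "1 / 2 \<le> cutoff R x" by (simp add: power2_eq_square)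
  then have "(1 / 2)^2 \<le> (cutoff R x)^2" by (rule power_mono) simp
  then show ?thesis by (simp add: power2_eq_square)
qed

lemma abs_partial_cutoff_le:
  assumes "R > 0" shows "\<bar>partial i (cutoff R) x\<bar> \<le> 4 / R"
proof (cases "norm x \<le> R")
  case True
  let ?g = "\<lambda>x::real^'n. 1 - inverse (R^2) * (norm x)^2"
  have N: "(\<lambda>x::real^'n. (norm x)^2) differentiable (at x)" for x
    using Ck_differentiable[OF Ck_norm_square] .
  have "Ck (Suc 0) ?g" by (intro Ck_diff Ck_const Ck_cmult Ck_norm_square)
  then have D: "?g differentiable (at x)" for x using Ck_differentiable by blast
  have pg: "partial i ?g x = - 2 * inverse (R^2) * x $ i"
    by (subst partial_diff) (auto simp: N partial_mult partial_norm_square)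
  have "((\<lambda>s. (max 0 s)^2) has_real_derivative 2 * max 0 (?g x)) (at (?g x))"
    using DERIV_max_0_power[of 0 "?g x"] by (simp add: numeral_2_eq_2)
  from partial_compose_real[OF D this, of i]
  have "partial i (cutoff R) x = - (4 * max 0 (?g x) * inverse (R^2) * x $ i)"
    by (simp add: cutoff_def[abs_def] pg)
  then have "\<bar>partial i (cutoff R) x\<bar> = 4 * max 0 (?g x) * inverse (R^2) * \<bar>x $ i\<bar>"
    by (simp add: abs_mult)
  also have "\<dots> \<le> 4 * 1 * inverse (R^2) * R"
    by (intro mult_mono order_trans[OF component_le_norm_cart True]) auto
  also have "\<dots> = 4 / R" using assms by (simp add: power2_eq_square field_simps)
  finally show ?thesis .
next
  case False
  then have "partial i (cutoff R) x = 0"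
    using supp_ball_partial[OF supp_ball_cutoff[OF assms], of i] by (simp add: supp_ball_def)
  then show ?thesis using assms by simp
qed

context gibbs_potential
begin

lemma square_divide_w_bounded:
  assumes "Cc \<eta>"
  obtains S where "S > 0" "\<And>x. (\<eta> x)^2 / w x \<le> S"
proof -
  have "Cc (\<lambda>x. (\<eta> x)^2 * inverse (w x))"
    by (intro Cc_mult_left Cc_power2 assms Ck_continuous[OF Ck_inverse_w])
  then obtain S where S: "S > 0" "\<And>x. \<bar>(\<eta> x)^2 * inverse (w x)\<bar> \<le> S" by (rule Cc_bounded) blast
  show thesis
    by (rule that[OF S(1)]) (use abs_le_D1[OF S(2)] in \<open>simp add: divide_inverse\<close>)
qed

text \<open>A quantitative version of being a weak solution of L h = 0. The defect is measured
  against the norm of \<open>L u\<close>, which makes the condition homogeneous in u and is the form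
  in which near-minimizers satisfy it.\<close>

definition almost_orthogonal :: "real \<Rightarrow> (real^'n \<Rightarrow> real) \<Rightarrow> bool" where
  "almost_orthogonal \<tau> h \<longleftrightarrow> continuous_on UNIV h \<and> integrable lborel (\<lambda>x. (h x)^2 * w x) \<and>
     (\<forall>u. Ck 3 u \<longrightarrow> Cc u \<longrightarrow> \<bar>wint (\<lambda>x. h x * L u x)\<bar> \<le> \<tau> * sqrt (sqnorm (L u)))"

text \<open>At scale \<epsilon> the weight changes at most by the factor 2, which lets w be frozen
  inside a convolution, and \<nabla>V at most by \<omega> per component, which makes the commutator
  small.\<close>

definition slowly_varying :: "real \<Rightarrow> real \<Rightarrow> real \<Rightarrow> bool" where
  "slowly_varying r \<omega> \<epsilon> \<longleftrightarrow> (\<forall>x y. norm x \<le> r \<longrightarrow> norm (x - y) \<le> \<epsilon> \<longrightarrow>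
     w y \<le> 2 * w x \<and> (\<forall>i. \<bar>partial i V y - partial i V x\<bar> \<le> \<omega>))"

lemma continuous_w: "continuous_on UNIV w" by (rule Ck_continuous[OF Ck_w])

lemma continuous_partial_V: "continuous_on UNIV (partial i V)" by (rule Ck_continuous[OF Ck_partial_V])

lemma ex_slowly_varying:
  assumes "\<omega> > 0"
  obtains \<epsilon> where "\<epsilon> > 0" "\<And>\<epsilon>'. \<epsilon>' \<le> \<epsilon> \<Longrightarrow> slowly_varying r \<omega> \<epsilon>'"
proof -
  \<comment> \<open>An oscillation of V by at most ln 2 is a factor of at most 2 for w.\<close>
  obtain d0 where d0: "d0 > 0" "\<And>x y :: real^'n. norm x \<le> r \<Longrightarrow> norm (x - y) \<le> d0 \<Longrightarrow> \<bar>V y - V x\<bar> \<le> ln 2"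
    using continuous_uniform_cball[OF Ck_continuous[OF Ck_V], of "ln 2" r] by (auto simp del: ln_le_cancel_iff)
  have "\<forall>i. \<exists>d>0. \<forall>x y :: real^'n. norm x \<le> r \<longrightarrow> norm (x - y) \<le> d \<longrightarrow> \<bar>partial i V y - partial i V x\<bar> \<le> \<omega>"
    using continuous_uniform_cball[OF continuous_partial_V assms] by metis
  then obtain d where d: "\<And>i. d i > 0"
    "\<And>i (x::real^'n) y. norm x \<le> r \<Longrightarrow> norm (x - y) \<le> d i \<Longrightarrow> \<bar>partial i V y - partial i V x\<bar> \<le> \<omega>"
    by metis
  define e where "e = min d0 (Min (range d))"
  have "e > 0" using d(1) d0(1) by (auto simp: e_def Min_gr_iff)
  moreover have "slowly_varying r \<omega> \<epsilon>'" if "\<epsilon>' \<le> e" for \<epsilon>'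
    unfolding slowly_varying_def
  proof (intro allI impI conjI)
    fix x y :: "real^'n" assume *: "norm x \<le> r" "norm (x - y) \<le> \<epsilon>'"
    have "norm (x - y) \<le> d0" using * that by (simp add: e_def)
    then have "- V y \<le> ln 2 + - V x" using d0(2)[of x y] * by auto
    then have "w y \<le> exp (ln 2 + - V x)" by (simp add: w_def)
    also have "\<dots> = 2 * w x" unfolding exp_add by (simp add: w_def)
    finally show "w y \<le> 2 * w x" .
    fix i
    have "Min (range d) \<le> d i" by simp
    then have "norm (x - y) \<le> d i" using * that unfolding e_def by linarith
    then show "\<bar>partial i V y - partial i V x\<bar> \<le> \<omega>" using d(2) * by blast
  qed
  ultimately show thesis using that by blast
qed

section \<open>Bounds for \<open>moll h q\<close> that are uniform in h\<close>

context
  fixes h q :: "real^'n \<Rightarrow> real" and \<epsilon> r \<omega> A :: real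
  assumes h: "continuous_on UNIV h" and hw: "integrable lborel (\<lambda>x. (h x)^2 * w x)"
    and A: "sqnorm h \<le> A"
    and q: "is_mollifier \<epsilon> q" and slow: "slowly_varying r \<omega> \<epsilon>"
begin

lemma continuous_h2w: "continuous_on UNIV (\<lambda>x. (h x)^2 * w x)"
  by (intro continuous_intros h continuous_w)

text \<open>One factor w is frozen at x at the cost of 2. What remains under the convolution is the
  density h^2 w, whose total integral is at most A.\<close>

lemma conv_square_le:
  assumes "norm x \<le> r"
  shows "conv (\<lambda>y. (h y * w y)^2) q x \<le> 2 * w x * conv (\<lambda>y. (h y)^2 * w y) q x"
  unfolding conv_cmult[symmetric]
proof (rule conv_mono_local[OF _ _ is_mollifierD(2,3,4)[OF q]])
  fix y assume "norm (x - y) \<le> \<epsilon>"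
  then have "w y \<le> 2 * w x" using slow assms by (simp add: slowly_varying_def)
  then have "((h y)^2 * w y) * w y \<le> ((h y)^2 * w y) * (2 * w x)" by (intro mult_left_mono) auto
  then show "(h y * w y)^2 \<le> 2 * w x * ((h y)^2 * w y)" by (simp add: power2_eq_square mult_ac)
qed (intro continuous_intros h continuous_w)+

lemma moll_square_le:
  assumes "norm x \<le> r"
  shows "(moll h q x)^2 * w x \<le> 2 * conv (\<lambda>y. (h y)^2 * w y) q x"
proof -
  have "(conv (\<lambda>y. h y * w y) q x)^2 \<le> 2 * w x * conv (\<lambda>y. (h y)^2 * w y) q x"
    by (rule order_trans[OF conv_sq_le conv_square_le[OF assms]])
      (use is_mollifierD[OF q] in \<open>auto intro!: continuous_on_mult h continuous_w\<close>)
  then show ?thesis by (simp add: moll_def power2_eq_square field_simps)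
qed

text \<open>The commutator is a single convolution with the factor \<partial>_i V(y) - \<partial>_i
  V(x), which is at most \<omega> within the support of q; Jensen's inequality then separates
  \<omega>^2.\<close>

lemma commutator_square_le:
  assumes "norm x \<le> r"
  shows "(conv (\<lambda>x. h x * w x * partial i V x) q x - partial i V x * conv (\<lambda>x. h x * w x) q x)^2 / w x
    \<le> 2 * \<omega>^2 * conv (\<lambda>y. (h y)^2 * w y) q x" (is "?c^2 / _ \<le> _")
proof -
  have I: "integrable lborel (\<lambda>y. h y * w y * partial i V y * q (x - y))" "integrable lborel (\<lambda>y. h y * w y * q (x - y))"
    by (intro integrable_conv_integrand continuous_on_mult h continuous_w continuous_partial_V is_mollifierD(2)[OF q])+
  have "conv (\<lambda>y. h y * w y * (partial i V y - partial i V x)) q x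
    = (LBINT y. h y * w y * partial i V y * q (x - y) - partial i V x * (h y * w y * q (x - y)))"
    unfolding conv_def by (simp add: algebra_simps)
  also have "\<dots> = ?c" using I by (simp add: conv_def)
  finally have "?c^2 = (conv (\<lambda>y. h y * w y * (partial i V y - partial i V x)) q x)^2" by simp
  also have "\<dots> \<le> conv (\<lambda>y. (h y * w y * (partial i V y - partial i V x))^2) q x"
    by (rule conv_sq_le) (use is_mollifierD[OF q] in \<open>auto intro!: continuous_on_mult continuous_on_diff h continuous_w continuous_partial_V\<close>)
  also have "\<dots> \<le> conv (\<lambda>y. \<omega>^2 * (h y * w y)^2) q x"
  proof (rule conv_mono_local[OF _ _ is_mollifierD(2,3,4)[OF q]])
    fix y assume "norm (x - y) \<le> \<epsilon>"
    then have "\<bar>partial i V y - partial i V x\<bar> \<le> \<omega>" using slow assms by (simp add: slowly_varying_def)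
    then have "\<bar>partial i V y - partial i V x\<bar>^2 \<le> \<omega>^2" by (intro power_mono) auto
    then have "(h y * w y)^2 * (partial i V y - partial i V x)^2 \<le> (h y * w y)^2 * \<omega>^2" by (intro mult_left_mono) auto
    then show "(h y * w y * (partial i V y - partial i V x))^2 \<le> \<omega>^2 * (h y * w y)^2"
      by (simp add: power_mult_distrib mult.commute)
  qed (intro continuous_intros h continuous_w continuous_partial_V)+
  also have "\<dots> \<le> \<omega>^2 * (2 * w x * conv (\<lambda>y. (h y)^2 * w y) q x)"
    unfolding conv_cmult by (intro mult_left_mono conv_square_le assms) auto
  finally show ?thesis by (simp add: divide_le_eq mult_ac)
qed

text \<open>The mollification is moved onto a, which it keeps below S. The bound is thus independent
  of the scale \<epsilon>.\<close>

lemma integral_conv_le: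
  assumes a: "Cc a" "\<And>x. 0 \<le> a x" "\<And>x. a x \<le> S"
  shows "(LBINT x. a x * conv (\<lambda>y. (h y)^2 * w y) q x) \<le> S * A"
proof -
  note qD = is_mollifierD[OF q]
  have S: "S \<ge> 0" using a(2,3) order_trans by blast
  have ca: "Cc (conv a q)" by (rule Cc_conv[OF a(1) qD(7,2)])
  have le: "conv a q y \<le> S" for y
    using conv_mono_local[OF Cc_continuous[OF a(1)] continuous_on_const qD(2,3,4), of y S] a(3) conv_const[OF qD(2,5)] by simp
  have "(LBINT x. a x * conv (\<lambda>y. (h y)^2 * w y) q x) = (LBINT y. ((h y)^2 * w y) * conv a q y)"
    using integral_conv_adjoint[OF continuous_h2w a(1) qD(2)] by (simp add: qD(6))
  also have "\<dots> \<le> (LBINT y. S * ((h y)^2 * w y))"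
  proof (rule Bochner_Integration.integral_mono)
    show "integrable lborel (\<lambda>y. ((h y)^2 * w y) * conv a q y)"
      by (intro Cc_integrable Cc_mult_right continuous_h2w ca)
    show "((h y)^2 * w y) * conv a q y \<le> S * ((h y)^2 * w y)" for y
      using mult_left_mono[OF le[of y], of "(h y)^2 * w y"] by (simp add: mult.commute)
  qed (use hw in simp)
  also have "\<dots> \<le> S * A" using A S by (simp add: wint_def mult_left_mono)
  finally show ?thesis .
qed

lemma continuous_conv_h2w: "continuous_on UNIV (conv (\<lambda>y. (h y)^2 * w y) q)"
  by (rule continuous_conv[OF continuous_h2w is_mollifierD(7,2)[OF q]])

lemma integral_le_of_local:
  assumes a: "Cc a" "\<And>x. 0 \<le> a x" "\<And>x. a x \<le> S" "supp_ball r a"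
    and F: "continuous_on UNIV F" "\<And>x. norm x \<le> r \<Longrightarrow> F x \<le> K * conv (\<lambda>y. (h y)^2 * w y) q x" and K: "K \<ge> 0"
  shows "(LBINT x. a x * F x) \<le> K * (S * A)"
proof -
  have "(LBINT x. a x * F x) \<le> (LBINT x. K * (a x * conv (\<lambda>y. (h y)^2 * w y) q x))"
  proof (rule Bochner_Integration.integral_mono)
    show "integrable lborel (\<lambda>x. a x * F x)" by (intro Cc_integrable Cc_mult_left a F)
    show "integrable lborel (\<lambda>x. K * (a x * conv (\<lambda>y. (h y)^2 * w y) q x))"
      by (intro integrable_mult_right Cc_integrable Cc_mult_left a continuous_conv_h2w)
    show "a x * F x \<le> K * (a x * conv (\<lambda>y. (h y)^2 * w y) q x)" for x
    proof (cases "norm x \<le> r")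
      case True
      show ?thesis using mult_left_mono[OF F(2)[OF True] a(2)[of x]] by (simp add: mult_ac)
    qed (use a(4) in \<open>simp add: supp_ball_def\<close>)
  qed
  also have "\<dots> \<le> K * (S * A)" using integral_conv_le[OF a(1-3)] K by (simp add: mult_left_mono)
  finally show ?thesis .
qed

lemma Ck_moll': "Ck 3 (moll h q)" by (rule Ck_moll[OF h q])

lemma integral_moll_square_le:
  assumes "Cc a" "\<And>x. 0 \<le> a x" "\<And>x. a x \<le> S" "supp_ball r a"
  shows "(LBINT x. a x * ((moll h q x)^2 * w x)) \<le> 2 * (S * A)"
  by (rule integral_le_of_local[OF assms])
    (auto intro!: continuous_intros Ck_continuous[OF Ck_moll'] continuous_w moll_square_le)

text \<open>An L^1 bound from the L^2 bound through |t| \<le> 1 + t^2; the weight is brought in by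
  writing \<eta>^2 = (\<eta>^2 / w) w.\<close>

lemma integral_moll_le:
  assumes \<eta>: "Cc \<eta>" "supp_ball r \<eta>" and S: "\<And>x. (\<eta> x)^2 / w x \<le> S"
  shows "(LBINT x. \<bar>(\<eta> x)^2 * moll h q x\<bar>) \<le> (LBINT x. (\<eta> x)^2) + 2 * S * A"
proof -
  have c: "Cc (\<lambda>x. (\<eta> x)^2 / w x)" 
    unfolding divide_inverse by (intro Cc_mult_left Cc_power2 \<eta> Ck_continuous[OF Ck_inverse_w])
  have I: "integrable lborel (\<lambda>x. (\<eta> x)^2 / w x * ((moll h q x)^2 * w x))"
    by (intro Cc_integrable Cc_mult_left c continuous_intros Ck_continuous[OF Ck_moll'] continuous_w)
  have I2: "integrable lborel (\<lambda>x. (\<eta> x)^2)" by (intro Cc_integrable Cc_power2 \<eta>)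
  have "(LBINT x. \<bar>(\<eta> x)^2 * moll h q x\<bar>) \<le> (LBINT x. (\<eta> x)^2 + (\<eta> x)^2 / w x * ((moll h q x)^2 * w x))"
  proof (rule Bochner_Integration.integral_mono)
    show "integrable lborel (\<lambda>x. \<bar>(\<eta> x)^2 * moll h q x\<bar>)"
      by (intro Cc_integrable Cc_abs Cc_mult_left Cc_power2 \<eta> Ck_continuous[OF Ck_moll'])
    show "\<bar>(\<eta> x)^2 * moll h q x\<bar> \<le> (\<eta> x)^2 + (\<eta> x)^2 / w x * ((moll h q x)^2 * w x)" for x
      using mult_left_mono[OF abs_le_one_plus_square[of "moll h q x"], of "(\<eta> x)^2"]
      by (simp add: abs_mult algebra_simps)
  qed (use I I2 in simp)
  also have "\<dots> = (LBINT x. (\<eta> x)^2) + (LBINT x. (\<eta> x)^2 / w x * ((moll h q x)^2 * w x))"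
    by (rule Bochner_Integration.integral_add[OF I2 I])
  also have "(LBINT x. (\<eta> x)^2 / w x * ((moll h q x)^2 * w x)) \<le> 2 * (S * A)"
    by (rule integral_moll_square_le[OF c _ S]) (use \<eta> in \<open>auto simp: supp_ball_def\<close>)
  finally show ?thesis by (simp add: mult.assoc)
qed

end

text \<open>For a fixed mollifier both derivatives in L fall on q, so an L^1 bound on g suffices.
  The constant M depends on q, which forces the tolerance of orthogonality to be chosen after
  q.\<close>

lemma wint_L_conv_square_le:
  assumes q: "is_mollifier \<epsilon> q" and \<epsilon>: "\<epsilon> > 0"
  obtains M where "M \<ge> 0" "\<And>g. Ck 1 g \<Longrightarrow> Cc g \<Longrightarrow> supp_ball r g \<Longrightarrow>
    sqnorm (L (conv g q)) \<le> M * (LBINT x. \<bar>g x\<bar>)^2"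
proof -
  note qD = is_mollifierD[OF q]
  have "\<forall>i. \<exists>S. \<forall>x. \<bar>partial i q x\<bar> \<le> S" "\<forall>i. \<exists>S. \<forall>x. \<bar>partial i (partial i q) x\<bar> \<le> S"
    using Cc_bounded[OF qD(8)] Cc_bounded[OF qD(10)] by metis+
  then obtain S1 S2 where S: "\<And>i x. \<bar>partial i q x\<bar> \<le> S1 i" "\<And>i x. \<bar>partial i (partial i q) x\<bar> \<le> S2 i"
    by metis
  define B where "B x = (\<Sum>i\<in>UNIV. S2 i + \<bar>partial i V x\<bar> * S1 i)" for x
  define M where "M = (LBINT x. indicator (cball 0 (r + \<epsilon>)) x *\<^sub>R ((B x)^2 * w x))"
  have S1: "S1 i \<ge> 0" "S2 i \<ge> 0" for i using S[of i 0] by linarith+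
  have IM: "integrable lborel (\<lambda>x. indicator (cball 0 (r + \<epsilon>)) x *\<^sub>R ((B x)^2 * w x))"
    by (rule borel_integrable_compact)
      (auto simp: B_def intro!: continuous_intros continuous_on_subset[OF continuous_w] continuous_on_subset[OF continuous_partial_V])
  have "M \<ge> 0" unfolding M_def by (rule integral_nonneg_AE) auto
  moreover have "sqnorm (L (conv g q)) \<le> M * (LBINT x. \<bar>g x\<bar>)^2"
    if g: "Ck 1 g" "Cc g" "supp_ball r g" for g
  proof -
    let ?G = "LBINT x. \<bar>g x\<bar>"
    have G: "?G \<ge> 0" by (rule integral_nonneg_AE) auto
    note gc = Cc_continuous[OF g(2)]
    have d1: "partial i (conv g q) = conv g (partial i q)" for i by (rule partial_conv[OF gc qD(7,2)])
    have d2: "partial i (partial i (conv g q)) = conv g (partial i (partial i q))" for i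
      unfolding d1 by (rule partial_conv[OF gc qD(9,8)])
    have supp: "supp_ball (r + \<epsilon>) (conv g q)" by (rule supp_ball_conv[OF g(3) qD(4)])
    have C3: "Ck 3 (conv g q)" by (rule Ck_conv_mollifier[OF gc q])
    have LC: "Cc (L (conv g q))" using Cc_L[of 1 "conv g q"] C3 CcI[OF Ck_continuous[OF C3] supp] by (simp add: eval_nat_numeral)
    have b: "\<bar>L (conv g q) x\<bar> \<le> B x * ?G" for x
    proof -
      have "\<bar>L (conv g q) x\<bar> \<le> (\<Sum>i\<in>UNIV. \<bar>conv g (partial i (partial i q)) x - partial i V x * conv g (partial i q) x\<bar>)"
        unfolding L_def d2 unfolding d1 by (rule sum_abs)
      also have "\<dots> \<le> (\<Sum>i\<in>UNIV. (S2 i + \<bar>partial i V x\<bar> * S1 i) * ?G)"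
      proof (rule sum_mono)
        fix i
        have "\<bar>conv g (partial i (partial i q)) x\<bar> \<le> S2 i * ?G" "\<bar>conv g (partial i q) x\<bar> \<le> S1 i * ?G"
          by (rule abs_conv_le[OF g(2) qD(10) S(2)] abs_conv_le[OF g(2) qD(8) S(1)])+
        moreover have "\<bar>partial i V x * conv g (partial i q) x\<bar> \<le> \<bar>partial i V x\<bar> * (S1 i * ?G)"
          unfolding abs_mult by (intro mult_left_mono) (use calculation in auto)
        ultimately show "\<bar>conv g (partial i (partial i q)) x - partial i V x * conv g (partial i q) x\<bar>
            \<le> (S2 i + \<bar>partial i V x\<bar> * S1 i) * ?G"
          by (simp add: algebra_simps)
      qed
      finally show ?thesis by (simp add: B_def sum_distrib_right)
    qed
    have "sqnorm (L (conv g q)) \<le> (LBINT x. ?G^2 * (indicator (cball 0 (r + \<epsilon>)) x *\<^sub>R ((B x)^2 * w x)))"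
      unfolding wint_def
    proof (rule Bochner_Integration.integral_mono)
      show "integrable lborel (\<lambda>x. (L (conv g q) x)^2 * w x)" by (intro integrable_Cc_w Cc_power2 LC)
      show "integrable lborel (\<lambda>x. ?G^2 * (indicator (cball 0 (r + \<epsilon>)) x *\<^sub>R ((B x)^2 * w x)))"
        by (intro integrable_mult_right IM)
      show "(L (conv g q) x)^2 * w x \<le> ?G^2 * (indicator (cball 0 (r + \<epsilon>)) x *\<^sub>R ((B x)^2 * w x))" for x
      proof (cases "norm x \<le> r + \<epsilon>")
        case True
        have "\<bar>L (conv g q) x\<bar>^2 \<le> (B x * ?G)^2" by (intro power_mono b) auto
        from mult_right_mono[OF this w_nonneg[of x]] show ?thesis using True by (simp add: power_mult_distrib mult_ac)
      next
        case False
        then show ?thesis using supp_ball_L[OF supp] by (simp add: supp_ball_def)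
      qed
    qed
    also have "\<dots> = M * ?G^2" by (simp add: M_def)
    finally show ?thesis .
  qed
  ultimately show thesis using that by blast
qed

end

text \<open>The recipe for choosing a small parameter against a nonnegative constant x that may
  vanish.\<close>

lemma divide_add_one_mult_le:
  fixes s x :: real
  assumes "s > 0" "x \<ge> 0"
  shows "s / (x + 1) > 0" "s / (x + 1) * x \<le> s"
proof -
  show "s / (x + 1) > 0" using assms by simp
  then have "s / (x + 1) * x \<le> s / (x + 1) * (x + 1)" by (intro mult_left_mono) auto
  also have "\<dots> = s" using assms by simp
  finally show "s / (x + 1) * x \<le> s" .
qed

context gibbs_potential
begin

text \<open>The three error terms of \<open>energy_estimate\<close> have different fates. The defect
  of orthogonality is made small by \<tau>, the commutator by \<epsilon>, and the term with the
  gradient of \<eta> is left over; it becomes small only when the cutoff is taken wide. The scale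
  \<epsilon>0 and the tolerance \<tau> do not depend on h.\<close>

lemma energy_small:
  assumes \<eta>: "Ck 1 \<eta>" "supp_ball r \<eta>" "\<And>x. 0 \<le> \<eta> x" "\<And>x. \<eta> x \<le> 1" "\<And>i x. \<bar>partial i \<eta> x\<bar> \<le> D"
    and A: "A \<ge> 0" and \<sigma>: "\<sigma> > 0"
  obtains \<epsilon>0 where "\<epsilon>0 > 0" "\<And>\<epsilon> q. 0 < \<epsilon> \<Longrightarrow> \<epsilon> \<le> \<epsilon>0 \<Longrightarrow> is_mollifier \<epsilon> q \<Longrightarrow>
    \<exists>\<tau>>0. \<forall>h. almost_orthogonal \<tau> h \<longrightarrow> sqnorm h \<le> A \<longrightarrow>
      local_energy \<eta> (moll h q) \<le> \<sigma> + 20 * real CARD('n) * D^2 * A"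
proof -
  let ?n = "real CARD('n)"
  have \<eta>c: "Cc \<eta>" by (rule CcI[OF Ck_continuous[OF \<eta>(1)] \<eta>(2)])
  \<comment> \<open>Chosen to make the commutator term 8 n \<omega>^2 A at most \<sigma> / 2: a
    factor 4 from \<open>energy_estimate\<close>, a factor 2 from
    \<open>commutator_square_le\<close>.\<close>
  define \<omega> where "\<omega> = sqrt (\<sigma> / 2 / (8 * ?n * A + 1))"
  note f = divide_add_one_mult_le[of "\<sigma> / 2" "8 * ?n * A"]
  have \<omega>: "\<omega> > 0" "8 * ?n * \<omega>^2 * A \<le> \<sigma> / 2"
  proof -
    have "\<omega>^2 = \<sigma> / 2 / (8 * ?n * A + 1)" unfolding \<omega>_def by (rule real_sqrt_pow2) (use f(1) A \<sigma> in simp)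
    then have "8 * ?n * \<omega>^2 * A = \<sigma> / 2 / (8 * ?n * A + 1) * (8 * ?n * A)" by (simp only: mult_ac)
    then show "8 * ?n * \<omega>^2 * A \<le> \<sigma> / 2" using f(2) A \<sigma> by simp
    show "\<omega> > 0" unfolding \<omega>_def by (rule real_sqrt_gt_zero, rule f(1)) (use A \<sigma> in auto)
  qed
  obtain \<epsilon>0 where \<epsilon>0: "\<epsilon>0 > 0" "\<And>\<epsilon>'. \<epsilon>' \<le> \<epsilon>0 \<Longrightarrow> slowly_varying r \<omega> \<epsilon>'" by (rule ex_slowly_varying[OF \<omega>(1)]) blast
  obtain S where S: "S > 0" "\<And>x. (\<eta> x)^2 / w x \<le> S" by (rule square_divide_w_bounded[OF \<eta>c]) blast
  define G where "G = (LBINT x. (\<eta> x)^2) + 2 * S * A"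
  have G: "G \<ge> 0" unfolding G_def using S(1) A by (intro add_nonneg_nonneg integral_nonneg_AE) auto
  show thesis
  proof (rule that[OF \<epsilon>0(1)])
    fix \<epsilon> :: real and q :: "real^'n \<Rightarrow> real"
    assume \<epsilon>: "0 < \<epsilon>" "\<epsilon> \<le> \<epsilon>0" and q: "is_mollifier \<epsilon> q"
    have slow: "slowly_varying r \<omega> \<epsilon>" by (rule \<epsilon>0(2)[OF \<epsilon>(2)])
    obtain M where M: "M \<ge> 0" "\<And>g. Ck 1 g \<Longrightarrow> Cc g \<Longrightarrow> supp_ball r g \<Longrightarrow>
      sqnorm (L (conv g q)) \<le> M * (LBINT x. \<bar>g x\<bar>)^2"
      using wint_L_conv_square_le[OF q \<epsilon>(1), of r] by blast
    \<comment> \<open>The quarter of \<sigma> anticipates the factor 2 in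
      \<open>energy_estimate\<close>; sqrt M * G bounds the norm of \<open>L\<close> applied to the
      test function.\<close>
    define \<tau> where "\<tau> = \<sigma> / 4 / (sqrt M * G + 1)"
    have \<tau>: "\<tau> > 0" "2 * (\<tau> * (sqrt M * G)) \<le> \<sigma> / 2"
    proof -
      have MG: "\<sigma> / 4 > 0" "sqrt M * G \<ge> 0" using M(1) G \<sigma> by simp_all
      show "\<tau> > 0" unfolding \<tau>_def by (rule divide_add_one_mult_le(1)[OF MG])
      have "\<tau> * (sqrt M * G) \<le> \<sigma> / 4" unfolding \<tau>_def by (rule divide_add_one_mult_le(2)[OF MG])
      then show "2 * (\<tau> * (sqrt M * G)) \<le> \<sigma> / 2" by linarith
    qed
    have "local_energy \<eta> (moll h q) \<le> \<sigma> + 20 * ?n * D^2 * A"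
      if ao: "almost_orthogonal \<tau> h" and hA: "sqnorm h \<le> A" for h
    proof -
      have h: "continuous_on UNIV h" "integrable lborel (\<lambda>x. (h x)^2 * w x)"
        using ao by (auto simp: almost_orthogonal_def)
      note ctx = h hA q slow
      let ?H = "moll h q" and ?g = "\<lambda>x. (\<eta> x)^2 * moll h q x"
      let ?c = "\<lambda>i x. conv (\<lambda>x. h x * w x * partial i V x) q x - partial i V x * conv (\<lambda>x. h x * w x) q x"
      have H1: "Ck 1 ?H" by (rule Ck_le[OF Ck_moll[OF h(1) q]]) simp
      have g: "Ck 1 ?g" "Cc ?g" "supp_ball r ?g"
      proof -
        show "Ck 1 ?g" unfolding power2_eq_square by (intro Ck_mult \<eta> H1)
        show "Cc ?g" by (intro Cc_mult_left Cc_power2 \<eta>c Ck_continuous[OF H1])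
        show "supp_ball r ?g" using \<eta>(2) by (simp add: supp_ball_def)
      qed
      have gG: "(LBINT x. \<bar>?g x\<bar>) \<le> G"
        unfolding G_def by (rule integral_moll_le[OF ctx \<eta>c \<eta>(2) S(2)])
      have g0: "(LBINT x. \<bar>?g x\<bar>) \<ge> 0" by (rule integral_nonneg_AE) auto
      have C3: "Ck 3 (conv ?g q)" by (rule Ck_conv_mollifier[OF Cc_continuous[OF g(2)] q])
      have Cq: "Cc (conv ?g q)" by (rule Cc_conv[OF g(2) is_mollifierD(7,2)[OF q]])
      have "\<bar>wint (\<lambda>x. h x * L (conv ?g q) x)\<bar> \<le> \<tau> * sqrt (sqnorm (L (conv ?g q)))"
        using ao C3 Cq unfolding almost_orthogonal_def by blast
      also have "sqrt (sqnorm (L (conv ?g q))) \<le> sqrt (M * G^2)"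
        by (rule real_sqrt_le_mono, rule order_trans[OF M(2)[OF g]])
          (intro mult_left_mono power_mono gG g0 M(1))
      also have "sqrt (M * G^2) = sqrt M * G" using G by (simp add: real_sqrt_mult)
      finally have b1: "2 * \<bar>wint (\<lambda>x. h x * L (conv ?g q) x)\<bar> \<le> \<sigma> / 2"
        using \<tau> by (simp add: mult_left_mono)
      have \<eta>2: "Cc (\<lambda>x. (\<eta> x)^2)" "(\<eta> x)^2 \<le> 1" "supp_ball r (\<lambda>x. (\<eta> x)^2)" for x
        using \<eta>c \<eta> by (auto intro: Cc_power2 power_le_one simp: supp_ball_def)
      have pc: "continuous_on UNIV (conv (\<lambda>x. h x * w x) q)" "continuous_on UNIV (conv (\<lambda>x. h x * w x * partial i V x) q)" for i
        by (intro continuous_conv is_mollifierD(7,2)[OF q] continuous_on_mult h continuous_w continuous_partial_V)+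
      have b2: "(LBINT x. (\<eta> x)^2 * ((?c i x)^2 / w x)) \<le> 2 * \<omega>^2 * A" for i
      proof -
        have "(LBINT x. (\<eta> x)^2 * ((?c i x)^2 / w x)) \<le> 2 * \<omega>^2 * (1 * A)"
        proof (rule integral_le_of_local[OF ctx \<eta>2(1) _ \<eta>2(2,3)])
          show "continuous_on UNIV (\<lambda>x. (?c i x)^2 / w x)"
            by (intro continuous_intros pc continuous_partial_V continuous_w) simp
          show "(?c i x)^2 / w x \<le> 2 * \<omega>^2 * conv (\<lambda>y. (h y)^2 * w y) q x" if "norm x \<le> r" for x
            by (rule commutator_square_le[OF ctx that])
        qed auto
        then show ?thesis by simp
      qed
      have b3: "(LBINT x. (partial i \<eta> x)^2 * ((?H x)^2 * w x)) \<le> 2 * D^2 * A" for i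
      proof -
        have "Cc (partial i \<eta>)" using Cc_partial[of 0, OF _ \<eta>c] \<eta>(1) by simp
        have "(LBINT x. (partial i \<eta> x)^2 * ((?H x)^2 * w x)) \<le> 2 * (D^2 * A)"
        proof (rule integral_moll_square_le[OF ctx])
          show "Cc (\<lambda>x. (partial i \<eta> x)^2)" by (rule Cc_power2) fact
          show "(partial i \<eta> x)^2 \<le> D^2" for x using power_mono[OF \<eta>(5)[of i x], of 2] by simp
          show "supp_ball r (\<lambda>x. (partial i \<eta> x)^2)" using supp_ball_partial[OF \<eta>(2)] by (simp add: supp_ball_def)
        qed auto
        then show ?thesis by simp
      qed
      have "local_energy \<eta> ?H
        \<le> 2 * \<bar>wint (\<lambda>x. h x * L (conv ?g q) x)\<bar>
        + 4 * (\<Sum>i\<in>UNIV. LBINT x. (\<eta> x)^2 * ((?c i x)^2 / w x))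
        + 10 * (\<Sum>i\<in>UNIV. LBINT x. (partial i \<eta> x)^2 * ((?H x)^2 * w x))"
        by (rule energy_estimate[OF h(1) q \<eta>(1) \<eta>c])
      also have "\<dots> \<le> \<sigma> / 2 + 4 * (\<Sum>i\<in>(UNIV::'n set). 2 * \<omega>^2 * A) + 10 * (\<Sum>i\<in>(UNIV::'n set). 2 * D^2 * A)"
        by (intro add_mono mult_left_mono sum_mono b1 b2 b3) auto
      also have "\<dots> = \<sigma> / 2 + 8 * ?n * \<omega>^2 * A + 20 * ?n * D^2 * A" by simp
      also have "\<dots> \<le> \<sigma> + 20 * ?n * D^2 * A" using \<omega>(2) by simp
      finally show ?thesis .
    qed
    then show "\<exists>\<tau>>0. \<forall>h. almost_orthogonal \<tau> h \<longrightarrow> sqnorm h \<le> A \<longrightarrow>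
      local_energy \<eta> (moll h q) \<le> \<sigma> + 20 * ?n * D^2 * A"
      using \<tau>(1) by blast
  qed
qed

text \<open>A second mollification, at a scale independent of the first, upgrades the L^2 bound on
  \<nabla>H to a pointwise bound on the gradient of \<open>conv H \<theta>\<close>, by Jensen's
  inequality and the local bounds T and W. Against a mean-zero \<psi> only the oscillation of
  \<open>conv H \<theta>\<close> counts. The condition on R places the ball of radius r + 1 where
  \<open>cutoff_half\<close> applies.\<close>

lemma gradient_bound_conv:
  fixes \<psi> H :: "real^'n \<Rightarrow> real"
  assumes \<theta>: "is_mollifier \<delta> \<theta>" "\<delta> \<le> 1" and r: "r > 0" and \<psi>: "Cc \<psi>" "supp_ball r \<psi>" "(LBINT x. \<psi> x) = 0"
    and R: "R \<ge> 2 * (r + 1)"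
    and T: "\<And>x. \<bar>\<theta> x\<bar> \<le> T" "T > 0" and W: "\<And>x. norm x \<le> r + 1 \<Longrightarrow> inverse (w x) \<le> W" "W > 0"
    and H: "Ck 1 H" and E: "local_energy (cutoff R) H \<le> E"
  shows "\<bar>LBINT x. H x * conv \<psi> \<theta> x\<bar> \<le> (LBINT x. \<bar>\<psi> x\<bar>) * (r * sqrt (4 * T * W * E))"
proof -
  note \<theta>D = is_mollifierD[OF \<theta>(1)]
  have R0: "R > 0" using R r by (simp add: algebra_simps)
  let ?T = "conv H \<theta>"
  have Hc: "continuous_on UNIV H" by (rule Ck_continuous[OF H])
  have pHc: "continuous_on UNIV (partial i H)" for i using H by simp
  have T1: "Ck 1 ?T" by (rule Ck_le[OF Ck_conv_mollifier[OF Hc \<theta>(1)]]) simp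
  have pT: "partial i ?T = conv (partial i H) \<theta>" for i
    by (simp only: partial_conv[OF Hc \<theta>D(7,2)] conv_partial_left[OF H \<theta>D(7,2)])
  have E0: "E \<ge> 0"
    by (rule order_trans[OF _ E]) (auto simp: wint_def intro!: integral_nonneg_AE AE_I2 mult_nonneg_nonneg sum_nonneg)
  have grad: "(norm (gradient ?T y))^2 \<le> 4 * T * W * E" if y: "norm y \<le> r" for y
  proof -
    have I: "integrable lborel (\<lambda>z. (cutoff R z)^2 * ((partial i H z)^2 * w z))" for i
      by (intro Cc_integrable Cc_mult_left Cc_power2 Cc_cutoff R0 continuous_intros pHc continuous_w)
    have "(conv (partial i H) \<theta> y)^2 \<le> 4 * T * W * (LBINT z. (cutoff R z)^2 * ((partial i H z)^2 * w z))" for i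
    proof -
      have "(conv (partial i H) \<theta> y)^2 \<le> conv (\<lambda>z. (partial i H z)^2) \<theta> y"
        by (rule conv_sq_le[OF pHc \<theta>D(2,3,5)])
      also have "\<dots> \<le> (LBINT z. 4 * T * W * ((cutoff R z)^2 * ((partial i H z)^2 * w z)))"
        unfolding conv_def
      proof (rule Bochner_Integration.integral_mono)
        show "integrable lborel (\<lambda>z. (partial i H z)^2 * \<theta> (y - z))"
          by (intro integrable_conv_integrand continuous_intros pHc \<theta>D(2))
        show "integrable lborel (\<lambda>z. 4 * T * W * ((cutoff R z)^2 * ((partial i H z)^2 * w z)))"
          using I by simp
        show "(partial i H z)^2 * \<theta> (y - z) \<le> 4 * T * W * ((cutoff R z)^2 * ((partial i H z)^2 * w z))" for z
        proof (cases "norm (y - z) \<le> \<delta>")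
          case True
          have "norm z \<le> norm y + norm (y - z)" using norm_triangle_ineq4[of y "y - z"] by simp
          then have z: "norm z \<le> r + 1" using True \<theta>(2) y by linarith
          have "1 \<le> 4 * (cutoff R z)^2" by (rule cutoff_half[OF R0]) (use z R in \<open>simp add: algebra_simps\<close>)
          moreover have "1 \<le> W * w z" using W(1)[OF z] by (simp add: field_simps)
          ultimately have "1 * 1 \<le> (4 * (cutoff R z)^2) * (W * w z)" by (intro mult_mono) auto
          then have "(partial i H z)^2 * \<theta> (y - z) * 1 \<le> (partial i H z)^2 * T * ((4 * (cutoff R z)^2) * (W * w z))"
            using T(1)[of "y - z"] \<theta>D(3)[of "y - z"] T(2) by (intro mult_mono) auto
          then show ?thesis by (simp add: mult_ac)
        next
          case False
          then show ?thesis using \<theta>D(4) T(2) W(2) by (simp add: supp_ball_def)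
        qed
      qed
      finally show ?thesis by simp
    qed
    then have "(\<Sum>i\<in>UNIV. (conv (partial i H) \<theta> y)^2) \<le> (\<Sum>i\<in>UNIV. 4 * T * W * (LBINT z. (cutoff R z)^2 * ((partial i H z)^2 * w z)))"
      by (rule sum_mono)
    also have "\<dots> = 4 * T * W * local_energy (cutoff R) H"
      using I by (simp add: wint_def sum_distrib_left sum_distrib_right mult.assoc Bochner_Integration.integral_sum)
    also have "\<dots> \<le> 4 * T * W * E" using E T(2) W(2) by (simp add: mult_left_mono)
    finally show ?thesis unfolding norm_vec_square by (simp add: gradient_def pT power2_eq_square)
  qed
  have inc: "\<bar>?T x - ?T 0\<bar> \<le> r * sqrt (4 * T * W * E)" if x: "norm x \<le> r" for x
  proof -
    obtain s where s: "0 < s" "s < 1" "?T (0 + x) - ?T 0 = gradient ?T (0 + s *\<^sub>R x) \<bullet> x"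
      by (rule mean_value_along[OF T1, of 0 x])
    have "norm (s *\<^sub>R x) \<le> r" using s x by (simp add: order_trans[OF mult_left_le_one_le x])
    from real_sqrt_le_mono[OF grad[OF this]] have g: "norm (gradient ?T (s *\<^sub>R x)) \<le> sqrt (4 * T * W * E)" by simp
    have "\<bar>?T x - ?T 0\<bar> \<le> norm (gradient ?T (s *\<^sub>R x)) * norm x"
      using s(3) Cauchy_Schwarz_ineq2[of "gradient ?T (s *\<^sub>R x)" x] by simp
    also have "\<dots> \<le> sqrt (4 * T * W * E) * r" using g x T(2) W(2) E0 by (intro mult_mono) auto
    finally show ?thesis by (simp add: mult.commute)
  qed
  have Tc: "continuous_on UNIV ?T" by (rule Ck_continuous[OF T1])
  have I1: "integrable lborel (\<lambda>x. \<psi> x * ?T x)" "integrable lborel \<psi>"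
    by (intro Cc_integrable Cc_mult_left \<psi> Tc)+
  have "(LBINT x. H x * conv \<psi> \<theta> x) = (LBINT x. \<psi> x * ?T x)"
    using integral_conv_adjoint[OF Hc \<psi>(1) \<theta>D(2)] by (simp add: \<theta>D(6))
  \<comment> \<open>The mean of \<psi> vanishes, so the value at the origin may be
    subtracted.\<close>
  also have "\<dots> = (LBINT x. \<psi> x * ?T x) - (LBINT x. \<psi> x) * ?T 0" by (simp add: \<psi>(3))
  also have "\<dots> = (LBINT x. \<psi> x * (?T x - ?T 0))"
    using I1 by (simp add: right_diff_distrib)
  finally have "\<bar>LBINT x. H x * conv \<psi> \<theta> x\<bar> \<le> (LBINT x. \<bar>\<psi> x * (?T x - ?T 0)\<bar>)"
    by (simp only: integral_abs_bound)
  also have "\<dots> \<le> (LBINT x. \<bar>\<psi> x\<bar> * (r * sqrt (4 * T * W * E)))"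
  proof (rule Bochner_Integration.integral_mono)
    show "integrable lborel (\<lambda>x. \<bar>\<psi> x * (?T x - ?T 0)\<bar>)"
      by (intro Cc_integrable Cc_abs Cc_mult_left \<psi> continuous_intros Tc)
    show "integrable lborel (\<lambda>x. \<bar>\<psi> x\<bar> * (r * sqrt (4 * T * W * E)))" using I1 by simp
    show "\<bar>\<psi> x * (?T x - ?T 0)\<bar> \<le> \<bar>\<psi> x\<bar> * (r * sqrt (4 * T * W * E))" for x
    proof (cases "norm x \<le> r")
      case True
      then show ?thesis unfolding abs_mult by (intro mult_left_mono inc) auto
    next
      case False then show ?thesis using \<psi>(2) by (simp add: supp_ball_def)
    qed
  qed
  finally show ?thesis by simp
qed

text \<open>The order of the choices matters: first the scale \<open>\<delta>\<close> of the outer mollifier, then the cutoff radius \<open>R\<close>,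
  then the scale \<open>\<epsilon>\<close> of the inner mollifier, and \<open>\<tau>0\<close> last.\<close>

lemma almost_orthogonal_imp_almost_constant:
  assumes \<psi>: "Cc \<psi>" "(LBINT x. \<psi> x) = 0" and A: "A \<ge> 0" and \<sigma>: "\<sigma> > 0"
  obtains \<tau>0 where "\<tau>0 > 0" "\<And>h. almost_orthogonal \<tau>0 h \<Longrightarrow> sqnorm h \<le> A \<Longrightarrow>
    \<bar>LBINT x. h x * \<psi> x\<bar> \<le> \<sigma>"
proof -
  let ?n = "real CARD('n)"
  obtain r where r: "r > 0" "supp_ball r \<psi>" using Cc_supp[OF \<psi>(1)] .
  define B where "B = cball (0::real^'n) (r + 1)"
  have \<psi>c: "continuous_on UNIV \<psi>" by (rule Cc_continuous[OF \<psi>(1)])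
  have intB: "integrable lborel (\<lambda>x. indicator B x * f x)" if "continuous_on UNIV f" for f :: "real^'n \<Rightarrow> real"
    using borel_integrable_compact[of B f] continuous_on_subset[OF that] by (simp add: B_def)
  define W0 where "W0 = (LBINT x. indicator B x * w x)"
  have W0: "W0 \<ge> 0" unfolding W0_def by (rule integral_nonneg_AE) auto
  \<comment> \<open>The error budget is split into thirds: e1 for replacing h by
    \<open>moll h q\<close>, e2 for replacing \<psi> by \<open>conv \<psi> \<theta>\<close>, and E
    for the gradient bound on what is left. W0 + A arises from |h| w \<le> w + h^2 w on the ball
    B.\<close>
  define e1 where "e1 = \<sigma> / 3 / (W0 + A + 1)"
  have e1: "e1 > 0" "e1 * (W0 + A) \<le> \<sigma> / 3"
    using divide_add_one_mult_le[of "\<sigma> / 3" "W0 + A"] W0 A \<sigma> by (simp_all add: e1_def)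
  define R0 where "R0 = 2 * (r + 1)"
  have R0: "R0 > 0" using r by (simp add: R0_def)
  obtain S where S: "S > 0" "\<And>x. (cutoff R0 x)^2 / w x \<le> S" by (rule square_divide_w_bounded[OF Cc_cutoff[OF R0]]) blast
  define G where "G = (LBINT x. (cutoff R0 (x::real^'n))^2) + 2 * S * A"
  have G: "G \<ge> 0" unfolding G_def using S(1) A by (intro add_nonneg_nonneg integral_nonneg_AE) auto
  define e2 where "e2 = \<sigma> / 3 / (4 * G + 1)"
  have e2: "e2 > 0" "e2 * (4 * G) \<le> \<sigma> / 3"
    using divide_add_one_mult_le[of "\<sigma> / 3" "4 * G"] G \<sigma> by (simp_all add: e2_def)
  \<comment> \<open>\<Psi> takes up the division by w in \<open>moll\<close>, so that the even q can
    be moved from h w onto \<Psi>.\<close>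
  define \<Psi> where "\<Psi> x = \<psi> x * inverse (w x)" for x
  have \<Psi>: "Cc \<Psi>" unfolding \<Psi>_def by (intro Cc_mult_left \<psi> Ck_continuous[OF Ck_inverse_w])
  have \<Psi>s: "supp_ball r \<Psi>" unfolding \<Psi>_def by (rule supp_ball_intros(1)[OF r(2)])
  obtain d1 where d1: "d1 > 0" "\<And>x y. norm (x - y) < d1 \<Longrightarrow> \<bar>\<Psi> x - \<Psi> y\<bar> < e1"
    by (rule Cc_uniformly_continuous[OF \<Psi> e1(1)]) blast
  obtain d2 where d2: "d2 > 0" "\<And>x y. norm (x - y) < d2 \<Longrightarrow> \<bar>\<psi> x - \<psi> y\<bar> < e2"
    by (rule Cc_uniformly_continuous[OF \<psi>(1) e2(1)]) blast
  define \<delta> where "\<delta> = min (d2 / 2) 1"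
  have \<delta>: "\<delta> > 0" "\<delta> < d2" "\<delta> \<le> 1" using d2(1) by (auto simp: \<delta>_def)
  obtain \<theta> :: "real^'n \<Rightarrow> real" where \<theta>: "is_mollifier \<delta> \<theta>" using ex_mollifier[OF \<delta>(1)] .
  note \<theta>D = is_mollifierD[OF \<theta>]
  obtain T where T: "T > 0" "\<And>x. \<bar>\<theta> x\<bar> \<le> T" by (rule Cc_bounded[OF \<theta>D(2)]) blast
  obtain W where W: "W > 0" "\<And>x. norm x \<le> r + 1 \<Longrightarrow> \<bar>inverse (w x)\<bar> \<le> W"
    by (rule continuous_bounded_cball[OF Ck_continuous[OF Ck_inverse_w], of "r + 1"]) blast
  define N where "N = (LBINT x. \<bar>\<psi> x\<bar>) * r"
  have N: "N \<ge> 0" unfolding N_def using r by (intro mult_nonneg_nonneg integral_nonneg_AE) auto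
  define E where "E = (\<sigma> / 3 / (N + 1))^2 / (4 * T * W)"
  have E: "E > 0" using N \<sigma> T W by (simp add: E_def)
  have EN: "N * sqrt (4 * T * W * E) \<le> \<sigma> / 3"
  proof -
    have "4 * T * W * E = (\<sigma> / 3 / (N + 1))^2" using T W by (simp add: E_def)
    then have "sqrt (4 * T * W * E) = \<sigma> / 3 / (N + 1)" using N \<sigma> by simp
    then show ?thesis using divide_add_one_mult_le(2)[of "\<sigma> / 3" N] N \<sigma> by (simp only: mult.commute)
  qed
  \<comment> \<open>The leftover 20 n (4 / R)^2 A = 320 n A / R^2 must be at most E / 2, so R^2 has
    to reach 640 n A / E; since R \<ge> 1, it is enough that R does.\<close>
  define R where "R = R0 + 1 + 640 * ?n * A / E"
  have R: "R \<ge> R0" "R \<ge> 1" "R \<ge> 640 * ?n * A / E" using R0 A E by (auto simp: R_def)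
  have Rpos: "R > 0" using R by linarith
  have RE: "20 * ?n * (4 / R)^2 * A \<le> E / 2"
  proof -
    have "640 * ?n * A / E \<le> R * R" using R(3) mult_mono[OF R(2) order_refl, of R] Rpos by linarith
    then show ?thesis using E Rpos by (simp add: field_simps power2_eq_square)
  qed
  obtain \<epsilon>0 where \<epsilon>0: "\<epsilon>0 > 0" "\<And>\<epsilon> q. 0 < \<epsilon> \<Longrightarrow> \<epsilon> \<le> \<epsilon>0 \<Longrightarrow> is_mollifier \<epsilon> q \<Longrightarrow>
    \<exists>\<tau>>0. \<forall>h. almost_orthogonal \<tau> h \<longrightarrow> sqnorm h \<le> A \<longrightarrow>
      local_energy (cutoff R) (moll h q) \<le> E / 2 + 20 * ?n * (4 / R)^2 * A"
    using energy_small[OF Ck_cutoff supp_ball_cutoff[OF Rpos] cutoff_nonneg cutoff_le_1 abs_partial_cutoff_le[OF Rpos] A, of "E / 2"] E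
    by auto
  \<comment> \<open>Comparing weights on the ball of radius R0 gives the L^1 bound G for
    \<open>moll h q\<close>, where G was fixed before \<epsilon>.\<close>
  obtain \<epsilon>1 where \<epsilon>1: "\<epsilon>1 > 0" "\<And>\<epsilon>'. \<epsilon>' \<le> \<epsilon>1 \<Longrightarrow> slowly_varying R0 1 \<epsilon>'" by (rule ex_slowly_varying[of 1 R0]) auto
  define \<epsilon> where "\<epsilon> = min (min \<epsilon>0 \<epsilon>1) (min (d1 / 2) 1)"
  have \<epsilon>: "\<epsilon> > 0" "\<epsilon> \<le> \<epsilon>0" "\<epsilon> \<le> \<epsilon>1" "\<epsilon> < d1" "\<epsilon> \<le> 1" using \<epsilon>0 \<epsilon>1 d1 by (auto simp: \<epsilon>_def)
  obtain q :: "real^'n \<Rightarrow> real" where q: "is_mollifier \<epsilon> q" using ex_mollifier[OF \<epsilon>(1)] .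
  note qD = is_mollifierD[OF q]
  obtain \<tau>0 where \<tau>0: "\<tau>0 > 0" "\<And>h. almost_orthogonal \<tau>0 h \<Longrightarrow> sqnorm h \<le> A \<Longrightarrow>
      local_energy (cutoff R) (moll h q) \<le> E / 2 + 20 * ?n * (4 / R)^2 * A"
    using \<epsilon>0(2)[OF \<epsilon>(1,2) q] by blast
  show thesis
  proof (rule that[OF \<tau>0(1)])
    fix h assume ao: "almost_orthogonal \<tau>0 h" and hA: "sqnorm h \<le> A"
    have h: "continuous_on UNIV h" "integrable lborel (\<lambda>x. (h x)^2 * w x)"
      using ao by (auto simp: almost_orthogonal_def)
    note ctx = h hA q \<epsilon>1(2)[OF \<epsilon>(3)]
    let ?H = "moll h q" and ?p = "\<lambda>x. h x * w x"
    have H1: "Ck 1 ?H" by (rule Ck_le[OF Ck_moll[OF h(1) q]]) simp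
    have Hc: "continuous_on UNIV ?H" by (rule Ck_continuous[OF H1])
    have pc: "continuous_on UNIV ?p" by (intro continuous_on_mult h continuous_w)
    have c\<Psi>: "Cc (conv \<Psi> q)" "supp_ball (r + 1) (conv \<Psi> q)"
      by (rule Cc_conv[OF \<Psi> qD(7,2)], rule supp_ball_mono[OF supp_ball_conv[OF \<Psi>s qD(4)]]) (use \<epsilon> in simp)
    have c\<psi>: "Cc (conv \<psi> \<theta>)" "supp_ball (r + 1) (conv \<psi> \<theta>)"
      by (rule Cc_conv[OF \<psi>(1) \<theta>D(7,2)], rule supp_ball_mono[OF supp_ball_conv[OF r(2) \<theta>D(4)]]) (use \<delta> in simp)
    have s1: "\<bar>(LBINT x. h x * \<psi> x) - (LBINT x. ?H x * \<psi> x)\<bar> \<le> \<sigma> / 3"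
    proof -
      have "(LBINT x. ?H x * \<psi> x) = (LBINT x. \<Psi> x * conv ?p q x)"
        by (simp add: moll_def \<Psi>_def mult_ac)
      also have "\<dots> = (LBINT x. ?p x * conv \<Psi> q x)"
        using integral_conv_adjoint[OF pc \<Psi> qD(2)] by (simp add: qD(6))
      finally have "(LBINT x. h x * \<psi> x) - (LBINT x. ?H x * \<psi> x)
          = (LBINT x. ?p x * \<Psi> x) - (LBINT x. ?p x * conv \<Psi> q x)"
        by (simp add: \<Psi>_def mult_ac)
      also have "\<dots> = (LBINT x. ?p x * (\<Psi> x - conv \<Psi> q x))"
        using Cc_integrable[OF Cc_mult_right[OF pc \<Psi>]] Cc_integrable[OF Cc_mult_right[OF pc c\<Psi>(1)]]
        by (simp add: right_diff_distrib)
      finally have "\<bar>(LBINT x. h x * \<psi> x) - (LBINT x. ?H x * \<psi> x)\<bar>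
          \<le> (LBINT x. \<bar>?p x * (\<Psi> x - conv \<Psi> q x)\<bar>)"
        by (simp only: integral_abs_bound)
      also have "\<dots> \<le> (LBINT x. e1 * (indicator B x * w x + (h x)^2 * w x))"
      proof (rule Bochner_Integration.integral_mono)
        show "integrable lborel (\<lambda>x. \<bar>?p x * (\<Psi> x - conv \<Psi> q x)\<bar>)"
          by (intro Cc_integrable Cc_abs Cc_mult_right pc Cc_diff \<Psi> c\<Psi>)
        show "integrable lborel (\<lambda>x. e1 * (indicator B x * w x + (h x)^2 * w x))"
          using intB[OF continuous_w] h(2) by simp
        show "\<bar>?p x * (\<Psi> x - conv \<Psi> q x)\<bar> \<le> e1 * (indicator B x * w x + (h x)^2 * w x)" for x
        proof (cases "norm x \<le> r + 1")
          case True
          have "\<bar>conv \<Psi> q x - \<Psi> x\<bar> \<le> e1"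
          proof (rule conv_close[OF Cc_continuous[OF \<Psi>] qD(2,3,4,5)])
            fix y assume "norm (x - y) \<le> \<epsilon>"
            then show "\<bar>\<Psi> y - \<Psi> x\<bar> \<le> e1" using d1(2)[of y x] \<epsilon>(4) by (simp add: norm_minus_commute)
          qed
          then have "\<bar>h x\<bar> * \<bar>\<Psi> x - conv \<Psi> q x\<bar> \<le> (1 + (h x)^2) * e1"
            by (intro mult_mono abs_le_one_plus_square) auto
          from mult_right_mono[OF this w_nonneg[of x]]
          have "\<bar>h x\<bar> * \<bar>\<Psi> x - conv \<Psi> q x\<bar> * w x \<le> e1 * (w x + (h x)^2 * w x)"
            by (simp add: algebra_simps)
          moreover have "\<bar>?p x * (\<Psi> x - conv \<Psi> q x)\<bar> = \<bar>h x\<bar> * \<bar>\<Psi> x - conv \<Psi> q x\<bar> * w x"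
            by (simp add: abs_mult)
          ultimately show ?thesis using True by (simp add: B_def)
        next
          case False
          then have "\<Psi> x = 0" "conv \<Psi> q x = 0" using \<Psi>s c\<Psi>(2) by (auto simp: supp_ball_def)
          then show ?thesis using e1(1) by (simp add: B_def)
        qed
      qed
      also have "\<dots> = e1 * (W0 + sqnorm h)"
        using intB[OF continuous_w] h(2) by (simp add: W0_def wint_def)
      also have "\<dots> \<le> e1 * (W0 + A)" using hA e1(1) by (simp add: mult_left_mono)
      finally show ?thesis using e1(2) by linarith
    qed
    have s2: "\<bar>(LBINT x. ?H x * \<psi> x) - (LBINT x. ?H x * conv \<psi> \<theta> x)\<bar> \<le> \<sigma> / 3"
    proof -
      have IH: "integrable lborel (\<lambda>x. \<bar>(cutoff R0 x)^2 * ?H x\<bar>)"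
        by (intro Cc_integrable Cc_abs Cc_mult_left Cc_power2 Cc_cutoff R0 Hc)
      have "(LBINT x. ?H x * \<psi> x) - (LBINT x. ?H x * conv \<psi> \<theta> x)
          = (LBINT x. ?H x * (\<psi> x - conv \<psi> \<theta> x))"
        using Cc_integrable[OF Cc_mult_right[OF Hc \<psi>(1)]] Cc_integrable[OF Cc_mult_right[OF Hc c\<psi>(1)]]
        by (simp add: right_diff_distrib)
      then have "\<bar>(LBINT x. ?H x * \<psi> x) - (LBINT x. ?H x * conv \<psi> \<theta> x)\<bar>
          \<le> (LBINT x. \<bar>?H x * (\<psi> x - conv \<psi> \<theta> x)\<bar>)"
        by (simp only: integral_abs_bound)
      also have "\<dots> \<le> (LBINT x. e2 * (4 * \<bar>(cutoff R0 x)^2 * ?H x\<bar>))"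
      proof (rule Bochner_Integration.integral_mono)
        show "integrable lborel (\<lambda>x. \<bar>?H x * (\<psi> x - conv \<psi> \<theta> x)\<bar>)"
          by (intro Cc_integrable Cc_abs Cc_mult_right Hc Cc_diff \<psi> c\<psi>)
        show "integrable lborel (\<lambda>x. e2 * (4 * \<bar>(cutoff R0 x)^2 * ?H x\<bar>))" using IH by simp
        show "\<bar>?H x * (\<psi> x - conv \<psi> \<theta> x)\<bar> \<le> e2 * (4 * \<bar>(cutoff R0 x)^2 * ?H x\<bar>)" for x
        proof (cases "norm x \<le> r + 1")
          case True
          have "\<bar>conv \<psi> \<theta> x - \<psi> x\<bar> \<le> e2"
          proof (rule conv_close[OF \<psi>c \<theta>D(2,3,4,5)])
            fix y assume "norm (x - y) \<le> \<delta>"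
            then show "\<bar>\<psi> y - \<psi> x\<bar> \<le> e2" using d2(2)[of y x] \<delta>(2) by (simp add: norm_minus_commute)
          qed
          then have "\<bar>\<psi> x - conv \<psi> \<theta> x\<bar> * (\<bar>?H x\<bar> * 1) \<le> e2 * (\<bar>?H x\<bar> * (4 * (cutoff R0 x)^2))"
            using e2(1) True R0 by (intro mult_mono cutoff_half) (auto simp: R0_def)
          then show ?thesis by (simp add: abs_mult mult_ac)
        next
          case False
          then have "\<psi> x = 0" "conv \<psi> \<theta> x = 0" using r(2) c\<psi>(2) by (auto simp: supp_ball_def)
          then show ?thesis using e2(1) by simp
        qed
      qed
      also have "\<dots> = e2 * (4 * (LBINT x. \<bar>(cutoff R0 x)^2 * ?H x\<bar>))" by simp
      also have "\<dots> \<le> e2 * (4 * G)"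
        unfolding G_def using e2(1)
        by (intro mult_left_mono integral_moll_le[OF ctx Cc_cutoff[OF R0] supp_ball_cutoff[OF R0] S(2)]) auto
      finally show ?thesis using e2(2) by linarith
    qed
    have "local_energy (cutoff R) ?H \<le> E"
      using \<tau>0(2)[OF ao hA] RE by linarith
    from gradient_bound_conv[OF \<theta> \<delta>(3) r(1) \<psi>(1) r(2) \<psi>(2) _ T(2,1) _ W(1) H1 this] R(1) W(2)
    have "\<bar>LBINT x. ?H x * conv \<psi> \<theta> x\<bar> \<le> N * sqrt (4 * T * W * E)"
      by (simp add: R0_def N_def mult.assoc)
    then have s3: "\<bar>LBINT x. ?H x * conv \<psi> \<theta> x\<bar> \<le> \<sigma> / 3" using EN by linarith
    show "\<bar>LBINT x. h x * \<psi> x\<bar> \<le> \<sigma>" using s1 s2 s3 by linarith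
  qed
qed

end

section \<open>Density of the range of \<open>L\<close>\<close>

text \<open>The discriminant criterion, including the degenerate case c = 0. It yields the
  Cauchy-Schwarz inequality, its version for gradients, and the almost orthogonality of
  near-minimizers.\<close>

lemma quadratic_nonneg_imp_le:
  fixes a b c :: real
  assumes "\<And>t. 0 \<le> a - 2 * t * b + t^2 * c" "c \<ge> 0"
  shows "b^2 \<le> a * c"
proof (cases "c = 0")
  case True
  have "b = 0"
  proof (rule ccontr)
    assume "b \<noteq> 0"
    \<comment> \<open>This t turns the affine expression into -1.\<close>
    then show False using assms(1)[of "(a + 1) / (2 * b)"] True by simp
  qed
  then show ?thesis using True by simp
next
  case False
  then have c: "c > 0" using assms(2) by simp
  have "0 \<le> c * (a - 2 * (b / c) * b + (b / c)^2 * c)" using assms(1)[of "b / c"] c by simp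
  also have "\<dots> = a * c - b^2" using c by (simp add: field_simps power2_eq_square)
  finally show ?thesis by simp
qed

lemma cutoff_tendsto_1: "(\<lambda>n. cutoff (real (Suc n)) x) \<longlonglongrightarrow> 1"
proof -
  have "(\<lambda>n. inverse (real (Suc n))) \<longlonglongrightarrow> 0" by (rule LIMSEQ_inverse_real_of_nat)
  then have "(\<lambda>n. (max 0 (1 - (inverse (real (Suc n)))^2 * (norm x)^2))^2) \<longlonglongrightarrow> (max 0 (1 - 0^2 * (norm x)^2))^2"
    by (intro tendsto_intros)
  then show ?thesis by (simp add: cutoff_def power_inverse)
qed

text \<open>The integrand factors over the coordinates; each factor is a multiple of the normal
  density with variance 1 / (2 c).\<close>

lemma integrable_gaussian:
  assumes "c > 0"
  shows "integrable lborel (\<lambda>x::real^'n::finite. exp (- c * (norm x)^2))"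
proof (rule integrableI_bounded)
  have fin: "(\<integral>\<^sup>+t. ennreal (exp (- c * t^2)) \<partial>(lborel :: real measure)) < \<infinity>"
  proof -
    define s where "s = sqrt (1 / (2 * c))"
    have s: "s > 0" "s^2 = 1 / (2 * c)" using assms by (simp_all add: s_def)
    have "integrable lborel (\<lambda>t. sqrt (2 * pi * s^2) * normal_density 0 s t)"
      by (intro integrable_mult_right integrable_normal_density s)
    also have "(\<lambda>t. sqrt (2 * pi * s^2) * normal_density 0 s t) = (\<lambda>t. exp (- c * t^2))"
    proof (rule ext)
      fix t :: real
      have "sqrt (2 * pi * s^2) \<noteq> 0" using s(1) by simp
      then have "sqrt (2 * pi * s^2) * normal_density 0 s t = exp (- (t^2) / (2 * s^2))"
        unfolding normal_density_def by simp
      also have "- (t^2) / (2 * s^2) = - c * t^2" unfolding s(2) using assms by simp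
      finally show "sqrt (2 * pi * s^2) * normal_density 0 s t = exp (- c * t^2)" .
    qed
    finally have "integrable lborel (\<lambda>t. exp (- c * t^2))" .
    from this[unfolded integrable_iff_bounded] show ?thesis by simp
  qed
  have "(\<integral>\<^sup>+(x::real^'n). ennreal (norm (exp (- c * (norm x)^2))) \<partial>lborel)
      = (\<integral>\<^sup>+(x::real^'n). (\<Prod>b\<in>Basis. ennreal (exp (- c * (x \<bullet> b)^2))) \<partial>lborel)"
  proof (rule nn_integral_cong)
    fix x :: "real^'n"
    have "(norm x)^2 = (\<Sum>b\<in>Basis. (x \<bullet> b)^2)"
      by (subst power2_norm_eq_inner, subst euclidean_inner) (simp add: power2_eq_square)
    then show "ennreal (norm (exp (- c * (norm x)^2))) = (\<Prod>b\<in>Basis. ennreal (exp (- c * (x \<bullet> b)^2)))"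
      by (simp add: exp_sum[symmetric] sum_negf sum_distrib_left prod_ennreal)
  qed
  also have "\<dots> = (\<Prod>b\<in>(Basis :: (real^'n) set). (\<integral>\<^sup>+t. ennreal (exp (- c * t^2)) \<partial>lborel))"
    by (rule nn_integral_lborel_prod) auto
  also have "\<dots> < \<infinity>"
    by (simp add: fin[simplified] power_less_top_ennreal)
  finally show "(\<integral>\<^sup>+(x::real^'n). ennreal (norm (exp (- c * (norm x)^2))) \<partial>lborel) < \<infinity>" .
qed simp

section \<open>Continuous functions in L^2(w)\<close>

context gibbs_potential
begin

text \<open>Actual continuous functions instead of classes modulo null sets. The resulting space is
  not complete, which is why \<open>range_L_dense\<close> works with an infimum and near-minimizers
  rather than with a projection.\<close>

definition L2w :: "(real^'n \<Rightarrow> real) \<Rightarrow> bool" where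
  "L2w f \<longleftrightarrow> continuous_on UNIV f \<and> integrable lborel (\<lambda>x. (f x)^2 * w x)"

lemma integrable_w_bound:
  assumes "continuous_on UNIV f" "integrable lborel (\<lambda>x. g x * w x)" "\<And>x. \<bar>f x\<bar> \<le> g x"
  shows "integrable lborel (\<lambda>x. f x * w x)"
proof (rule Bochner_Integration.integrable_bound[OF assms(2)])
  show "(\<lambda>x. f x * w x) \<in> borel_measurable lborel"
    by (intro continuous_on_UNIV_borel continuous_on_mult assms(1) continuous_w)
  show "AE x in lborel. norm (f x * w x) \<le> norm (g x * w x)"
  proof (rule AE_I2)
    fix x
    have "\<bar>f x\<bar> \<le> \<bar>g x\<bar>" using assms(3)[of x] by linarith
    then show "norm (f x * w x) \<le> norm (g x * w x)" by (simp add: abs_mult mult_right_mono)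
  qed
qed

lemma L2w_continuous: "L2w f \<Longrightarrow> continuous_on UNIV f" by (simp add: L2w_def)

lemma L2w_mult_integrable:
  assumes "L2w f" "L2w g"
  shows "integrable lborel (\<lambda>x. f x * g x * w x)"
proof (rule integrable_w_bound)
  show "integrable lborel (\<lambda>x. ((f x)^2 + (g x)^2) * w x)"
    using assms by (simp add: L2w_def distrib_right)
  show "\<bar>f x * g x\<bar> \<le> (f x)^2 + (g x)^2" for x
  proof -
    have "0 \<le> (\<bar>f x\<bar> - \<bar>g x\<bar>)^2" by simp
    then have "2 * (\<bar>f x\<bar> * \<bar>g x\<bar>) \<le> (f x)^2 + (g x)^2" by (simp add: power2_diff)
    moreover have "0 \<le> \<bar>f x\<bar> * \<bar>g x\<bar>" by simp
    ultimately show ?thesis unfolding abs_mult by linarith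
  qed
qed (use assms in \<open>auto simp: L2w_def intro: continuous_on_mult\<close>)

lemma L2w_cmult: "L2w f \<Longrightarrow> L2w (\<lambda>x. c * f x)"
  by (auto simp: L2w_def power_mult_distrib mult.assoc intro: continuous_on_mult)

lemma L2w_add:
  assumes "L2w f" "L2w g" shows "L2w (\<lambda>x. f x + g x)"
proof -
  have "(\<lambda>x. (f x + g x)^2 * w x) = (\<lambda>x. (f x)^2 * w x + 2 * (f x * g x * w x) + (g x)^2 * w x)"
    by (simp add: power2_eq_square algebra_simps fun_eq_iff)
  then show ?thesis using assms L2w_mult_integrable[OF assms] by (auto simp: L2w_def intro: continuous_on_add)
qed

lemma L2w_diff: "L2w f \<Longrightarrow> L2w g \<Longrightarrow> L2w (\<lambda>x. f x - g x)"
  using L2w_add[of f "\<lambda>x. (-1) * g x"] L2w_cmult[of g "-1"] by simp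

lemma L2w_Cc: "Cc f \<Longrightarrow> L2w f"
  unfolding L2w_def by (intro conjI Cc_continuous integrable_Cc_w Cc_power2)

lemma wint_square_nonneg: "sqnorm f \<ge> 0"
  unfolding wint_def by (rule integral_nonneg_AE) auto

lemma wint_square_lincomb:
  assumes "L2w f" "L2w g"
  shows "wint (\<lambda>x. (f x - t * g x)^2) = sqnorm f - 2 * t * wint (\<lambda>x. f x * g x) + t^2 * sqnorm g"
proof -
  have "(\<lambda>x. (f x - t * g x)^2 * w x) = (\<lambda>x. (f x)^2 * w x - (2 * t) * (f x * g x * w x) + t^2 * ((g x)^2 * w x))"
    by (simp add: power2_eq_square algebra_simps fun_eq_iff)
  then show ?thesis using assms L2w_mult_integrable[OF assms] by (simp add: wint_def L2w_def)
qed

lemma wint_square_diff: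
  "L2w f \<Longrightarrow> L2w g \<Longrightarrow>
    wint (\<lambda>x. (f x - g x)^2) = sqnorm f - 2 * wint (\<lambda>x. f x * g x) + sqnorm g"
  using wint_square_lincomb[of f g 1] by simp

lemma wint_Cauchy_Schwarz:
  assumes "L2w f" "L2w g"
  shows "(wint (\<lambda>x. f x * g x))^2 \<le> sqnorm f * sqnorm g"
  by (rule quadratic_nonneg_imp_le[OF _ wint_square_nonneg])
    (simp add: wint_square_lincomb[OF assms, symmetric] wint_square_nonneg)

lemma abs_wint_mult_le:
  assumes "L2w f" "L2w g"
  shows "\<bar>wint (\<lambda>x. f x * g x)\<bar> \<le> sqrt (sqnorm f) * sqrt (sqnorm g)"
  using real_sqrt_le_mono[OF wint_Cauchy_Schwarz[OF assms]] by (simp add: real_sqrt_mult)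

text \<open>Strong convexity along the ray through x: the lower bound on the second derivative is
  integrated twice by monotonicity. It yields Gaussian decay of w.\<close>

lemma V_lower_bound: "V x \<ge> V 0 + gradient V 0 \<bullet> x + \<kappa> * (norm x)^2 / 2"
proof -
  let ?k = "\<kappa> * (norm x)^2"
  let ?v' = "\<lambda>t. \<Sum>i\<in>UNIV. partial i V (t *\<^sub>R x) * x $ i"
  have v': "((\<lambda>t. V (t *\<^sub>R x)) has_real_derivative ?v' t) (at t)" for t
    using has_real_derivative_along_line[of V 0 t x] differentiable_V by (simp add: gradient_def inner_vec_def)
  let ?v'' = "\<lambda>t. \<Sum>i\<in>UNIV. (\<Sum>j\<in>UNIV. partial j (partial i V) (t *\<^sub>R x) * x $ j) * x $ i"
  have v'': "(?v' has_real_derivative ?v'' t) (at t)" for t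
  proof (intro DERIV_sum DERIV_cmult_right)
    fix i
    show "((\<lambda>t. partial i V (t *\<^sub>R x)) has_real_derivative (\<Sum>j\<in>UNIV. partial j (partial i V) (t *\<^sub>R x) * x $ j)) (at t)"
      using has_real_derivative_along_line[of "partial i V" 0 t x] Ck_differentiable[OF Ck_partial_V]
      by (simp add: gradient_def inner_vec_def)
  qed
  have lb: "?v'' t \<ge> ?k" for t
  proof -
    have "?k = \<kappa> * (\<Sum>i\<in>UNIV. (x $ i)^2)" unfolding norm_vec_square by (simp add: power2_eq_square)
    also have "\<dots> \<le> (\<Sum>i\<in>UNIV. \<Sum>j\<in>UNIV. x $ i * partial i (partial j V) (t *\<^sub>R x) * x $ j)"
      by (rule hessian_V_ge)
    also have "\<dots> = ?v'' t"
      by (subst sum.swap) (simp add: sum_distrib_left mult_ac)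
    finally show ?thesis .
  qed
  have 1: "?v' t \<ge> ?v' 0 + ?k * t" if "t \<ge> 0" for t
  proof -
    have "((\<lambda>t. ?v' t - ?k * t) has_real_derivative (?v'' t - ?k)) (at t)" for t
      by (rule DERIV_diff[OF v'']) (auto intro!: derivative_eq_intros)
    then have "?v' 0 - ?k * 0 \<le> ?v' t - ?k * t"
      using lb that by (intro DERIV_nonneg_imp_nondecreasing[of 0 t "\<lambda>t. ?v' t - ?k * t"]) (auto intro!: exI[of _ "?v'' _ - ?k"])
    then show ?thesis by simp
  qed
  have "((\<lambda>t. V (t *\<^sub>R x) - ?v' 0 * t - ?k * t^2 / 2) has_real_derivative (?v' t - ?v' 0 - ?k * t)) (at t)" for t
    by (intro DERIV_diff v') (auto intro!: derivative_eq_intros)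
  moreover have "?v' t - ?v' 0 - ?k * t \<ge> 0" if "t \<ge> 0" for t using 1[OF that] by simp
  ultimately have "V (0 *\<^sub>R x) - ?v' 0 * 0 - ?k * 0^2 / 2 \<le> V (1 *\<^sub>R x) - ?v' 0 * 1 - ?k * 1^2 / 2"
    by (intro DERIV_nonneg_imp_nondecreasing[of 0 1 "\<lambda>t. V (t *\<^sub>R x) - ?v' 0 * t - ?k * t^2 / 2"]) (auto intro!: exI)
  then show ?thesis by (simp add: gradient_def inner_vec_def)
qed

text \<open>Half of the decay rate \<kappa> / 2 from \<open>V_lower_bound\<close> absorbs the linear
  term by completing a square, and half of the remaining \<kappa> / 4 absorbs the polynomial factor.
  The rate \<kappa> / 8 is left over.\<close>

lemma integrable_quadratic_w: "integrable lborel (\<lambda>x. (1 + (norm x)^2) * w x)"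
proof -
  define a where "a = norm (gradient V 0)"
  define C where "C = exp (- V 0 + a^2 / \<kappa>) * (1 + 8 / \<kappa>)"
  have b: "(1 + (norm x)^2) * w x \<le> C * exp (- (\<kappa> / 8) * (norm x)^2)" for x
  proof -
    define s where "s = norm x"
    have "- (gradient V 0 \<bullet> x) \<le> a * s"
      using Cauchy_Schwarz_ineq2[of "gradient V 0" x] by (simp add: a_def s_def)
    moreover have "a * s \<le> a^2 / \<kappa> + \<kappa> * s^2 / 4"
    proof -
      have "0 \<le> (a - \<kappa> * s / 2)^2 / \<kappa>" using \<kappa>_pos by simp
      also have "\<dots> = a^2 / \<kappa> + \<kappa> * s^2 / 4 - a * s" using \<kappa>_pos by (simp add: power2_eq_square field_simps)
      finally show ?thesis by simp
    qed
    ultimately have "- V x \<le> (- V 0 + a^2 / \<kappa>) + (- (\<kappa> / 4) * s^2)"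
      using V_lower_bound[of x] by (simp add: s_def)
    then have "w x \<le> exp ((- V 0 + a^2 / \<kappa>) + (- (\<kappa> / 4) * s^2))" by (simp add: w_def)
    then have w: "w x \<le> exp (- V 0 + a^2 / \<kappa>) * exp (- (\<kappa> / 4) * s^2)" by (simp only: exp_add)
    have "1 + s^2 \<le> (1 + 8 / \<kappa>) * exp (\<kappa> / 8 * s^2)"
    proof -
      have e: "1 + \<kappa> / 8 * s^2 \<le> exp (\<kappa> / 8 * s^2)" by (rule exp_ge_add_one_self)
      have "1 + s^2 \<le> (1 + 8 / \<kappa>) * (1 + \<kappa> / 8 * s^2)" using \<kappa>_pos by (simp add: field_simps)
      also have "\<dots> \<le> (1 + 8 / \<kappa>) * exp (\<kappa> / 8 * s^2)" using e \<kappa>_pos by (intro mult_left_mono) auto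
      finally show ?thesis .
    qed
    then have "(1 + s^2) * w x \<le> ((1 + 8 / \<kappa>) * exp (\<kappa> / 8 * s^2)) * (exp (- V 0 + a^2 / \<kappa>) * exp (- (\<kappa> / 4) * s^2))"
      using w \<kappa>_pos by (intro mult_mono) auto
    also have "\<dots> = C * (exp (\<kappa> / 8 * s^2) * exp (- (\<kappa> / 4) * s^2))" by (simp add: C_def)
    also have "exp (\<kappa> / 8 * s^2) * exp (- (\<kappa> / 4) * s^2) = exp (- (\<kappa> / 8) * s^2)"
      by (simp add: exp_add[symmetric] algebra_simps)
    finally show ?thesis by (simp add: s_def)
  qed
  show ?thesis
  proof (rule Bochner_Integration.integrable_bound)
    show "integrable lborel (\<lambda>x::real^'n. C * exp (- (\<kappa> / 8) * (norm x)^2))"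
      using \<kappa>_pos by (intro integrable_mult_right integrable_gaussian) simp
    show "(\<lambda>x. (1 + (norm x)^2) * w x) \<in> borel_measurable lborel"
      by (intro continuous_on_UNIV_borel continuous_intros continuous_w)
    show "AE x in lborel. norm ((1 + (norm x)^2) * w x) \<le> norm (C * exp (- (\<kappa> / 8) * (norm x)^2))"
    proof (rule AE_I2)
      fix x
      have "0 \<le> (1 + (norm x)^2) * w x" by simp
      then show "norm ((1 + (norm x)^2) * w x) \<le> norm (C * exp (- (\<kappa> / 8) * (norm x)^2))" using b[of x] by simp
    qed
  qed
qed

text \<open>This covers constants, coordinates, and first derivatives of functions with bounded
  Hessian.\<close>

lemma L2w_linear_growth:
  assumes f: "continuous_on UNIV f" and le: "\<And>x. \<bar>f x\<bar> \<le> a + b * norm x" 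
  shows "L2w f"
  unfolding L2w_def
proof (intro conjI f)
  have q: "(f x)^2 \<le> 2 * (a^2 + b^2) * (1 + (norm x)^2)" for x
  proof -
    have "(f x)^2 \<le> (a + b * norm x)^2" using le[of x] power_mono[of "\<bar>f x\<bar>" "a + b * norm x" 2] by simp
    also have "\<dots> \<le> 2 * (a^2 + (b * norm x)^2)"
    proof -
      have "0 \<le> (a - b * norm x)^2" by simp
      then show ?thesis by (simp add: power2_sum power2_diff)
    qed
    also have "\<dots> \<le> 2 * (a^2 + b^2) * (1 + (norm x)^2)" by (simp add: power_mult_distrib algebra_simps)
    finally show ?thesis .
  qed
  have "integrable lborel (\<lambda>x. (2 * (a^2 + b^2)) * ((1 + (norm x)^2) * w x))"
    by (intro integrable_mult_right integrable_quadratic_w)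
  then have I: "integrable lborel (\<lambda>x. (2 * (a^2 + b^2) * (1 + (norm x)^2)) * w x)" by (simp only: mult.assoc)
  show "integrable lborel (\<lambda>x. (f x)^2 * w x)"
  proof (rule integrable_w_bound[OF _ I])
    show "continuous_on UNIV (\<lambda>x. (f x)^2)" by (intro continuous_intros f)
    show "\<bar>(f x)^2\<bar> \<le> 2 * (a^2 + b^2) * (1 + (norm x)^2)" for x using q[of x] by simp
  qed
qed

lemma L2w_const: "L2w (\<lambda>x. c)"
  by (rule L2w_linear_growth[of _ "\<bar>c\<bar>" 0]) auto

lemma L2w_component: "L2w (\<lambda>x. x $ i)"
  by (rule L2w_linear_growth[of _ 0 1])
    (auto simp: component_le_norm_cart intro!: continuous_intros)

lemma L2w_integrable: "L2w f \<Longrightarrow> integrable lborel (\<lambda>x. f x * w x)"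
  using L2w_mult_integrable[OF L2w_const[of 1]] by simp

lemma integrable_w: "integrable lborel w"
  using L2w_integrable[OF L2w_const[of 1]] by simp

lemma integral_w_pos: "(LBINT x. w x) > 0"
  by (rule integral_pos_continuous[OF continuous_w integrable_w]) auto

section \<open>Truncation, near-minimizers and density\<close>

lemma L_lincomb:
  assumes "Ck 2 u" "Ck 2 v"
  shows "L (\<lambda>x. u x + t * v x) x = L u x + t * L v x"
proof -
  have u1: "Ck (Suc (Suc 0)) u" and v1: "Ck (Suc (Suc 0)) v" using assms by (simp_all add: numeral_2_eq_2)
  note D = Ck_differentiable[OF u1] Ck_differentiable[OF v1]
    Ck_differentiable[OF Ck_partial[OF u1]] Ck_differentiable[OF Ck_partial[OF v1]]
  have tD: "(\<lambda>x. t * v x) differentiable (at x)" "(\<lambda>x. t * partial i v x) differentiable (at x)" for i x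
    using D by simp_all
  have c: "(\<lambda>x. t) differentiable (at x)" for x :: "real^'n" by simp
  have 1: "partial i (\<lambda>x. u x + t * v x) = (\<lambda>x. partial i u x + t * partial i v x)" for i
    by (rule ext) (simp add: partial_add[OF D(1) tD(1)] partial_mult[OF c D(2)])
  have 2: "partial i (\<lambda>x. partial i u x + t * partial i v x) x = partial i (partial i u) x + t * partial i (partial i v) x" for i
    by (simp add: partial_add[OF D(3) tD(2)] partial_mult[OF c D(4)])
  show ?thesis unfolding L_def 1 2 by (simp add: sum.distrib sum_distrib_left algebra_simps sum_subtractf)
qed

text \<open>Weyl's lemma is tested only with mean-zero functions, so the truncation of f is
  corrected by the constant c n that restores mean zero. Since f itself has mean zero, c n tends to
  0 and the correction is harmless in the limit.\<close>

lemma truncation_tendsto_0: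
  assumes f: "L2w f" and f0: "wint f = 0"
  defines "c \<equiv> \<lambda>n. (LBINT x. cutoff (real (Suc n)) x * (f x * w x)) / (LBINT x. cutoff (real (Suc n)) x * w x)"
  shows "(\<lambda>n. wint (\<lambda>x. (f x - cutoff (real (Suc n)) x * (f x - c n))^2)) \<longlonglongrightarrow> 0"
    and "(LBINT x. cutoff (real (Suc n)) x * (f x - c n) * w x) = 0"
proof -
  let ?X = "\<lambda>n. cutoff (real (Suc n)) :: real^'n \<Rightarrow> real"
  have fc: "continuous_on UNIV f" and cc: "continuous_on UNIV (cutoff R :: real^'n \<Rightarrow> real)" for R
    by (rule L2w_continuous[OF f], rule Ck_continuous[OF Ck_cutoff])
  have lim: "(\<lambda>n. LBINT x. ?X n x * g x) \<longlonglongrightarrow> (LBINT x. g x)"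
    if g: "continuous_on UNIV g" "integrable lborel g" for g :: "real^'n \<Rightarrow> real"
  proof (rule integral_dominated_convergence[where w = "\<lambda>x. \<bar>g x\<bar>"])
    show "AE x in lborel. (\<lambda>n. ?X n x * g x) \<longlonglongrightarrow> g x"
      using tendsto_mult_right[OF cutoff_tendsto_1] by (intro AE_I2) fastforce
    show "AE x in lborel. norm (?X n x * g x) \<le> \<bar>g x\<bar>" for n
      by (intro AE_I2) (simp only: real_norm_def abs_mult abs_of_nonneg[OF cutoff_nonneg] mult_left_le_one_le[OF abs_ge_zero cutoff_nonneg cutoff_le_1])
    show "(\<lambda>x. ?X n x * g x) \<in> borel_measurable lborel" for n
      by (intro continuous_on_UNIV_borel continuous_on_mult cc g)
    show "g \<in> borel_measurable lborel" by (intro continuous_on_UNIV_borel g)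
  qed (use g in simp)
  have "(\<lambda>n. LBINT x. ?X n x * (f x * w x)) \<longlonglongrightarrow> 0"
    using lim[OF continuous_on_mult[OF fc continuous_w] L2w_integrable[OF f]] f0 by (simp add: wint_def)
  from tendsto_divide[OF this lim[OF continuous_w integrable_w]] integral_w_pos
  have c0: "c \<longlonglongrightarrow> 0" by (simp add: c_def)
  then have "Bseq c" by (intro convergent_imp_Bseq convergentI)
  then obtain C where C: "\<And>n. \<bar>c n\<bar> \<le> C"
    by (rule BseqE) auto
  let ?F = "\<lambda>n x. f x - ?X n x * (f x - c n)"
  have "(\<lambda>n. LBINT x. (?F n x)^2 * w x) \<longlonglongrightarrow> (LINT x::real^'n|lborel. 0)"
  proof (rule integral_dominated_convergence[where w = "\<lambda>x. 2 * ((f x)^2 * w x) + 2 * C^2 * w x"])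
    show "AE x in lborel. (\<lambda>n. (?F n x)^2 * w x) \<longlonglongrightarrow> 0"
    proof (rule AE_I2)
      fix x
      have "(\<lambda>n. (?F n x)^2 * w x) \<longlonglongrightarrow> (f x - 1 * (f x - 0))^2 * w x"
        by (intro tendsto_intros c0 cutoff_tendsto_1)
      then show "(\<lambda>n. (?F n x)^2 * w x) \<longlonglongrightarrow> 0" by simp
    qed
    show "integrable lborel (\<lambda>x. 2 * ((f x)^2 * w x) + 2 * C^2 * w x)"
      using f integrable_w by (simp add: L2w_def)
    show "AE x in lborel. norm ((?F n x)^2 * w x) \<le> 2 * ((f x)^2 * w x) + 2 * C^2 * w x" for n
    proof (rule AE_I2)
      fix x :: "real^'n"
      define t where "t = ?X n x"
      have t: "0 \<le> t" "t \<le> 1" by (auto simp: t_def cutoff_le_1)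
      \<comment> \<open>As a convex combination of f x and c n, the truncation error is dominated
        independently of n.\<close>
      have "\<bar>?F n x\<bar> = \<bar>(1 - t) * f x + t * c n\<bar>" by (simp add: t_def algebra_simps)
      also have "\<dots> \<le> (1 - t) * \<bar>f x\<bar> + t * \<bar>c n\<bar>" 
        by (rule order_trans[OF abs_triangle_ineq]) (use t in \<open>simp add: abs_mult\<close>)
      also have "\<dots> \<le> 1 * \<bar>f x\<bar> + 1 * C" using t C[of n] by (intro add_mono mult_mono) auto
      finally have "\<bar>?F n x\<bar>^2 \<le> (\<bar>f x\<bar> + C)^2" by (intro power_mono) auto
      moreover have "0 \<le> (\<bar>f x\<bar> - C)^2" by simp
      ultimately have "(?F n x)^2 \<le> 2 * (f x)^2 + 2 * C^2" by (simp add: power2_sum power2_diff)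
      from mult_right_mono[OF this w_nonneg[of x]]
      show "norm ((?F n x)^2 * w x) \<le> 2 * ((f x)^2 * w x) + 2 * C^2 * w x" by (simp add: algebra_simps)
    qed
    show "(\<lambda>x. (?F n x)^2 * w x) \<in> borel_measurable lborel" for n
      by (intro continuous_on_UNIV_borel continuous_intros fc cc continuous_w)
  qed simp
  then show "(\<lambda>n. wint (\<lambda>x. (f x - ?X n x * (f x - c n))^2)) \<longlonglongrightarrow> 0"
    by (simp add: wint_def)
  have Cc: "Cc (?X n)" by (rule Cc_cutoff) simp
  have I: "integrable lborel (\<lambda>x. ?X n x * (f x * w x))" "integrable lborel (\<lambda>x. ?X n x * w x)"
    by (intro Cc_integrable Cc_mult_left Cc continuous_on_mult fc continuous_w)+
  have "(LBINT x. ?X n x * w x) > 0"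
  proof (rule integral_pos_continuous[of _ 0])
    show "continuous_on UNIV (\<lambda>x. ?X n x * w x)" by (intro continuous_on_mult cc continuous_w)
    show "0 < ?X n 0 * w 0" by (simp add: cutoff_def)
  qed (use I in simp_all)
  then have "c n * (LBINT x. ?X n x * w x) = (LBINT x. ?X n x * (f x * w x))"
    by (simp add: c_def)
  moreover have "(LBINT x. ?X n x * (f x - c n) * w x)
      = (LBINT x. ?X n x * (f x * w x) - c n * (?X n x * w x))"
    by (simp add: algebra_simps)
  ultimately show "(LBINT x. ?X n x * (f x - c n) * w x) = 0" using I by simp
qed

lemma L2w_L: "Ck 3 u \<Longrightarrow> Cc u \<Longrightarrow> L2w (L u)"
  using Cc_L[of 1 u] by (intro L2w_Cc) (simp add: numeral_3_eq_3)

text \<open>The first variation in quantitative form: along u + t v the squared distance is a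
  quadratic polynomial in t that cannot drop by more than \<tau>^2, and its discriminant bounds the
  linear coefficient.\<close>

lemma near_minimizer_almost_orthogonal:
  assumes f: "L2w f" and u: "Ck 3 u" "Cc u" and \<tau>: "\<tau> \<ge> 0"
    and min: "\<And>v. Ck 3 v \<Longrightarrow> Cc v \<Longrightarrow> wint (\<lambda>x. (f x - L u x)^2) - \<tau>^2 \<le> wint (\<lambda>x. (f x - L v x)^2)"
  shows "almost_orthogonal \<tau> (\<lambda>x. f x - L u x)"
proof -
  let ?h = "\<lambda>x. f x - L u x"
  have h: "L2w ?h" by (intro L2w_diff f L2w_L u)
  have "\<bar>wint (\<lambda>x. ?h x * L v x)\<bar> \<le> \<tau> * sqrt (sqnorm (L v))" if v: "Ck 3 v" "Cc v" for v
  proof -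
    have "(wint (\<lambda>x. ?h x * L v x))^2 \<le> \<tau>^2 * sqnorm (L v)"
    proof (rule quadratic_nonneg_imp_le[OF _ wint_square_nonneg])
      fix t
      have L: "L (\<lambda>x. u x + t * v x) x = L u x + t * L v x" for x
        by (rule L_lincomb) (use Ck_le[OF u(1), of 2] Ck_le[OF v(1), of 2] in auto)
      have "sqnorm ?h - \<tau>^2 \<le> wint (\<lambda>x. (f x - L (\<lambda>x. u x + t * v x) x)^2)"
        by (intro min Ck_add Ck_cmult Cc_add Cc_cmult u v)
      also have "\<dots> = wint (\<lambda>x. (?h x - t * L v x)^2)" by (simp add: L diff_diff_eq)
      also have "\<dots> = sqnorm ?h - 2 * t * wint (\<lambda>x. ?h x * L v x) + t^2 * sqnorm (L v)"
        by (rule wint_square_lincomb[OF h L2w_L[OF v]])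
      finally show "0 \<le> \<tau>^2 - 2 * t * wint (\<lambda>x. ?h x * L v x) + t^2 * sqnorm (L v)" by simp
    qed
    from real_sqrt_le_mono[OF this] show ?thesis using \<tau> by (simp add: real_sqrt_mult)
  qed
  then show ?thesis using h by (auto simp: almost_orthogonal_def L2w_def)
qed

text \<open>Let h = f - L u for a near-minimizer u, and split f = \<psi> / w + \<open>?F n\<close>.
  Then ||h||^2 = <h, f> - <h, L u> has three small parts: the one with \<psi> by
  \<open>almost_orthogonal_imp_almost_constant\<close>, as \<psi> has mean zero; the one with
  \<open>?F n\<close> because the truncation error is small; the last because h is almost orthogonal
  to the range of L.\<close>

lemma range_L_dense:
  assumes f: "L2w f" "wint f = 0" and \<sigma>: "\<sigma> > 0"
  obtains u where "Ck 3 u" "Cc u" "wint (\<lambda>x. (f x - L u x)^2) < \<sigma>"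
proof -
  \<comment> \<open>A bounds ||h||^2 for the near-minimizer before \<tau> is known: the competitor 0
    gives D \<le> \<open>sqnorm f\<close>, and \<tau> \<le> 1 adds at most 1.\<close>
  define A where "A = sqnorm f + 1"
  have A: "A \<ge> 1" using wint_square_nonneg by (simp add: A_def)
  define a where "a = sqrt A"
  have a: "a \<ge> 1" "a^2 = A" using A by (simp_all add: a_def)
  let ?X = "\<lambda>n. cutoff (real (Suc n)) :: real^'n \<Rightarrow> real"
  define c where "c n = (LBINT x. ?X n x * (f x * w x)) / (LBINT x. ?X n x * w x)" for n
  let ?F = "\<lambda>n x. f x - ?X n x * (f x - c n)"
  have "(\<lambda>n. wint (\<lambda>x. (?F n x)^2)) \<longlonglongrightarrow> 0"
    using truncation_tendsto_0(1)[OF f] by (simp add: c_def)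
  moreover have "(\<sigma> / 4 / a)^2 > 0" using \<sigma> a by simp
  ultimately have "eventually (\<lambda>n. wint (\<lambda>x. (?F n x)^2) < (\<sigma> / 4 / a)^2) sequentially"
    by (rule order_tendstoD(2))
  then obtain n where n: "wint (\<lambda>x. (?F n x)^2) < (\<sigma> / 4 / a)^2"
    unfolding eventually_sequentially by blast
  define \<psi> where "\<psi> x = ?X n x * (f x - c n) * w x" for x
  have fc: "continuous_on UNIV f" by (rule L2w_continuous[OF f(1)])
  have X: "Cc (?X n)" by (rule Cc_cutoff) simp
  have \<psi>: "Cc \<psi>" unfolding \<psi>_def by (intro Cc_mult_left X continuous_intros fc continuous_w)
  have \<psi>0: "(LBINT x. \<psi> x) = 0"
    using truncation_tendsto_0(2)[OF f, of n] by (simp add: \<psi>_def c_def)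
  have F: "L2w (?F n)"
    by (intro L2w_diff f L2w_Cc Cc_mult_left X continuous_intros fc)
  have A0: "A \<ge> 0" and s4: "\<sigma> / 4 > 0" using A \<sigma> by auto
  obtain \<tau>0 where \<tau>0: "\<tau>0 > 0" "\<And>h. almost_orthogonal \<tau>0 h \<Longrightarrow> sqnorm h \<le> A \<Longrightarrow>
    \<bar>LBINT x. h x * \<psi> x\<bar> \<le> \<sigma> / 4"
    by (rule almost_orthogonal_imp_almost_constant[OF \<psi> \<psi>0 A0 s4]) blast
  \<comment> \<open>The bound \<sigma> / 8 / a is matched to ||L u|| \<le> 2 a: the product is
    \<sigma> / 4.\<close>
  define \<tau> where "\<tau> = min (min \<tau>0 1) (\<sigma> / 8 / a)"
  have \<tau>: "\<tau> > 0" "\<tau> \<le> \<tau>0" "\<tau> \<le> 1" "\<tau> \<le> \<sigma> / 8 / a" using \<tau>0(1) \<sigma> a by (auto simp: \<tau>_def)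
  define D where "D = (INF v\<in>{v. Ck 3 v \<and> Cc v}. wint (\<lambda>x. (f x - L v x)^2))"
  have bdd: "bdd_below ((\<lambda>v. wint (\<lambda>x. (f x - L v x)^2)) ` {v. Ck 3 v \<and> Cc v})"
    by (rule bdd_belowI[of _ 0]) (auto simp: wint_square_nonneg)
  have D: "D \<le> wint (\<lambda>x. (f x - L v x)^2)" if "Ck 3 v" "Cc v" for v
    unfolding D_def by (rule cINF_lower[OF bdd]) (use that in simp)
  have Cz: "Ck 3 (\<lambda>x::real^'n. 0)" "Cc (\<lambda>x::real^'n. 0)" by (rule Ck_const, rule Cc_0)
  have "L (\<lambda>x. 0) x = 0" for x by (simp add: L_def)
  then have DA: "D \<le> A - 1" using D[OF Cz] by (simp add: A_def)
  have "\<exists>u. Ck 3 u \<and> Cc u \<and> wint (\<lambda>x. (f x - L u x)^2) < D + \<tau>^2"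
  proof (rule ccontr)
    assume "\<not> ?thesis"
    then have "D + \<tau>^2 \<le> wint (\<lambda>x. (f x - L v x)^2)" if "Ck 3 v" "Cc v" for v
      using that by (meson not_less)
    moreover have "{v::real^'n \<Rightarrow> real. Ck 3 v \<and> Cc v} \<noteq> {}" using Cz by blast
    ultimately have "D + \<tau>^2 \<le> (INF v\<in>{v. Ck 3 v \<and> Cc v}. wint (\<lambda>x. (f x - L v x)^2))"
      by (intro cINF_greatest) auto
    then have "D + \<tau>^2 \<le> D" unfolding D_def .
    then show False using \<tau>(1) by simp
  qed
  then obtain u where u: "Ck 3 u" "Cc u" "wint (\<lambda>x. (f x - L u x)^2) < D + \<tau>^2" by blast
  let ?h = "\<lambda>x. f x - L u x"
  have Lu: "L2w (L u)" by (rule L2w_L[OF u(1,2)])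
  have h: "L2w ?h" by (intro L2w_diff f Lu)
  have ao: "almost_orthogonal \<tau> ?h"
    by (rule near_minimizer_almost_orthogonal[OF f(1) u(1,2)]) (use \<tau>(1) u(3) D in \<open>auto intro: order_trans[of _ D]\<close>)
  have ao0: "almost_orthogonal \<tau>0 ?h"
    unfolding almost_orthogonal_def
  proof (intro conjI allI impI)
    fix v :: "real^'n \<Rightarrow> real" assume v: "Ck 3 v" "Cc v"
    have "\<bar>wint (\<lambda>x. ?h x * L v x)\<bar> \<le> \<tau> * sqrt (sqnorm (L v))"
      using ao v unfolding almost_orthogonal_def by blast
    also have "\<dots> \<le> \<tau>0 * sqrt (sqnorm (L v))" using \<tau>(2) by (intro mult_right_mono) (auto simp: wint_square_nonneg)
    finally show "\<bar>wint (\<lambda>x. ?h x * L v x)\<bar> \<le> \<tau>0 * sqrt (sqnorm (L v))" .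
  qed (use h in \<open>auto simp: L2w_def\<close>)
  have "\<tau>^2 \<le> 1" using \<tau> by (intro power_le_one) auto
  then have hA: "sqnorm ?h \<le> A" using u(3) DA by simp
  have sh: "sqrt (sqnorm ?h) \<le> a" unfolding a_def by (rule real_sqrt_le_mono[OF hA])
  have b1: "\<bar>LBINT x. ?h x * \<psi> x\<bar> \<le> \<sigma> / 4" by (rule \<tau>0(2)[OF ao0 hA])
  have b2: "\<bar>wint (\<lambda>x. ?h x * ?F n x)\<bar> \<le> \<sigma> / 4"
  proof -
    have "sqrt (wint (\<lambda>x. (?F n x)^2)) \<le> sqrt ((\<sigma> / 4 / a)^2)" using n by (intro real_sqrt_le_mono) simp
    also have "\<dots> = \<sigma> / 4 / a" using \<sigma> a by simp
    finally have "sqrt (sqnorm ?h) * sqrt (wint (\<lambda>x. (?F n x)^2)) \<le> a * (\<sigma> / 4 / a)"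
      using sh a(1) by (intro mult_mono) (auto simp: wint_square_nonneg)
    also have "\<dots> = \<sigma> / 4" using a by simp
    finally show ?thesis using abs_wint_mult_le[OF h F] by linarith
  qed
  have b3: "\<bar>wint (\<lambda>x. ?h x * L u x)\<bar> \<le> \<sigma> / 4"
  proof -
    have "\<bar>wint (\<lambda>x. f x * ?h x)\<bar> \<le> sqrt (sqnorm f) * sqrt (sqnorm ?h)"
      by (rule abs_wint_mult_le[OF f(1) h])
    also have "\<dots> \<le> a * a"
      using sh by (intro mult_mono) (auto simp: a_def A_def wint_square_nonneg)
    finally have fh: "\<bar>wint (\<lambda>x. f x * ?h x)\<bar> \<le> A" using a by (simp add: power2_eq_square)
    have "sqnorm (L u) = wint (\<lambda>x. (f x - ?h x)^2)" by simp
    also have "\<dots> \<le> 4 * A"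
    proof -
      have "X - 2 * Y + Z \<le> 4 * A" if "X \<le> A" "\<bar>Y\<bar> \<le> A" "Z \<le> A" for X Y Z :: real
        using that by linarith
      from this[OF _ fh hA] show ?thesis unfolding wint_square_diff[OF f(1) h] by (simp add: A_def)
    qed
    also have "\<dots> = (2 * a)^2" using a by simp
    finally have "sqrt (sqnorm (L u)) \<le> 2 * a" using a by (intro real_le_lsqrt) (auto simp: wint_square_nonneg)
    then have "\<tau> * sqrt (sqnorm (L u)) \<le> \<sigma> / 8 / a * (2 * a)"
      using \<tau> \<sigma> a by (intro mult_mono) (auto simp: wint_square_nonneg)
    also have "\<dots> = \<sigma> / 4" using a by simp
    finally show ?thesis using ao u(1,2) unfolding almost_orthogonal_def by (meson order_trans)
  qed
  have hc: "continuous_on UNIV ?h" by (rule L2w_continuous[OF h])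
  have "sqnorm ?h = (LBINT x. ?h x * \<psi> x) + wint (\<lambda>x. ?h x * ?F n x) - wint (\<lambda>x. ?h x * L u x)"
  proof -
    have e: "(\<lambda>x. (?h x)^2 * w x) = (\<lambda>x. ?h x * \<psi> x + ?h x * ?F n x * w x - ?h x * L u x * w x)"
      by (simp add: \<psi>_def power2_eq_square algebra_simps fun_eq_iff)
    show ?thesis unfolding wint_def e
      using Cc_integrable[OF Cc_mult_right[OF hc \<psi>]] L2w_mult_integrable[OF h F] L2w_mult_integrable[OF h Lu]
      by simp
  qed
  then have "sqnorm ?h < \<sigma>" using b1 b2 b3 \<sigma> by linarith
  then show thesis using that u by blast
qed

section \<open>The spectral gap\<close>

lemma wint_L_square_le:
  assumes g: "Ck 1 g" "L2w g" "\<And>i. L2w (partial i g)" and u: "Ck 3 u" "Cc u"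
  shows "(wint (\<lambda>x. g x * L u x))^2
    \<le> energy g * energy u"
proof (rule quadratic_nonneg_imp_le)
  have u2: "Ck 2 u" by (rule Ck_le[OF u(1)]) simp
  have pu: "L2w (partial i u)" for i
    by (rule L2w_Cc[OF Cc_partial[of 2, OF _ u(2)]]) (use u(1) in \<open>simp add: numeral_3_eq_3 numeral_2_eq_2\<close>)
  fix t
  \<comment> \<open>The parameter enters as - t because <g, L u> is minus the inner product of the
    gradients.\<close>
  have "0 \<le> (\<Sum>i\<in>UNIV. wint (\<lambda>x. (partial i g x - (- t) * partial i u x)^2))"
    by (intro sum_nonneg wint_square_nonneg)
  also have "\<dots> = energy g - 2 * t * wint (\<lambda>x. g x * L u x)
    + t^2 * energy u"
    unfolding wint_square_lincomb[OF g(3) pu] wint_L[OF g(1) u2 u(2)]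
    by (simp add: sum.distrib sum_subtractf sum_distrib_left)
  finally show "0 \<le> energy g - 2 * t * wint (\<lambda>x. g x * L u x)
    + t^2 * energy u" .
qed (intro sum_nonneg wint_square_nonneg)

text \<open>Duality: \<open>\<langle>g, L u\<rangle> = - \<langle>\<nabla>g, \<nabla>u\<rangle>\<close> tends to \<open>\<parallel>g\<parallel>\<^sup>2\<close> when \<open>L u\<close> tends to \<open>g\<close>.\<close>

lemma dirichlet_lower_bound:
  assumes g: "Ck 1 g" "L2w g" "\<And>i. L2w (partial i g)" "wint g = 0" and K: "K \<ge> 0"
    and bound: "\<And>u. (\<And>n. Ck 3 (u n) \<and> Cc (u n)) \<Longrightarrow> (\<lambda>n. wint (\<lambda>x. (g x - L (u n) x)^2)) \<longlonglongrightarrow> 0 \<Longrightarrow>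
      \<exists>e. e \<longlonglongrightarrow> 0 \<and> (\<forall>n. K * energy (u n) \<le> sqnorm (L (u n)) + e n)"
  shows "K * sqnorm g \<le> energy g"
proof -
  let ?a = "sqnorm g" and ?D = "energy g"
  have D: "?D \<ge> 0" by (intro sum_nonneg wint_square_nonneg)
  have "\<exists>u. Ck 3 u \<and> Cc u \<and> wint (\<lambda>x. (g x - L u x)^2) < inverse (real (Suc n))" for n
    by (rule range_L_dense[OF g(2,4), of "inverse (real (Suc n))"]) auto
  then obtain u where u: "\<And>n. Ck 3 (u n)" "\<And>n. Cc (u n)"
    "\<And>n. wint (\<lambda>x. (g x - L (u n) x)^2) < inverse (real (Suc n))"
    by metis
  let ?h = "\<lambda>n x. g x - L (u n) x"
  let ?X = "\<lambda>n. wint (\<lambda>x. (?h n x)^2)"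
  have X: "?X \<longlonglongrightarrow> 0"
    by (rule tendsto_sandwich[OF _ _ tendsto_const LIMSEQ_inverse_real_of_nat])
      (use u(3) in \<open>auto intro!: always_eventually wint_square_nonneg less_imp_le\<close>)
  then obtain e where e: "e \<longlonglongrightarrow> 0"
    "\<And>n. K * energy (u n) \<le> sqnorm (L (u n)) + e n"
    using bound[of u] u by blast
  have h: "L2w (?h n)" for n by (intro L2w_diff g L2w_L u)
  let ?Y = "\<lambda>n. wint (\<lambda>x. g x * ?h n x)"
  have Y: "?Y \<longlonglongrightarrow> 0"
  proof (rule Lim_null_comparison)
    show "\<forall>\<^sub>F n in sequentially. norm (?Y n) \<le> sqrt ?a * sqrt (?X n)"
      using abs_wint_mult_le[OF g(2) h] by (intro always_eventually) simp
    show "(\<lambda>n. sqrt ?a * sqrt (?X n)) \<longlonglongrightarrow> 0"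
      using tendsto_mult[OF tendsto_const tendsto_real_sqrt[OF X], of "sqrt ?a"] by simp
  qed
  have gL: "wint (\<lambda>x. g x * L (u n) x) = ?a - ?Y n" for n
  proof -
    have e1: "(\<lambda>x. g x * L (u n) x * w x) = (\<lambda>x. (g x)^2 * w x - g x * ?h n x * w x)"
      by (simp add: power2_eq_square algebra_simps)
    have "integrable lborel (\<lambda>x. (g x)^2 * w x)" "integrable lborel (\<lambda>x. g x * ?h n x * w x)"
      using g(2) L2w_mult_integrable[OF g(2) h] by (auto simp: L2w_def)
    then show ?thesis unfolding wint_def e1 by (rule Bochner_Integration.integral_diff)
  qed
  have LL: "sqnorm (L (u n)) = ?a - 2 * ?Y n + ?X n" for n
    using wint_square_diff[OF g(2) h, of n] by simp
  \<comment> \<open>Cauchy-Schwarz for gradients followed by the assumed energy bound. The limit is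
    K a^2 \<le> D a, from which a factor a is cancelled unless a = 0.\<close>
  have ineq: "K * (?a - ?Y n)^2 \<le> ?D * (?a - 2 * ?Y n + ?X n + e n)" for n
  proof -
    have "K * (?a - ?Y n)^2 \<le> K * (?D * energy (u n))"
      unfolding gL[symmetric] by (intro mult_left_mono K wint_L_square_le g u)
    also have "\<dots> = ?D * (K * energy (u n))" by (rule mult.left_commute)
    also have "\<dots> \<le> ?D * (sqnorm (L (u n)) + e n)" by (intro mult_left_mono e D)
    finally show ?thesis unfolding LL .
  qed
  have "(\<lambda>n. K * (?a - ?Y n)^2) \<longlonglongrightarrow> K * (?a - 0)^2" by (intro tendsto_intros Y)
  moreover have "(\<lambda>n. ?D * (?a - 2 * ?Y n + ?X n + e n)) \<longlonglongrightarrow> ?D * (?a - 2 * 0 + 0 + 0)"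
    by (intro tendsto_intros Y X e)
  ultimately have "K * (?a - 0)^2 \<le> ?D * (?a - 2 * 0 + 0 + 0)"
    by (rule LIMSEQ_le) (use ineq in blast)
  then have "(K * ?a) * ?a \<le> ?D * ?a" by (simp add: power2_eq_square)
  then show ?thesis using wint_square_nonneg[of g] D by (cases "?a = 0") auto
qed

text \<open>In \<open>bochner\<close> the Hessian term is nonnegative; dropping it gives the
  hypothesis of \<open>dirichlet_lower_bound\<close> with zero error.\<close>

lemma poincare:
  assumes g: "Ck 1 g" "L2w g" "\<And>i. L2w (partial i g)" "wint g = 0"
  shows "\<kappa> * sqnorm g \<le> energy g"
proof (rule dirichlet_lower_bound[OF g])
  fix u :: "nat \<Rightarrow> real^'n \<Rightarrow> real" assume u: "\<And>n. Ck 3 (u n) \<and> Cc (u n)"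
  have "\<kappa> * energy (u n) \<le> sqnorm (L (u n))" for n
  proof -
    have "(\<Sum>i\<in>UNIV. \<Sum>j\<in>UNIV. wint (\<lambda>x. (partial j (partial i (u n)) x)^2)) \<ge> 0"
      by (intro sum_nonneg wint_square_nonneg)
    then show ?thesis using bochner[of "u n"] u[of n] by (auto simp del: Ck.simps)
  qed
  then show "\<exists>e. e \<longlonglongrightarrow> 0 \<and> (\<forall>n. \<kappa> * energy (u n) \<le> sqnorm (L (u n)) + e n)"
    by (intro exI[of _ "\<lambda>_. 0"]) simp
qed (use \<kappa>_pos in simp)

lemma poincare_variance:
  assumes g: "Ck 2 g" "Cc g"
  shows "\<kappa> * (sqnorm g - (wint g)^2 / (LBINT x. w x)) \<le> energy g"
proof -
  define Z where "Z = (LBINT x. w x)"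
  have Z: "Z > 0" unfolding Z_def by (rule integral_w_pos)
  define c where "c = wint g / Z"
  have g1: "Ck 1 g" by (rule Ck_le[OF g(1)]) simp
  have gL: "L2w g" by (rule L2w_Cc[OF g(2)])
  have "g differentiable (at x)" for x using g1 Ck_differentiable[of 0 g] by simp
  then have pg: "partial i (\<lambda>x. g x - c) = partial i g" for i
    by (intro ext) (simp add: partial_diff)
  have pL: "L2w (partial i g)" for i using Cc_partial[of 0 g i] g1 g(2) by (intro L2w_Cc) simp
  have wc: "wint (\<lambda>x. g x * c) = c * wint g" "wint (\<lambda>x. c^2) = c^2 * Z"
    by (simp_all add: wint_def Z_def mult_ac)
  have "wint (\<lambda>x. g x - c) = wint g - c * Z"
    using L2w_integrable[OF gL] integrable_w by (simp add: wint_def left_diff_distrib Z_def)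
  also have "\<dots> = 0" using Z by (simp add: c_def)
  finally have "\<kappa> * wint (\<lambda>x. (g x - c)^2) \<le> energy g"
    using poincare[of "\<lambda>x. g x - c", unfolded pg] pL Ck_diff[OF g1 Ck_const] L2w_diff[OF gL L2w_const] by blast
  moreover have "wint (\<lambda>x. (g x - c)^2) = sqnorm g - (wint g)^2 / Z"
    unfolding wint_square_diff[OF gL L2w_const] wc using Z by (simp add: c_def power2_eq_square field_simps)
  ultimately show ?thesis by (simp add: Z_def)
qed

text \<open>Orthogonality to the coordinates makes the mean of \<open>\<nabla>u\<close> tend to zero when \<open>L u\<close> tends to \<open>g\<close>, so that
  the Hessian term of Bochner's formula can be bounded from below by the Poincare inequality.\<close>

lemma spectral_gap:
  assumes g: "Ck 1 g" "L2w g" "\<And>i. L2w (partial i g)" "wint g = 0" and gx: "\<And>i. wint (\<lambda>x. g x * x $ i) = 0"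
  shows "2 * \<kappa> * sqnorm g \<le> energy g"
proof (rule dirichlet_lower_bound[OF g])
  fix u :: "nat \<Rightarrow> real^'n \<Rightarrow> real" assume u: "\<And>n. Ck 3 (u n) \<and> Cc (u n)"
    and lim: "(\<lambda>n. wint (\<lambda>x. (g x - L (u n) x)^2)) \<longlonglongrightarrow> 0"
  have u3: "Ck 3 (u n)" and uc: "Cc (u n)" for n using u by auto
  have u2: "Ck 2 (u n)" for n by (rule Ck_le[OF u3]) simp
  have pu: "Ck 2 (partial i (u n))" "Cc (partial i (u n))" for i n
    using Ck_partial[of 2 "u n" i] Cc_partial[of 2 "u n" i] u3[of n] uc[of n] by (simp_all add: numeral_3_eq_3 numeral_2_eq_2)
  define Z where "Z = (LBINT x. w x)"
  have Z: "Z > 0" unfolding Z_def by (rule integral_w_pos)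
  \<comment> \<open>This is \<kappa> times the defect in \<open>poincare_variance\<close>, summed
    over the partial derivatives of u, which need not have mean zero before the limit.\<close>
  define e where "e n = \<kappa> / Z * (\<Sum>i\<in>UNIV. (wint (partial i (u n)))^2)" for n
  have "(\<lambda>n. (wint (partial i (u n)))^2) \<longlonglongrightarrow> 0" for i
  proof (rule Lim_null_comparison)
    have "(wint (partial i (u n)))^2 \<le> wint (\<lambda>x. (x $ i)^2) * wint (\<lambda>x. (g x - L (u n) x)^2)" for n
    proof -
      \<comment> \<open>A coordinate has constant gradient, so <x_i, L u> is minus the weighted
        integral of the i-th partial derivative. As g is orthogonal to x_i, that integral equals
        <x_i, g - L u>, which Cauchy-Schwarz controls.\<close>
      have "wint (\<lambda>x. x $ i * L (u n) x) = - (\<Sum>j\<in>UNIV. if j = i then wint (partial i (u n)) else 0)"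
        unfolding wint_L[OF Ck_component u2 uc] partial_component
        by (rule arg_cong[where f = uminus], rule sum.cong) (auto simp: axis_def wint_def)
      then have 1: "wint (\<lambda>x. x $ i * L (u n) x) = - wint (partial i (u n))" by simp
      have e1: "(\<lambda>x. x $ i * (g x - L (u n) x) * w x) = (\<lambda>x. g x * x $ i * w x - x $ i * L (u n) x * w x)"
        by (simp add: algebra_simps)
      have "wint (\<lambda>x. x $ i * (g x - L (u n) x)) = wint (partial i (u n))"
        using gx[of i] 1 L2w_mult_integrable[OF g(2) L2w_component[of i]]
          L2w_mult_integrable[OF L2w_component[of i] L2w_L[OF u3 uc, of n]]
        unfolding wint_def e1 by simp
      then show ?thesis
        using wint_Cauchy_Schwarz[OF L2w_component[of i] L2w_diff[OF g(2) L2w_L[OF u3 uc, of n]]] by simp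
    qed
    then show "\<forall>\<^sub>F n in sequentially. norm ((wint (partial i (u n)))^2) \<le> wint (\<lambda>x. (x $ i)^2) * wint (\<lambda>x. (g x - L (u n) x)^2)"
      by (intro always_eventually) simp
    show "(\<lambda>n. wint (\<lambda>x. (x $ i)^2) * wint (\<lambda>x. (g x - L (u n) x)^2)) \<longlonglongrightarrow> 0"
      using tendsto_mult[OF tendsto_const lim] by simp
  qed
  then have "(\<lambda>n. \<kappa> / Z * (\<Sum>i\<in>UNIV. (wint (partial i (u n)))^2)) \<longlonglongrightarrow> \<kappa> / Z * (\<Sum>i\<in>(UNIV::'n set). 0)"
    by (intro tendsto_intros)
  then have "e \<longlonglongrightarrow> 0" by (simp add: e_def[abs_def])
  moreover have "2 * \<kappa> * energy (u n) \<le> sqnorm (L (u n)) + e n" for n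
  proof -
    have "(\<Sum>i\<in>UNIV. \<kappa> * (wint (\<lambda>x. (partial i (u n) x)^2) - (wint (partial i (u n)))^2 / Z))
        \<le> (\<Sum>i\<in>UNIV. \<Sum>j\<in>UNIV. wint (\<lambda>x. (partial j (partial i (u n)) x)^2))"
      unfolding Z_def by (intro sum_mono poincare_variance pu)
    moreover have "(\<Sum>i\<in>UNIV. \<kappa> * (wint (\<lambda>x. (partial i (u n) x)^2) - (wint (partial i (u n)))^2 / Z))
        = \<kappa> * energy (u n) - e n"
      by (simp add: e_def right_diff_distrib sum_subtractf sum_distrib_left)
    ultimately show ?thesis using bochner[OF u3 uc, of n] by simp
  qed
  ultimately show "\<exists>e. e \<longlonglongrightarrow> 0 \<and> (\<forall>n. 2 * \<kappa> * energy (u n) \<le> sqnorm (L (u n)) + e n)"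
    by blast
qed (use \<kappa>_pos in simp)

text \<open>Bounded second derivatives give linear growth of the first ones by the mean value
  theorem, and linear growth is square integrable against the decaying weight.\<close>

lemma L2w_partial_of_bounded_hessian:
  assumes f: "Ck 2 f" and b: "bounded (range (hessian f))"
  shows "L2w (partial j f)"
proof -
  obtain B where B: "B > 0" "\<And>x. norm (hessian f x) \<le> B" using b by (auto simp: bounded_pos)
  have pB: "\<bar>partial i (partial j f) x\<bar> \<le> B" for i x
  proof -
    have "\<bar>hessian f x $ i $ j\<bar> \<le> norm (hessian f x $ i)" by (rule component_le_norm_cart)
    also have "\<dots> \<le> norm (hessian f x)" by (rule Finite_Cartesian_Product.norm_nth_le)
    finally show ?thesis using B(2)[of x] by (simp add: hessian_def)
  qed
  have p1: "Ck 1 (partial j f)" using Ck_partial[of 1 f j] f by (simp add: numeral_2_eq_2 del: Ck.simps)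
  show ?thesis
  proof (rule L2w_linear_growth[OF Ck_continuous[OF p1]])
    fix x :: "real^'n"
    obtain s where s: "partial j f (0 + x) - partial j f 0 = gradient (partial j f) (0 + s *\<^sub>R x) \<bullet> x"
      by (rule mean_value_along[OF p1, of 0 x])
    have "norm (gradient (partial j f) (0 + s *\<^sub>R x)) \<le> (\<Sum>i\<in>UNIV. \<bar>gradient (partial j f) (0 + s *\<^sub>R x) $ i\<bar>)"
      by (rule norm_le_l1_cart)
    also have "\<dots> \<le> (\<Sum>i\<in>(UNIV::'n set). B)" by (intro sum_mono) (simp add: gradient_def pB)
    finally have "norm (gradient (partial j f) (0 + s *\<^sub>R x)) * norm x \<le> real CARD('n) * B * norm x"
      by (intro mult_right_mono) simp_all
    then have "\<bar>partial j f x - partial j f 0\<bar> \<le> real CARD('n) * B * norm x"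
      using s Cauchy_Schwarz_ineq2[of "gradient (partial j f) (0 + s *\<^sub>R x)" x] by simp
    then show "\<bar>partial j f x\<bar> \<le> \<bar>partial j f 0\<bar> + real CARD('n) * B * norm x" by linarith
  qed
qed

text \<open>Integration by parts for f without compact support: cutoffs are inserted, and the term
  with their gradient vanishes because that gradient is O(1/R). For the Gaussian potential it
  converts a mean-zero gradient into orthogonality to the coordinates.\<close>

lemma wint_partial:
  assumes f: "Ck 1 f" "L2w f" "L2w (partial i f)" and fV: "integrable lborel (\<lambda>x. f x * partial i V x * w x)"
  shows "wint (partial i f) = wint (\<lambda>x. f x * partial i V x)"
proof -
  let ?X = "\<lambda>n. cutoff (real (Suc n)) :: real^'n \<Rightarrow> real"
  have X1: "Ck 1 (?X n)" "Cc (?X n)" for n by (rule Ck_cutoff, rule Cc_cutoff) simp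
  have fc: "continuous_on UNIV f" and pc: "continuous_on UNIV (partial i f)"
    by (rule L2w_continuous, fact)+
  have D: "?X n differentiable (at x)" "f differentiable (at x)" for n x
    using X1[of n] f(1) Ck_differentiable[of 0] by auto
  \<comment> \<open>The bound 4 covers both uses: cutoffs, with limit c = 1, and their partial
    derivatives, with limit c = 0.\<close>
  have lim: "(\<lambda>n. LBINT x. a n x * (h x * w x)) \<longlonglongrightarrow> c * wint h"
    if a: "\<And>n. continuous_on UNIV (a n)" "\<And>n x. \<bar>a n x\<bar> \<le> 4" "\<And>x. (\<lambda>n. a n x) \<longlonglongrightarrow> c"
      and h: "continuous_on UNIV h" "integrable lborel (\<lambda>x. h x * w x)" for a h c
  proof -
    have "(\<lambda>n. LBINT x. a n x * (h x * w x)) \<longlonglongrightarrow> (LBINT x. c * (h x * w x))"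
    proof (rule integral_dominated_convergence[where w = "\<lambda>x. 4 * \<bar>h x * w x\<bar>"])
      show "AE x in lborel. norm (a n x * (h x * w x)) \<le> 4 * \<bar>h x * w x\<bar>" for n
        by (intro AE_I2) (simp only: real_norm_def abs_mult[of "a n _"] mult_right_mono[OF a(2) abs_ge_zero])
      show "AE x in lborel. (\<lambda>n. a n x * (h x * w x)) \<longlonglongrightarrow> c * (h x * w x)"
        by (intro AE_I2 tendsto_intros a)
      show "(\<lambda>x. a n x * (h x * w x)) \<in> borel_measurable lborel" for n
        by (intro continuous_on_UNIV_borel continuous_on_mult a h continuous_w)
      show "(\<lambda>x. c * (h x * w x)) \<in> borel_measurable lborel"
        by (intro continuous_on_UNIV_borel continuous_intros h continuous_w)
    qed (use h in simp)
    then show ?thesis by (simp add: wint_def)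
  qed
  have pX: "\<bar>partial i (?X n) x\<bar> \<le> 4 * inverse (real (Suc n))" for n x
    using abs_partial_cutoff_le[of "real (Suc n)" i x] by (simp add: divide_inverse)
  have eq: "(LBINT x. ?X n x * (partial i f x * w x))
      = (LBINT x. ?X n x * (f x * partial i V x * w x)) - (LBINT x. partial i (?X n) x * (f x * w x))" for n
  proof -
    have g: "Ck 1 (\<lambda>x. ?X n x * w x)" "Cc (\<lambda>x. ?X n x * w x)"
      by (intro Ck_mult X1 Ck_w Cc_mult_left continuous_w)+
    have pXc: "Cc (partial i (?X n))" using Cc_partial[of 0 "?X n" i] X1[of n] by simp
    have I: "integrable lborel (\<lambda>x. ?X n x * (f x * partial i V x * w x))" "integrable lborel (\<lambda>x. partial i (?X n) x * (f x * w x))"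
      by (intro Cc_integrable Cc_mult_left X1 pXc continuous_on_mult fc continuous_w continuous_partial_V)+
    have "(LBINT x. ?X n x * (partial i f x * w x)) = - (LBINT x. f x * partial i (\<lambda>x. ?X n x * w x) x)"
      using integral_by_parts[OF f(1) g, of i] by (simp add: mult_ac)
    also have "(LBINT x. f x * partial i (\<lambda>x. ?X n x * w x) x)
        = (LBINT x. partial i (?X n) x * (f x * w x) - ?X n x * (f x * partial i V x * w x))"
      unfolding partial_mult[OF D(1) differentiable_w] partial_w by (simp add: algebra_simps)
    also have "\<dots> = (LBINT x. partial i (?X n) x * (f x * w x)) - (LBINT x. ?X n x * (f x * partial i V x * w x))"
      by (rule Bochner_Integration.integral_diff[OF I(2,1)])
    finally show ?thesis by simp
  qed
  have "(\<lambda>n. LBINT x. ?X n x * (partial i f x * w x)) \<longlonglongrightarrow> 1 * wint (partial i f)"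
  proof (rule lim)
    show "\<bar>?X n x\<bar> \<le> 4" for n x using cutoff_le_1[of "real (Suc n)" x] by simp
  qed (intro Ck_continuous[OF X1(1)] cutoff_tendsto_1 pc L2w_integrable f)+
  moreover have "(\<lambda>n. (LBINT x. ?X n x * (f x * partial i V x * w x)) - (LBINT x. partial i (?X n) x * (f x * w x)))
      \<longlonglongrightarrow> 1 * wint (\<lambda>x. f x * partial i V x) - 0 * wint f"
  proof (intro tendsto_diff lim)
    show "\<bar>?X n x\<bar> \<le> 4" for n x using cutoff_le_1[of "real (Suc n)" x] by simp
    show "continuous_on UNIV (partial i (?X n))" for n using X1(1)[of n] by simp
    show "\<bar>partial i (?X n) x\<bar> \<le> 4" for n x
    proof -
      have "inverse (real (Suc n)) \<le> 1" by (simp add: inverse_le_1_iff)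
      then show ?thesis using pX[of n x] by linarith
    qed
    show "(\<lambda>n. partial i (?X n) x) \<longlonglongrightarrow> 0" for x
    proof (rule Lim_null_comparison)
      show "\<forall>\<^sub>F n in sequentially. norm (partial i (?X n) x) \<le> 4 * inverse (real (Suc n))"
        by (intro always_eventually) (simp only: real_norm_def pX simp_thms)
      show "(\<lambda>n. 4 * inverse (real (Suc n))) \<longlonglongrightarrow> 0"
        using tendsto_mult[OF tendsto_const LIMSEQ_inverse_real_of_nat, of 4] by simp
    qed
  qed (intro Ck_continuous[OF X1(1)] cutoff_tendsto_1 continuous_on_mult fc continuous_partial_V L2w_integrable f fV)+
  ultimately show ?thesis unfolding eq by (auto dest: LIMSEQ_unique)
qed

section \<open>From the weight w to the measure \<open>gibbs V\<close>\<close>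

lemma gibbs_eq: "gibbs V = density lborel (\<lambda>x. ennreal (w x))"
  by (simp add: gibbs_def w_def)

lemma integral_gibbs:
  fixes f :: "real^'n \<Rightarrow> 'b::{banach, second_countable_topology}"
  assumes "continuous_on UNIV f"
  shows "(LINT x|gibbs V. f x) = (LBINT x. w x *\<^sub>R f x)"
  unfolding gibbs_eq
  by (rule integral_density) (auto intro!: borel_measurable_continuous_onI assms continuous_w)

lemma integral_gibbs_wint: "continuous_on UNIV f \<Longrightarrow> (LINT x|gibbs V. f x) = wint f"
  by (simp add: integral_gibbs wint_def mult.commute)

text \<open>A Bochner integral is 0 by convention when the integrand is not integrable. A vanishing
  vector integral says something about its components only once integrability of the whole vector is
  known, which is obtained here from that of the components.\<close>

lemma integral_gibbs_component:
  fixes v :: "real^'n \<Rightarrow> real^'n"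
  assumes v: "continuous_on UNIV v" and I: "\<And>i. integrable lborel (\<lambda>x. v x $ i * w x)"
  shows "(LINT x|gibbs V. v x) $ i = wint (\<lambda>x. v x $ i)"
proof -
  have "integrable lborel (\<lambda>x. w x *\<^sub>R v x)"
  proof (rule Bochner_Integration.integrable_bound)
    show "integrable lborel (\<lambda>x. \<Sum>i\<in>UNIV. \<bar>v x $ i * w x\<bar>)"
      by (intro Bochner_Integration.integrable_sum integrable_abs I)
    show "(\<lambda>x. w x *\<^sub>R v x) \<in> borel_measurable lborel"
      by (intro continuous_on_UNIV_borel continuous_intros v continuous_w)
    show "AE x in lborel. norm (w x *\<^sub>R v x) \<le> norm (\<Sum>i\<in>UNIV. \<bar>v x $ i * w x\<bar>)"
    proof (rule AE_I2)
      fix x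
      have "norm (w x *\<^sub>R v x) \<le> (\<Sum>i\<in>UNIV. \<bar>v x $ i * w x\<bar>)"
        using norm_le_l1_cart[of "w x *\<^sub>R v x"] by (simp add: mult.commute)
      then show "norm (w x *\<^sub>R v x) \<le> norm (\<Sum>i\<in>UNIV. \<bar>v x $ i * w x\<bar>)" by simp
    qed
  qed
  from integral_bounded_linear[OF bounded_linear_vec_nth[of i] this] show ?thesis
    by (simp add: integral_gibbs[OF v] wint_def mult.commute)
qed

lemma L2w_of_H1:
  assumes f: "f \<in> H1 (gibbs V)" and c: "continuous_on UNIV f"
  shows "L2w f"
proof -
  have "integrable (gibbs V) (\<lambda>x. (f x)^2)" using f by (simp add: H1_def L2_def)
  moreover have "(\<lambda>x. (f x)^2) \<in> borel_measurable lborel" 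
    by (intro continuous_on_UNIV_borel continuous_intros c)
  ultimately have "integrable lborel (\<lambda>x. w x *\<^sub>R (f x)^2)"
    unfolding gibbs_eq
    by (subst (asm) integrable_density) (auto intro!: borel_measurable_continuous_onI continuous_w)
  then show ?thesis using c by (simp add: L2w_def mult.commute)
qed

lemma integral_gradient_square:
  assumes f: "Ck 2 f" "bounded (range (hessian f))"
  shows "(LINT x|gibbs V. (norm (gradient f x))^2) = energy f"
proof -
  have L: "L2w (partial i f)" for i by (rule L2w_partial_of_bounded_hessian[OF f])
  have e: "(norm (gradient f x))^2 = (\<Sum>i\<in>UNIV. (partial i f x)^2)" for x
    unfolding norm_vec_square by (simp add: gradient_def power2_eq_square)
  have "(LINT x|gibbs V. (norm (gradient f x))^2) = wint (\<lambda>x. \<Sum>i\<in>UNIV. (partial i f x)^2)"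
    unfolding e by (rule integral_gibbs_wint) (intro continuous_intros L2w_continuous[OF L])
  also have "\<dots> = energy f"
    unfolding wint_def sum_distrib_right
    by (rule Bochner_Integration.integral_sum) (use L in \<open>simp add: L2w_def\<close>)
  finally show ?thesis .
qed

lemma spectral_gap_gibbs:
  assumes H1: "f \<in> H1 (gibbs V)" and f: "smooth f" "bounded (range (hessian f))"
    and f0: "(LINT x|gibbs V. f x) = 0" and fx: "\<And>i. wint (\<lambda>x. f x * x $ i) = 0"
  shows "2 * \<kappa> * (LINT x|gibbs V. (f x)^2) \<le> (LINT x|gibbs V. (norm (gradient f x))^2)"
proof -
  have C: "Ck k f" for k using f(1) by (simp add: smooth_def)
  have L: "L2w f" by (rule L2w_of_H1[OF H1 Ck_continuous[OF C[of 0]]])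
  have "2 * \<kappa> * sqnorm f \<le> energy f"
    using spectral_gap[OF C L L2w_partial_of_bounded_hessian[OF C f(2)] _ fx] f0
      integral_gibbs_wint[OF L2w_continuous[OF L]] by simp
  moreover have "(LINT x|gibbs V. (f x)^2) = sqnorm f"
    by (rule integral_gibbs_wint) (intro continuous_intros L2w_continuous[OF L])
  ultimately show ?thesis using integral_gradient_square[OF C f(2)] by simp
qed

end

section \<open>The Gaussian measure and the final theorem\<close>

lemma std_gaussian_eq_gibbs:
  "std_gaussian = gibbs (\<lambda>x::real^'n::finite. (1 / 2) * (norm x)^2 + real CARD('n) / 2 * ln (2 * pi))"
proof -
  have "(2 * pi) powr (- real CARD('n) / 2) * exp (- ((norm x)^2) / 2)
    = exp (- ((1 / 2) * (norm x)^2 + real CARD('n) / 2 * ln (2 * pi)))" for x :: "real^'n"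
    by (simp add: powr_def exp_add[symmetric])
  then show ?thesis by (simp add: std_gaussian_def gibbs_def)
qed

lemma gaussian_potential:
  defines "G \<equiv> \<lambda>x::real^'n::finite. (1 / 2) * (norm x)^2 + real CARD('n) / 2 * ln (2 * pi)"
  shows "gibbs_potential G 1" and "partial i G x = x $ i"
proof -
  have C: "Ck k G" for k unfolding G_def by (intro Ck_add Ck_cmult Ck_const Ck_norm_square)
  have N: "(\<lambda>x::real^'n. (norm x)^2) differentiable (at x)" for x
    using Ck_differentiable[OF Ck_norm_square] .
  have p: "partial i G x = x $ i" for i x
  proof -
    have c: "(\<lambda>x::real^'n. c) differentiable (at x)" for c x by simp
    have D: "(\<lambda>x::real^'n. (1 / 2) * (norm x)^2) differentiable (at x)" for x using N c by (rule differentiable_mult[rotated])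
    show ?thesis unfolding G_def partial_add[OF D c] partial_mult[OF c N] partial_norm_square by simp
  qed
  then show "partial i G x = x $ i" .
  have pG: "partial j G = (\<lambda>x. x $ j)" for j by (rule ext) (rule p)
  have "hessian G x = mat 1" for x
    by (simp add: hessian_def pG partial_component vec_eq_iff mat_def axis_def)
  then show "gibbs_potential G 1"
    by unfold_locales (auto simp: smooth_def C loewner_le_def)
qed

theorem corollary5p6:
  shows "(\<forall>(V :: real^'n::finite \<Rightarrow> real) (f :: real^'n \<Rightarrow> real) (\<kappa> :: real) (\<kappa>' :: real).
      smooth V \<and> prob_space (gibbs V) \<and> \<kappa> > 0 \<and> \<kappa>' > 0 \<and>
      (\<forall>x. loewner_le (mat \<kappa>) (hessian V x) \<and> loewner_le (hessian V x) (mat \<kappa>')) \<and>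
      f \<in> H1 (gibbs V) \<and> smooth f \<and> bounded (range (hessian f)) \<and>
      (LINT x|gibbs V. f x) = 0 \<and>
      (LINT x|gibbs V. f x *\<^sub>R x) = 0
      \<longrightarrow> \<kappa> * (1 + \<kappa> / \<kappa>') * (LINT x|gibbs V. (f x)\<^sup>2)
            \<le> (LINT x|gibbs V. (norm (gradient f x))\<^sup>2)) \<and>
    (\<forall>f :: real^'n \<Rightarrow> real.
      f \<in> H1 std_gaussian \<and> smooth f \<and> bounded (range (hessian f)) \<and>
      (LINT x|std_gaussian. f x) = 0 \<and>
      (LINT x|std_gaussian. gradient f x) = 0
      \<longrightarrow> 2 * (LINT x|std_gaussian. (f x)\<^sup>2)
            \<le> (LINT x|std_gaussian. (norm (gradient f x))\<^sup>2))"
proof (intro conjI allI impI)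
  fix V f :: "real^'n \<Rightarrow> real" and \<kappa> \<kappa>' :: real
  assume A: "smooth V \<and> prob_space (gibbs V) \<and> \<kappa> > 0 \<and> \<kappa>' > 0 \<and>
      (\<forall>x. loewner_le (mat \<kappa>) (hessian V x) \<and> loewner_le (hessian V x) (mat \<kappa>')) \<and>
      f \<in> H1 (gibbs V) \<and> smooth f \<and> bounded (range (hessian f)) \<and>
      (LINT x|gibbs V. f x) = 0 \<and> (LINT x|gibbs V. f x *\<^sub>R x) = 0"
  interpret gibbs_potential V \<kappa> using A by unfold_locales auto
  have fc: "continuous_on UNIV f" using A Ck_continuous[of 0 f] by (simp add: smooth_def)
  have L: "L2w f" using L2w_of_H1[OF _ fc] A by blast
  have "wint (\<lambda>x. f x * x $ i) = 0" for i
    using integral_gibbs_component[of "\<lambda>x. f x *\<^sub>R x" i] A L2w_mult_integrable[OF L L2w_component]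
    by (simp add: continuous_on_scaleR fc)
  then have "2 * \<kappa> * (LINT x|gibbs V. (f x)^2) \<le> (LINT x|gibbs V. (norm (gradient f x))^2)"
    using A by (intro spectral_gap_gibbs) auto
  moreover have "\<kappa> * (1 + \<kappa> / \<kappa>') * (LINT x|gibbs V. (f x)^2) \<le> 2 * \<kappa> * (LINT x|gibbs V. (f x)^2)"
  proof (intro mult_right_mono)
    have "axis i 1 \<bullet> (mat \<kappa> *v axis i 1) \<le> axis i 1 \<bullet> (mat \<kappa>' *v (axis i 1 :: real^'n))" for i
      using A by (auto simp: loewner_le_def intro: order_trans)
    \<comment> \<open>Comparing the two Hessian bounds on a single coordinate vector gives \<kappa>
      \<le> \<kappa>'; \<open>undefined\<close> serves as an arbitrary index.\<close>
    from this[of undefined] have "\<kappa> \<le> \<kappa>'"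
      unfolding mat_form by (simp add: axis_def if_distrib[of "\<lambda>a. a^2"] cong: if_cong)
    then have "\<kappa> / \<kappa>' \<le> 1" using A by simp
    then have "\<kappa> * (1 + \<kappa> / \<kappa>') \<le> \<kappa> * 2" using \<kappa>_pos by (intro mult_left_mono) auto
    then show "\<kappa> * (1 + \<kappa> / \<kappa>') \<le> 2 * \<kappa>" by simp
  qed (simp add: integral_nonneg_AE)
  ultimately show "\<kappa> * (1 + \<kappa> / \<kappa>') * (LINT x|gibbs V. (f x)^2) \<le> (LINT x|gibbs V. (norm (gradient f x))^2)"
    by (rule order_trans[rotated])
next
  fix f :: "real^'n \<Rightarrow> real"
  assume A: "f \<in> H1 std_gaussian \<and> smooth f \<and> bounded (range (hessian f)) \<and>
      (LINT x|std_gaussian. f x) = 0 \<and> (LINT x|std_gaussian. gradient f x) = 0"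
  define G where "G = (\<lambda>x::real^'n. (1 / 2) * (norm x)^2 + real CARD('n) / 2 * ln (2 * pi))"
  have std: "std_gaussian = gibbs G" unfolding G_def by (rule std_gaussian_eq_gibbs)
  interpret gibbs_potential G 1 unfolding G_def by (rule gaussian_potential(1))
  have pG: "partial i G x = x $ i" for i x unfolding G_def by (rule gaussian_potential(2))
  have C: "Ck k f" for k using A by (simp add: smooth_def)
  have fc: "continuous_on UNIV f" by (rule Ck_continuous[OF C[of 0]])
  have L: "L2w f" using L2w_of_H1[OF _ fc] A std by simp
  have Lp: "L2w (partial i f)" for i using L2w_partial_of_bounded_hessian[OF C] A by blast
  have gc: "continuous_on UNIV (gradient f)"
    unfolding gradient_def by (intro continuous_on_vec_lambda L2w_continuous[OF Lp])
  have "wint (partial i f) = 0" for i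
    using integral_gibbs_component[OF gc, of i] A L2w_integrable[OF Lp] by (simp add: std gradient_def)
  \<comment> \<open>The Gaussian potential has gradient x, so the mean of \<nabla>f is the first
    moment of f.\<close>
  moreover have "wint (partial i f) = wint (\<lambda>x. f x * x $ i)" for i
    using wint_partial[OF C L Lp, of i] L2w_mult_integrable[OF L L2w_component[of i]] by (simp add: pG)
  ultimately show "2 * (LINT x|std_gaussian. (f x)^2) \<le> (LINT x|std_gaussian. (norm (gradient f x))^2)"
    using spectral_gap_gibbs[of f] A by (simp add: std)
qed

end
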